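(* Let $\sigma>0$, $b\in\mathbb{R}^d$, and let $H$ be the RKHS on $\mathbb{R}^d$ of the kernel $k(x,y)=e^{(x-b)^\top(y-b)/\sigma^2}$ or of the kernel $k(x,y)=e^{-\|x-y\|^2/2\sigma^2}$. Let $F=(F_1,\dots,F_d):\mathbb{R}^d\to\mathbb{R}^d$ be of class $C^\infty$ and $p\in\mathbb{R}^d$ with $F(p)=0$ and $V_p\subset D(A_F)$. Let $\mu=\rho(x)\,\mathrm{d}x$ be a probability measure on $\mathbb{R}^d$ with compactly supported measurable density $\rho\ge0$, and suppose there is a rectangle $R(a,r)=\prod_{i=1}^d[a_i-r_i,a_i+r_i]$ with $a_i\in\mathbb{R}$, $r_i>0$, such that $\operatorname{ess\,inf}_{x\in R(a,r)}\rho(x)>0$. Let $x_1,x_2,\dots$ be i.i.d. with law $\mu$. Set $$B_1:=\sup_{x\in\mathrm{supp}(\rho)}\|x-p\|,\qquad B_2:=\sup_{i=1,\dots,d}\Big(1+\frac{|a_i-p_i|}{r_i}\Big).$$ Then for every integer $m\ge0$ there is a constant $C>0$ independent of $n$ such that for every integer $n\ge\max(m,1)$, almost surely, $$\limsup_{N\to\infty}\big\|\mathbf{A}_{F,m}^\star-\widehat{\mathbf{A}}_{m,n,N}\big\|\le\frac{C\,n^{m+d}}{\sqrt{(n+1)!}}\Big(\frac{2B_1B_2}{\sigma}\Big)^n .$$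
   Context: Conventions: $k_x:=k(x,\cdot)\in H$, $\langle h,k_x\rangle_H=h(x)$. $A_Fh:=\sum_{i=1}^dF_i\,\partial_{x_i}h$ with domain $D(A_F)=\{h\in H:\sum_iF_i\partial_{x_i}h\in H\}$ (generator of the Koopman operators of $\dot z=F(z)$); $A_F^*$ is its adjoint. $V_{p,n}:=\mathrm{span}\{\partial_x^\alpha k(x,\cdot)|_{x=p}:|\alpha|\le n\}\subset H$, $V_p:=\bigcup_nV_{p,n}$ (dense in $H$), $r_n:=\dim V_{p,n}$; $A_F^*$ maps $V_{p,n}$ into itself because $F(p)=0$. Fix a basis $\{v_i\}_{i\ge1}$ of $V_p$, orthogonal in $H$, such that $\{v_1,\dots,v_{r_n}\}$ is a basis of $V_{p,n}$ for every $n$. Put $\mathbf{v}_n(x):=(\overline{v_i(x)})_{i=1}^{r_n}$, $\mathbf{G}_n:=(\langle v_i,v_j\rangle_H)_{i,j=1}^{r_n}$ (diagonal), and, for $X_N=(x_1,\dots,x_N)$, $\mathbf{V}_n^{X_N}:=(\mathbf{v}_n(x_1),\dots,\mathbf{v}_n(x_N))\in\mathbb{C}^{r_n\times N}$ and $\mathbf{W}_m^{X_N,F(X_N)}:=\sum_{i=1}^d\big(F_i(x_1)\partial_{x_i}\mathbf{v}_m(x_1),\dots,F_i(x_N)\partial_{x_i}\mathbf{v}_m(x_N)\big)\in\mathbb{C}^{r_m\times N}$. The matrix $\widehat{\mathbf{A}}_{m,n,N}\in\mathbb{C}^{r_m\times r_m}$ consists of the first $r_m$ columns of $\mathbf{G}_m^{-1}\mathbf{W}_m^{X_N,F(X_N)}(\mathbf{V}_n^{X_N})^\dagger\mathbf{G}_n$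 ($\dagger$ = Moore–Penrose pseudo-inverse). $\mathbf{A}_{F,m}^\star$ is the matrix of $A_F^*|_{V_{p,m}}$ in the basis $\{v_1,\dots,v_{r_m}\}$. $\|\cdot\|$ on matrices is the Frobenius norm. *)

theory Defs
  imports
    "HOL-Probability.Probability"
    "HOL-Library.Function_Algebras"
    "Jordan_Normal_Form.Schur_Decomposition"
    "Jordan_Normal_Form.Gauss_Jordan_Elimination"
begin

(* Both libraries claim these symbols; below, $ and the inner product dot are those of HOL-Analysis. *)
no_notation Matrix.vec_index (infixl "$" 100)
no_notation Matrix.scalar_prod (infix "\<bullet>" 70)

section \<open>Complex-valued functions as a complex vector space\<close>

definition cscale :: "complex \<Rightarrow> ('a \<Rightarrow> complex) \<Rightarrow> 'a \<Rightarrow> complex" where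
  "cscale c f = (\<lambda>x. c * f x)"

global_interpretation cfun: vector_space "cscale :: complex \<Rightarrow> ('a \<Rightarrow> complex) \<Rightarrow> 'a \<Rightarrow> complex"
  by unfold_locales (auto simp: cscale_def fun_eq_iff algebra_simps)

definition is_basis_of :: "('a \<Rightarrow> complex) set \<Rightarrow> ('a \<Rightarrow> complex) set \<Rightarrow> bool" where
  "is_basis_of B U \<longleftrightarrow> \<not> cfun.dependent B \<and> cfun.span B = U"


section \<open>Reproducing kernel Hilbert spaces\<close>

text \<open>
  The inner product \<open>ip\<close> is linear in its first argument; its values outside \<open>H\<close> are irrelevant.
  By the Moore-Aronszajn theorem \<open>k\<close> determines \<open>H\<close>, and \<open>ip\<close> on \<open>H\<close>, uniquely.
\<close>

locale complex_rkhs =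
  fixes H :: "('a \<Rightarrow> complex) set"
    and ip :: "('a \<Rightarrow> complex) \<Rightarrow> ('a \<Rightarrow> complex) \<Rightarrow> complex"
    and k :: "'a \<Rightarrow> 'a \<Rightarrow> complex"
  assumes subspace: "cfun.subspace H"
    and ip_add: "\<And>f g h. f \<in> H \<Longrightarrow> g \<in> H \<Longrightarrow> h \<in> H \<Longrightarrow> ip (f + g) h = ip f h + ip g h"
    and ip_scale: "\<And>c f h. f \<in> H \<Longrightarrow> h \<in> H \<Longrightarrow> ip (cscale c f) h = c * ip f h"
    and ip_cnj: "\<And>f g. f \<in> H \<Longrightarrow> g \<in> H \<Longrightarrow> ip g f = cnj (ip f g)"
    and ip_nonneg: "\<And>f. f \<in> H \<Longrightarrow> 0 \<le> Re (ip f f)"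
    and ip_definite: "\<And>f. f \<in> H \<Longrightarrow> ip f f = 0 \<Longrightarrow> f = 0"
    and complete: "\<And>f. (\<And>j. f j \<in> H) \<Longrightarrow>
        (\<And>e. 0 < e \<Longrightarrow> \<exists>K. \<forall>i\<ge>K. \<forall>j\<ge>K. sqrt (Re (ip (f i - f j) (f i - f j))) < e) \<Longrightarrow>
        (\<exists>g\<in>H. (\<lambda>j. sqrt (Re (ip (f j - g) (f j - g)))) \<longlonglongrightarrow> 0)"
    and kernel_mem: "\<And>x. k x \<in> H"
    and reproducing: "\<And>h x. h \<in> H \<Longrightarrow> ip h (k x) = h x"

definition exponential_kernel :: "real \<Rightarrow> real ^ 'd \<Rightarrow> real ^ 'd \<Rightarrow> real ^ 'd \<Rightarrow> complex" where
  "exponential_kernel \<sigma> b x y = complex_of_real (exp (((x - b) \<bullet> (y - b)) / \<sigma>\<^sup>2))"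

definition gaussian_kernel :: "real \<Rightarrow> real ^ 'd \<Rightarrow> real ^ 'd \<Rightarrow> complex" where
  "gaussian_kernel \<sigma> x y = complex_of_real (exp (- (norm (x - y))\<^sup>2 / (2 * \<sigma>\<^sup>2)))"


section \<open>Partial derivatives\<close>

definition partial_deriv :: "'d \<Rightarrow> (real ^ 'd \<Rightarrow> 'b::real_normed_vector) \<Rightarrow> real ^ 'd \<Rightarrow> 'b" where
  "partial_deriv i f x = vector_derivative (\<lambda>t. f (x + t *\<^sub>R axis i 1)) (at 0)"

primrec Ck_fun :: "nat \<Rightarrow> (real ^ 'd \<Rightarrow> 'b::real_normed_vector) \<Rightarrow> bool" where
  "Ck_fun 0 f \<longleftrightarrow> continuous_on UNIV f"
| "Ck_fun (Suc k) f \<longleftrightarrow> continuous_on UNIV f \<and>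
     (\<forall>i. (\<forall>x. (\<lambda>t. f (x + t *\<^sub>R axis i 1)) differentiable (at 0)) \<and> Ck_fun k (partial_deriv i f))"

definition Cinf_fun :: "(real ^ 'd \<Rightarrow> 'b::real_normed_vector) \<Rightarrow> bool" where
  "Cinf_fun f \<longleftrightarrow> (\<forall>k. Ck_fun k f)"

text \<open>
  A multi-index is a function \<open>\<alpha>\<close> from the coordinates to \<open>nat\<close>. The index type carries no order, so
  the coordinates are processed in an arbitrary fixed order; for smooth functions it is immaterial.
\<close>

definition coords :: "'d::finite list" where
  "coords = (SOME xs. set xs = UNIV \<and> distinct xs)"

definition multi_deriv ::
    "('d \<Rightarrow> nat) \<Rightarrow> (real ^ 'd \<Rightarrow> 'b::real_normed_vector) \<Rightarrow> real ^ 'd \<Rightarrow> 'b" where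
  "multi_deriv \<alpha> f = foldr (\<lambda>i. partial_deriv i ^^ \<alpha> i) coords f"


section \<open>The Koopman generator, its adjoint, and the invariant subspaces\<close>

definition koopman_gen :: "(real ^ 'd \<Rightarrow> real ^ 'd) \<Rightarrow> (real ^ 'd \<Rightarrow> complex) \<Rightarrow> real ^ 'd \<Rightarrow> complex" where
  "koopman_gen F h = (\<lambda>x. \<Sum>i\<in>UNIV. complex_of_real (F x $ i) * partial_deriv i h x)"

definition koopman_dom ::
    "(real ^ 'd \<Rightarrow> complex) set \<Rightarrow> (real ^ 'd \<Rightarrow> real ^ 'd) \<Rightarrow> (real ^ 'd \<Rightarrow> complex) set" where
  "koopman_dom H F = {h \<in> H. koopman_gen F h \<in> H}"

text \<open>
  Adjoint of an operator \<open>A\<close> in \<open>H\<close> with dense domain \<open>D\<close>; meaningful only for those \<open>g\<close> for which a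
  suitable \<open>w\<close> exists (the domain of the adjoint), and then \<open>w\<close> is unique.
\<close>

definition adjoint_op ::
    "('a \<Rightarrow> complex) set \<Rightarrow> (('a \<Rightarrow> complex) \<Rightarrow> ('a \<Rightarrow> complex) \<Rightarrow> complex) \<Rightarrow> ('a \<Rightarrow> complex) set \<Rightarrow>
     (('a \<Rightarrow> complex) \<Rightarrow> 'a \<Rightarrow> complex) \<Rightarrow> ('a \<Rightarrow> complex) \<Rightarrow> 'a \<Rightarrow> complex" where
  "adjoint_op H ip D A g = (THE w. w \<in> H \<and> (\<forall>h\<in>D. ip (A h) g = ip h w))"

definition jet_space :: "(real ^ 'd \<Rightarrow> real ^ 'd \<Rightarrow> complex) \<Rightarrow> real ^ 'd \<Rightarrow> nat \<Rightarrow> (real ^ 'd \<Rightarrow> complex) set" where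
  "jet_space k p n =
     cfun.span {(\<lambda>y. multi_deriv \<alpha> (\<lambda>x. k x y) p) | \<alpha>. (\<Sum>i\<in>UNIV. \<alpha> i) \<le> n}"

text \<open>
  The sequence \<open>v\<close> is indexed from 0, so \<open>v i\<close> is the usual \<open>v_(i+1)\<close>; the first \<open>r_n\<close> elements form
  a basis of \<open>U n\<close>, where \<open>r_n\<close> is the dimension of \<open>U n\<close>.
\<close>

definition adapted_orthogonal_basis ::
    "(('a \<Rightarrow> complex) \<Rightarrow> ('a \<Rightarrow> complex) \<Rightarrow> complex) \<Rightarrow> (nat \<Rightarrow> ('a \<Rightarrow> complex) set) \<Rightarrow>
     (nat \<Rightarrow> 'a \<Rightarrow> complex) \<Rightarrow> bool" where
  "adapted_orthogonal_basis ip U v \<longleftrightarrow>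
     inj v \<and> is_basis_of (range v) (\<Union>n. U n) \<and>
     (\<forall>i j. i \<noteq> j \<longrightarrow> ip (v i) (v j) = 0) \<and>
     (\<forall>n. is_basis_of (v ` {..<cfun.dim (U n)}) (U n))"


section \<open>Matrices\<close>

definition frobenius_norm :: "complex mat \<Rightarrow> real" where
  "frobenius_norm A = sqrt (\<Sum>i<dim_row A. \<Sum>j<dim_col A. (cmod (A $$ (i, j)))\<^sup>2)"

definition pinv :: "complex mat \<Rightarrow> complex mat" where
  "pinv A = (THE B. B \<in> carrier_mat (dim_col A) (dim_row A) \<and>
     A * B * A = A \<and> B * A * B = B \<and>
     mat_adjoint (A * B) = A * B \<and> mat_adjoint (B * A) = B * A)"

definition first_cols :: "nat \<Rightarrow> complex mat \<Rightarrow> complex mat" where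
  "first_cols c A = mat (dim_row A) c (\<lambda>(i, j). A $$ (i, j))"

text \<open>Column \<open>j\<close> holds the coordinates of \<open>T (v j)\<close> with respect to \<open>v 0, \<dots>, v (r - 1)\<close>.\<close>

definition op_matrix :: "(('a \<Rightarrow> complex) \<Rightarrow> 'a \<Rightarrow> complex) \<Rightarrow> (nat \<Rightarrow> 'a \<Rightarrow> complex) \<Rightarrow> nat \<Rightarrow> complex mat" where
  "op_matrix T v r = mat r r (\<lambda>(i, j). cfun.representation (v ` {..<r}) (T (v j)) (v i))"

definition gram_matrix ::
    "(('a \<Rightarrow> complex) \<Rightarrow> ('a \<Rightarrow> complex) \<Rightarrow> complex) \<Rightarrow> (nat \<Rightarrow> 'a \<Rightarrow> complex) \<Rightarrow> nat \<Rightarrow> complex mat" where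
  "gram_matrix ip v r = mat r r (\<lambda>(i, j). ip (v i) (v j))"

definition V_matrix :: "(nat \<Rightarrow> 'a \<Rightarrow> complex) \<Rightarrow> nat \<Rightarrow> nat \<Rightarrow> (nat \<Rightarrow> 'a) \<Rightarrow> complex mat" where
  "V_matrix v r N x = mat r N (\<lambda>(i, j). cnj (v i (x j)))"

definition W_matrix ::
    "(real ^ 'd \<Rightarrow> real ^ 'd) \<Rightarrow> (nat \<Rightarrow> real ^ 'd \<Rightarrow> complex) \<Rightarrow> nat \<Rightarrow> nat \<Rightarrow>
     (nat \<Rightarrow> real ^ 'd) \<Rightarrow> complex mat" where
  "W_matrix F v r N x = mat r N (\<lambda>(i, j).
     \<Sum>l\<in>UNIV. complex_of_real (F (x j) $ l) * partial_deriv l (\<lambda>y. cnj (v i y)) (x j))"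

text \<open>The estimator; \<open>rm\<close> and \<open>rn\<close> stand for \<open>r_m\<close> and \<open>r_n\<close>, and \<open>x 0, \<dots>, x (N - 1)\<close> are the samples.\<close>

definition A_hat ::
    "((real ^ 'd \<Rightarrow> complex) \<Rightarrow> (real ^ 'd \<Rightarrow> complex) \<Rightarrow> complex) \<Rightarrow> (real ^ 'd \<Rightarrow> real ^ 'd) \<Rightarrow>
     (nat \<Rightarrow> real ^ 'd \<Rightarrow> complex) \<Rightarrow> nat \<Rightarrow> nat \<Rightarrow> nat \<Rightarrow> (nat \<Rightarrow> real ^ 'd) \<Rightarrow> complex mat" where
  "A_hat ip F v rm rn N x = first_cols rm
     (the (mat_inverse (gram_matrix ip v rm)) * W_matrix F v rm N x *
      pinv (V_matrix v rn N x) * gram_matrix ip v rn)"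


section \<open>Densities\<close>

definition supp :: "('a::topological_space \<Rightarrow> real) \<Rightarrow> 'a set" where
  "supp \<rho> = closure {x. \<rho> x \<noteq> 0}"

definition rectangle :: "real ^ 'd \<Rightarrow> real ^ 'd \<Rightarrow> (real ^ 'd) set" where
  "rectangle a r = {x. \<forall>i. a $ i - r $ i \<le> x $ i \<and> x $ i \<le> a $ i + r $ i}"

definition essinf :: "'a measure \<Rightarrow> ('a \<Rightarrow> ereal) \<Rightarrow> ereal" where
  "essinf M f = - esssup M (\<lambda>x. - f x)"

end

theory Submission
  imports Defs "HOL-Complex_Analysis.Complex_Analysis"
begin


text \<open>
  Almost surely the estimator converges, as \<open>N\<close> tends to infinity, to the matrix obtained by replacing the
  \<open>H\<close>-orthogonal projection of \<open>A\<^sub>F v\<^sub>i\<close> onto \<open>V\<^sub>p\<^sub>,\<^sub>n\<close> by the \<open>L\<^sup>2(\<mu>)\<close>-orthogonal one. The two projections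
  differ by the \<open>L\<^sup>2(\<mu>)\<close>-projection \<open>f\<close> of some \<open>e \<in> H\<close> vanishing to order \<open>n\<close> at \<open>p\<close>, and on the support
  of \<open>\<rho>\<close> such an \<open>e\<close> is at most a constant times \<open>(B\<^sub>1 / \<sigma>)\<^sup>n / sqrt ((n + 1)!)\<close>. The matrix entries only
  see the \<open>m\<close>-jet of \<open>f\<close> at \<open>p\<close>. Up to a positive weight \<open>f\<close> is a polynomial of degree at most \<open>n\<close>, so
  Bernstein's inequality on the lines through \<open>p\<close> that meet the rectangle bounds this jet by a constant
  times \<open>(2 B\<^sub>2)\<^sup>n\<close> times the \<open>L\<^sup>1\<close> norm of \<open>f\<close> over the rectangle, where \<open>\<rho>\<close> is bounded below.
\<close>

(* FPS coefficients would make the vector component notation ambiguous. *)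
no_notation fps_nth (infixl "$" 75)

section \<open>Extrapolation of polynomials in one variable\<close>

text \<open>The base \<open>2 * B2\<close> has to come out exactly, so the extrapolation may lose
  constants but no factor growing geometrically in n. On a line p + s (y - p), with y near the
  centre a, values are known for s near 1, while the jet is wanted at s = 0. The line stays in the
  rectangle for |s - 1| \<le> \<eta> as soon as \<eta> (B2 - 1) < 1, with room to spare. Rescaling
  this interval to [-1, 1] puts s = 0 at distance 1/\<eta> from the centre, and the ellipse with
  foci -1 and 1 through that point belongs to R + 1/R = 2/\<eta>. The choice R = 2 * B2 leaves room
  twice: for a disc of fixed radius about the point, where Cauchy's estimate costs a constant
  independent of n, and for a box of fixed size around a from which y may be taken.

  Elements of H are given only through the reproducing property. All calculus on them goes through
  their pairings with explicit homogeneous functions \<open>pw q j u\<close>: at every base point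
  these pairings are the Taylor coefficients of the element divided by a positive weight, and at p
  orthogonality to \<open>jet_space k p n\<close> makes those of degree at most n vanish.\<close>

lemma poly_altdef_le:
  fixes P :: "'a::comm_ring_1 poly"
  assumes "degree P \<le> N"
  shows "poly P x = (\<Sum>i\<le>N. coeff P i * x ^ i)"
  unfolding poly_altdef by (rule sum.mono_neutral_left) (use assms in \<open>auto simp: coeff_eq_0\<close>)

text \<open>The Joukowski map w -> (w + 1/w)/2 sends the unit circle onto [-1, 1]. Multiplying by
  w^N clears the pole at 0, so \<open>Q\<close> is a polynomial and the maximum modulus principle on
  the unit disc applies to it.\<close>

lemma norm_poly_Joukowski_le:
  fixes P :: "complex poly" and w :: complex
  assumes "degree P \<le> N" and bd: "\<And>t. \<bar>t\<bar> \<le> 1 \<Longrightarrow> norm (poly P (complex_of_real t)) \<le> M"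
    and w: "norm w \<le> 1" "w \<noteq> 0"
  shows "norm (poly P ((w + inverse w) / 2)) \<le> M * (1 / norm w) ^ N"
proof -
  define Q where "Q z = (\<Sum>i\<le>N. coeff P i * (z ^ (N - i) * ((z\<^sup>2 + 1) / 2) ^ i))" for z
  have Q: "Q z = z ^ N * poly P ((z + inverse z) / 2)" if "z \<noteq> 0" for z
  proof -
    have "z ^ (N - i) * ((z\<^sup>2 + 1) / 2) ^ i = z ^ N * ((z + inverse z) / 2) ^ i" if "i \<le> N" for i
    proof -
      have "(z\<^sup>2 + 1) / 2 = z * ((z + inverse z) / 2)"
        using \<open>z \<noteq> 0\<close> by (simp add: field_simps power2_eq_square)
      then have "((z\<^sup>2 + 1) / 2) ^ i = z ^ i * ((z + inverse z) / 2) ^ i"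
        by (simp only: power_mult_distrib)
      moreover have "z ^ (N - i) * z ^ i = z ^ N"
        using that by (simp add: power_add[symmetric])
      ultimately show ?thesis by (simp add: mult.assoc[symmetric])
    qed
    then have "Q z = (\<Sum>i\<le>N. z ^ N * (coeff P i * ((z + inverse z) / 2) ^ i))"
      unfolding Q_def by (intro sum.cong) (auto simp: mult_ac)
    also have "\<dots> = z ^ N * poly P ((z + inverse z) / 2)"
      using poly_altdef_le[OF assms(1)] by (simp add: sum_distrib_left)
    finally show ?thesis .
  qed
  have "norm (Q w) \<le> M"
  proof (rule maximum_modulus_frontier[where S = "cball 0 1" and f = Q])
    show "Q holomorphic_on interior (cball 0 1)" "continuous_on (closure (cball 0 1)) Q"
      unfolding Q_def by (intro holomorphic_intros continuous_intros, simp)+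
    fix z :: complex assume "z \<in> frontier (cball 0 1)"
    then have nz: "norm z = 1" by (simp add: frontier_cball)
    then have "z \<noteq> 0" by auto
    have "z * cnj z = 1" using nz by (simp add: complex_norm_square[symmetric])
    then have "inverse z = cnj z" by (metis inverse_unique)
    then have "(z + inverse z) / 2 = of_real (Re z)"
      by (simp add: complex_add_cnj)
    then show "norm (Q z) \<le> M"
      using Q[OF \<open>z \<noteq> 0\<close>] bd[of "Re z"] abs_Re_le_cmod[of z] nz by (simp add: norm_mult norm_power)
  qed (use w in auto)
  then have "norm w ^ N * norm (poly P ((w + inverse w) / 2)) \<le> M"
    using Q[OF w(2)] by (simp add: norm_mult norm_power)
  then show ?thesis using w by (simp add: field_simps power_divide)
qed

text \<open>The roots \<open>z + s\<close> and \<open>z - s\<close> of w^2 - 2zw + 1 have product 1,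
  so one of them is a Joukowski preimage w of z with 0 < |w| \<le> 1. The distances of z to the foci
  -1 and 1 add up to |w| + 1/|w|, and x + 1/x increases for x \<ge> 1, whence 1/|w| \<le> R.\<close>

lemma Bernstein_ellipse:
  fixes P :: "complex poly" and z :: complex
  assumes deg: "degree P \<le> N" and bd: "\<And>t. \<bar>t\<bar> \<le> 1 \<Longrightarrow> norm (poly P (complex_of_real t)) \<le> M"
    and R: "1 \<le> R" "norm (z - 1) + norm (z + 1) \<le> R + 1 / R"
  shows "norm (poly P z) \<le> M * R ^ N"
proof -
  define s where "s = csqrt (z\<^sup>2 - 1)"
  have s: "(z + s) * (z - s) = 1"
    by (simp add: s_def algebra_simps power2_eq_square[symmetric])
  obtain w where w: "norm w \<le> 1" "w \<noteq> 0" "z = (w + inverse w) / 2"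
  proof (cases "norm (z + s) \<le> 1")
    case True
    moreover have "z + s \<noteq> 0" using s by auto
    moreover have "inverse (z + s) = z - s" using s by (metis inverse_unique)
    ultimately show ?thesis using that[of "z + s"] by simp
  next
    case False
    have "norm (z + s) * norm (z - s) = 1" using s by (metis norm_mult norm_one)
    then have "norm (z - s) \<le> 1" using False
      using mult_mono[of 1 "norm (z + s)" "norm (z - s)" "norm (z - s)"] by linarith
    moreover have "z - s \<noteq> 0" using s by auto
    moreover have "inverse (z - s) = z + s" using s by (metis inverse_unique mult.commute)
    ultimately show ?thesis using that[of "z - s"] by simp
  qed
  have M0: "0 \<le> M" using bd[of 0] norm_ge_zero by (metis abs_zero order_trans zero_le_one)
  have e1: "z + 1 = (w + 1)\<^sup>2 / (2 * w)" "z - 1 = (w - 1)\<^sup>2 / (2 * w)"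
    using w by (auto simp: field_simps power2_eq_square)
  have "(norm (w + 1))\<^sup>2 + (norm (w - 1))\<^sup>2 = 2 * (norm w)\<^sup>2 + 2"
    unfolding cmod_power2 by (simp add: power2_eq_square algebra_simps)
  moreover have "norm (z - 1) + norm (z + 1) = ((norm (w + 1))\<^sup>2 + (norm (w - 1))\<^sup>2) / (2 * norm w)"
    unfolding e1 by (simp add: norm_divide norm_power norm_mult add_divide_distrib)
  ultimately have "norm (z - 1) + norm (z + 1) = norm w + 1 / norm w"
    using w(2) by (simp add: field_simps power2_eq_square)
  then have le: "1 / norm w + norm w \<le> R + 1 / R" using R by simp
  have "1 / norm w \<le> R"
  proof (rule ccontr)
    let ?r = "1 / norm w"
    assume "\<not> ?r \<le> R"
    then have r: "R < ?r" by simp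
    have "(?r + 1 / ?r) - (R + 1 / R) = (?r - R) * (1 - 1 / (?r * R))"
    proof -
      have "(x + 1 / x) - (R + 1 / R) = (x - R) * (1 - 1 / (x * R))" if "x > 0" for x
        using that R by (simp add: field_simps)
      then show ?thesis using r R by (smt (verit))
    qed
    moreover have "1 < ?r * R" using r R less_1_mult[of ?r R] by (cases "R = 1") auto
    then have "1 / (?r * R) < 1" by (subst divide_less_eq_1_pos) auto
    then have "1 - 1 / (?r * R) > 0" by linarith
    ultimately have "(?r + 1 / ?r) - (R + 1 / R) > 0" using r by simp
    then show False using le by simp
  qed
  then have "(1 / norm w) ^ N \<le> R ^ N" by (intro power_mono) auto
  then show ?thesis
    using norm_poly_Joukowski_le[OF deg bd w(1,2)] w(3) M0 by (meson mult_left_mono order_trans)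
qed

lemma deriv_poly: "deriv (poly P) = poly (pderiv P)" for P :: "complex poly"
  by (intro ext DERIV_imp_deriv poly_DERIV)

lemma higher_deriv_poly_0: "(deriv ^^ k) (poly P) 0 = fact k * coeff P k" for P :: "complex poly"
proof -
  have "(deriv ^^ k) (poly P) = poly ((pderiv ^^ k) P)"
    by (induction k) (auto simp: deriv_poly)
  then show ?thesis
    by (simp add: poly_0_coeff_0 coeff_higher_pderiv pochhammer_fact)
qed

text \<open>Bernstein's inequality on a disc around the extrapolation point, followed by Cauchy's estimate.\<close>

lemma coeff_pcompose_le:
  fixes P :: "complex poly"
  assumes deg: "degree P \<le> N" and bd: "\<And>t. \<bar>t\<bar> \<le> 1 \<Longrightarrow> norm (poly P (complex_of_real t)) \<le> M"
    and R: "1 \<le> R" "2 * (max 1 \<bar>t0\<bar> + \<delta>) \<le> R + 1 / R" and "0 < \<delta>"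
  shows "norm (coeff (pcompose P [:complex_of_real t0, 1:]) k) \<le> M * R ^ N / \<delta> ^ k"
proof -
  let ?Q = "pcompose P [:complex_of_real t0, 1:]"
  have "norm ((deriv ^^ k) (poly ?Q) 0) \<le> fact k * (M * R ^ N) / \<delta> ^ k"
  proof (rule Cauchy_inequality)
    fix x :: complex assume x: "norm (0 - x) = \<delta>"
    have "norm (of_real t0 + x - 1) \<le> \<bar>t0 - 1\<bar> + \<delta>"
      using norm_triangle_ineq[of "of_real t0 - 1" x] norm_of_real[of "t0 - 1", where 'a = complex] x
      by (simp add: add.assoc add.commute[of _ x] diff_add_eq add_diff_eq)
    moreover have "norm (of_real t0 + x + 1) \<le> \<bar>t0 + 1\<bar> + \<delta>"
      using norm_triangle_ineq[of "of_real t0 + 1" x] norm_of_real[of "t0 + 1", where 'a = complex] x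
      by (simp add: add.assoc add.commute[of _ x] diff_add_eq add_diff_eq)
    moreover have "norm (of_real t0 + x - 1) + norm (of_real t0 + x + 1) \<le> R + 1 / R"
    proof -
      have "\<bar>t0 - 1\<bar> + \<bar>t0 + 1\<bar> \<le> 2 * max 1 \<bar>t0\<bar>" by linarith
      then show ?thesis using R(2) calculation by argo
    qed
    ultimately show "norm (poly ?Q x) \<le> M * R ^ N"
      using Bernstein_ellipse[OF deg bd R(1)] by (simp add: poly_pcompose)
  next
    show "poly ?Q holomorphic_on ball 0 \<delta>"
      using poly_holomorphic_on[of "\<lambda>x. x" "ball 0 \<delta>" ?Q] by simp
    show "continuous_on (cball 0 \<delta>) (poly ?Q)"
      by (intro continuous_on_poly continuous_on_id)
  qed (rule \<open>0 < \<delta>\<close>)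
  then show ?thesis by (simp add: higher_deriv_poly_0 norm_mult flip: times_divide_eq_right)
qed

text \<open>Rescaling to [-1, 1] reduces this to \<open>coeff_pcompose_le\<close> about the centre
  of the interval. It is used with n fixed and t varying, where 2^n * 4^k is a constant.\<close>

lemma coeff_bound_interval:
  fixes c :: "nat \<Rightarrow> complex"
  assumes "t > 0" and bd: "\<And>s. \<bar>s\<bar> \<le> t \<Longrightarrow> norm (\<Sum>j\<le>n. of_real s ^ j * c j) \<le> M" and "k \<le> n"
  shows "norm (c k) * t ^ k \<le> M * 2 ^ n * 4 ^ k"
proof -
  define P where "P = (\<Sum>j\<le>n. monom (c j * of_real t ^ j) j)"
  have deg: "degree P \<le> n" unfolding P_def
    by (intro degree_sum_le) (auto intro: order_trans[OF degree_monom_le])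
  have "norm (poly P (of_real s)) \<le> M" if "\<bar>s\<bar> \<le> 1" for s
  proof -
    have "poly P (of_real s) = (\<Sum>j\<le>n. of_real (s * t) ^ j * c j)"
      by (simp add: P_def poly_sum poly_monom power_mult_distrib mult_ac)
    moreover have "\<bar>s * t\<bar> \<le> t" using that \<open>t > 0\<close> by (simp add: abs_mult mult_left_le_one_le)
    ultimately show ?thesis using bd by metis
  qed
  \<comment> \<open>R = 2, t0 = 0, \<delta> = 1/4 give equality in the hypothesis: 2 (1 + 1/4) = 2 +
    1/2.\<close>
  from coeff_pcompose_le[OF deg this, of 2 0 "1/4" k]
  have "norm (coeff P k) \<le> M * 2 ^ n * 4 ^ k" by (simp add: power_divide)
  moreover have "coeff P k = c k * of_real t ^ k"
    using \<open>k \<le> n\<close> by (simp add: P_def coeff_sum)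
  ultimately show ?thesis using \<open>t > 0\<close> by (simp add: norm_mult norm_power)
qed

text \<open>Uniqueness of Taylor polynomials: on [-t, t] the sum is at most C t^(n+1), so
  \<open>coeff_bound_interval\<close> bounds \<open>d j\<close> by a multiple of t^(n+1-j), which
  tends to 0 with t.\<close>

lemma coeff_0_if_vanishing:
  fixes d :: "nat \<Rightarrow> complex"
  assumes "0 < \<epsilon>" "\<And>s. \<bar>s\<bar> \<le> \<epsilon> \<Longrightarrow> norm (\<Sum>i\<le>n. of_real s ^ i * d i) \<le> C * \<bar>s\<bar> ^ Suc n" "j \<le> n"
  shows "d j = 0"
proof -
  have "0 \<le> C * \<epsilon> ^ Suc n"
    using order_trans[OF norm_ge_zero assms(2)[of \<epsilon>]] assms(1) by (simp del: power_Suc)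
  then have C: "C \<ge> 0" using zero_less_power[OF assms(1), of "Suc n"] by (simp add: zero_le_mult_iff del: power_Suc)
  define K where "K = C * 2 ^ n * 4 ^ j"
  have le: "norm (d j) \<le> K * t" if t: "0 < t" "t \<le> min 1 \<epsilon>" for t
  proof -
    have "norm (d j) * t ^ j \<le> (C * t ^ Suc n) * 2 ^ n * 4 ^ j"
    proof (rule coeff_bound_interval[OF t(1) _ \<open>j \<le> n\<close>])
      fix s assume s: "\<bar>s\<bar> \<le> t"
      have "norm (\<Sum>i\<le>n. of_real s ^ i * d i) \<le> C * \<bar>s\<bar> ^ Suc n" using s t by (intro assms) auto
      also have "\<dots> \<le> C * t ^ Suc n" using s C by (intro mult_left_mono power_mono) auto
      finally show "norm (\<Sum>i\<le>n. of_real s ^ i * d i) \<le> C * t ^ Suc n" .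
    qed
    also have "\<dots> = K * t ^ (Suc n - j) * t ^ j" using \<open>j \<le> n\<close> by (simp add: K_def mult_ac power_add[symmetric])
    finally have "norm (d j) \<le> K * t ^ (Suc n - j)" using t by simp
    also have "\<dots> \<le> K * t ^ 1"
      using t \<open>j \<le> n\<close> C unfolding K_def by (intro mult_left_mono power_decreasing) auto
    finally show ?thesis by simp
  qed
  have "((\<lambda>t. K * t) \<longlongrightarrow> K * 0) (at_right 0)" by (intro tendsto_intros)
  then have "norm (d j) \<le> K * 0"
  proof (rule tendsto_lowerbound)
    show "\<forall>\<^sub>F t in at_right 0. norm (d j) \<le> K * t"
      unfolding eventually_at_right_field using le assms(1) by (auto intro!: exI[of _ "min 1 \<epsilon>"])
  qed simp
  then show ?thesis by simp
qed

text \<open>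
  Applying \<open>coeff_pcompose_le\<close> to a primitive replaces the supremum norm by the \<open>L\<^sup>1\<close> norm. The value of
  \<open>\<eta>\<close> gives equality in its hypothesis on \<open>R = 2 * B\<close>, with \<open>t0 = - 1 / \<eta>\<close> and \<open>\<delta> = 1 / (8 * B)\<close>.
\<close>

lemma coeff_le_integral:
  fixes c :: "nat \<Rightarrow> complex"
  assumes B: "1 \<le> B" and \<eta>: "\<eta> = 1 / (B + 1 / (8 * B))" and "k \<le> n"
  shows "norm (c k) \<le> (real k + 1) * (8 * B / \<eta>) ^ (k + 1) * (2 * B) ^ (n + 1) *
    integral {1 - \<eta>..1 + \<eta>} (\<lambda>s. norm (\<Sum>j\<le>n. of_real s ^ j * c j))"
proof -
  let ?\<phi> = "\<lambda>s. \<Sum>j\<le>n. of_real s ^ j * c j"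
  let ?I = "integral {1 - \<eta>..1 + \<eta>} (\<lambda>s. norm (?\<phi> s))"
  have \<eta>0: "0 < \<eta>" using B unfolding \<eta> by (simp add: add_pos_pos)
  have "1 \<le> B + 1 / (8 * B)" using B by (simp add: add_increasing2)
  then have \<eta>1: "1 \<le> 1 / \<eta>" by (simp add: \<eta>)
  define \<Phi> where "\<Phi> = (\<Sum>j\<le>n. monom (c j / of_nat (Suc j)) (Suc j))"
  \<comment> \<open>P(t) = \<Phi>(1 + \<eta> t) - \<Phi>(1 - \<eta>): the interval [-1, 1]
    parametrises the domain of integration, |P| is at most the integral there, and t = -1/\<eta> is
    the point s = 0.\<close>
  define P where "P = pcompose (\<Phi> - [:poly \<Phi> (of_real (1 - \<eta>)):]) [:1, of_real \<eta>:]"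
  have "degree \<Phi> \<le> n + 1" unfolding \<Phi>_def
    by (intro degree_sum_le) (auto intro: order_trans[OF degree_monom_le])
  then have "degree (\<Phi> - [:poly \<Phi> (of_real (1 - \<eta>)):]) \<le> n + 1"
    by (intro degree_diff_le) auto
  then have deg: "degree P \<le> n + 1"
    unfolding P_def using degree_pcompose_le[of "\<Phi> - [:poly \<Phi> (of_real (1 - \<eta>)):]" "[:1, of_real \<eta>:]"] \<eta>0
    by simp
  have der: "((\<lambda>s. poly \<Phi> (of_real s)) has_vector_derivative ?\<phi> s) (at s within S)" for s :: real and S
  proof -
    have "((\<lambda>s. \<Sum>j\<le>n. (c j / of_nat (Suc j)) * of_real s ^ Suc j) has_vector_derivative
      (\<Sum>j\<le>n. (c j / of_nat (Suc j)) * (of_nat (Suc j) * of_real s ^ j))) (at s within S)"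
    proof (intro has_vector_derivative_sum has_vector_derivative_mult_right has_vector_derivative_real_field)
      fix j
      show "((\<lambda>z. z ^ Suc j) has_field_derivative of_nat (Suc j) * of_real s ^ j) (at (of_real s :: complex))"
        by (rule DERIV_cong[OF DERIV_power_Suc[OF DERIV_ident]]) simp
    qed
    moreover have "(\<Sum>j\<le>n. (c j / of_nat (Suc j)) * (of_nat (Suc j) * of_real s ^ j)) = ?\<phi> s"
      by (intro sum.cong) (auto simp del: of_nat_Suc)
    moreover have "poly \<Phi> (of_real s) = (\<Sum>j\<le>n. (c j / of_nat (Suc j)) * of_real s ^ Suc j)" for s
      by (simp only: \<Phi>_def poly_sum poly_monom)
    ultimately show ?thesis by simp
  qed
  have bd: "norm (poly P (of_real t)) \<le> ?I" if t: "\<bar>t\<bar> \<le> 1" for t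
  proof -
    let ?s = "1 + \<eta> * t"
    have s: "1 - \<eta> \<le> ?s" "?s \<le> 1 + \<eta>"
    proof -
      have "\<bar>\<eta> * t\<bar> \<le> \<eta>" using t \<eta>0 by (simp add: abs_mult mult_left_le)
      then show "1 - \<eta> \<le> ?s" "?s \<le> 1 + \<eta>" by linarith+
    qed
    have "(?\<phi> has_integral (poly \<Phi> (of_real ?s) - poly \<Phi> (of_real (1 - \<eta>)))) {1 - \<eta>..?s}"
      by (rule fundamental_theorem_of_calculus[OF s(1)]) (rule der)
    moreover have "poly P (of_real t) = poly \<Phi> (of_real ?s) - poly \<Phi> (of_real (1 - \<eta>))"
      by (simp add: P_def poly_pcompose mult.commute)
    ultimately have "poly P (of_real t) = integral {1 - \<eta>..?s} ?\<phi>"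
      by (simp add: integral_unique)
    also have "norm \<dots> \<le> integral {1 - \<eta>..?s} (\<lambda>s. norm (?\<phi> s))"
      by (intro integral_norm_bound_integral integrable_continuous_real continuous_intros) auto
    also have "\<dots> \<le> ?I"
      using s by (intro integral_subset_le integrable_continuous_real continuous_intros) auto
    finally show ?thesis .
  qed
  \<comment> \<open>The index is k + 1 because P comes from a primitive: \<open>c k\<close> is k + 1
    times the coefficient of degree k + 1 of \<Phi>. The degree of P is n + 1 for the same
    reason.\<close>
  have "norm (coeff (pcompose P [:of_real (- 1 / \<eta>), 1:]) (Suc k)) \<le> ?I * (2 * B) ^ (n + 1) / (1 / (8 * B)) ^ Suc k"
  proof (rule coeff_pcompose_le[OF deg bd])
    show "2 * (max 1 \<bar>- 1 / \<eta>\<bar> + 1 / (8 * B)) \<le> 2 * B + 1 / (2 * B)"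
      using \<eta>1 \<eta>0 B by (simp add: max_def) (simp add: \<eta> field_simps)
  qed (use B in auto)
  moreover have "pcompose P [:of_real (- 1 / \<eta>), 1:] = pcompose (\<Phi> - [:poly \<Phi> (of_real (1 - \<eta>)):]) [:0, of_real \<eta>:]"
    using \<eta>0 by (simp add: P_def pcompose_assoc[symmetric] pcompose_pCons field_simps)
  moreover have "coeff \<Phi> (Suc k) = c k / of_nat (Suc k)"
    using \<open>k \<le> n\<close> by (simp add: \<Phi>_def coeff_sum)
  ultimately have "norm (c k) / (real k + 1) * \<eta> ^ Suc k \<le> ?I * (2 * B) ^ (n + 1) * (8 * B) ^ Suc k"
    using \<eta>0 by (simp add: coeff_pcompose_linear norm_mult norm_divide norm_power power_divide
        add.commute mult.commute del: power_Suc of_nat_Suc flip: of_nat_Suc)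
  then show ?thesis using \<eta>0
    by (simp add: field_simps power_divide)
qed


section \<open>Reproducing kernel Hilbert spaces\<close>

lemma sum_fun_apply: "(\<Sum>i\<in>I. f i) x = (\<Sum>i\<in>I. f i x)" for f :: "'i \<Rightarrow> 'a \<Rightarrow> 'b::comm_monoid_add"
  by (induction I rule: infinite_finite_induct) auto

lemma cscale_apply [simp]: "cscale c f x = c * f x"
  by (simp add: cscale_def)

context complex_rkhs
begin

lemma zero_mem: "0 \<in> H" and add_mem: "f \<in> H \<Longrightarrow> g \<in> H \<Longrightarrow> f + g \<in> H"
  and scale_mem: "f \<in> H \<Longrightarrow> cscale c f \<in> H" and diff_mem: "f \<in> H \<Longrightarrow> g \<in> H \<Longrightarrow> f - g \<in> H"
  using subspace by (auto intro: cfun.subspace_0 cfun.subspace_add cfun.subspace_scale cfun.subspace_diff)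

lemma sum_mem: "(\<And>i. i \<in> I \<Longrightarrow> f i \<in> H) \<Longrightarrow> (\<Sum>i\<in>I. f i) \<in> H"
  using subspace by (rule cfun.subspace_sum)

lemmas mem_intros = zero_mem add_mem scale_mem diff_mem sum_mem kernel_mem

lemma ip_zero_left: "h \<in> H \<Longrightarrow> ip 0 h = 0"
  using ip_scale[of 0 h 0] zero_mem by simp

lemma ip_diff: "f \<in> H \<Longrightarrow> g \<in> H \<Longrightarrow> h \<in> H \<Longrightarrow> ip (f - g) h = ip f h - ip g h"
  using ip_add[of "f - g" g h] by (simp add: diff_mem)

lemma ip_sum: "(\<And>i. i \<in> I \<Longrightarrow> f i \<in> H) \<Longrightarrow> h \<in> H \<Longrightarrow> ip (\<Sum>i\<in>I. f i) h = (\<Sum>i\<in>I. ip (f i) h)"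
  by (induction I rule: infinite_finite_induct) (auto simp: ip_zero_left ip_add sum_mem)

lemma ip_scale_right: "f \<in> H \<Longrightarrow> h \<in> H \<Longrightarrow> ip h (cscale c f) = cnj c * ip h f"
  using ip_cnj[of "cscale c f" h] ip_cnj[of f h] by (simp add: scale_mem ip_scale)

lemma ip_diff_right: "f \<in> H \<Longrightarrow> g \<in> H \<Longrightarrow> h \<in> H \<Longrightarrow> ip h (f - g) = ip h f - ip h g"
  using ip_cnj[of "f - g" h] ip_cnj[of f h] ip_cnj[of g h] by (simp add: diff_mem ip_diff)

lemma ip_sum_right: "(\<And>i. i \<in> I \<Longrightarrow> f i \<in> H) \<Longrightarrow> h \<in> H \<Longrightarrow> ip h (\<Sum>i\<in>I. f i) = (\<Sum>i\<in>I. ip h (f i))"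
  using ip_cnj[of "\<Sum>i\<in>I. f i" h] ip_cnj[of _ h] by (simp add: sum_mem ip_sum)

definition nrm :: "('a \<Rightarrow> complex) \<Rightarrow> real" where
  "nrm f = sqrt (Re (ip f f))"

lemma nrm_nonneg: "f \<in> H \<Longrightarrow> 0 \<le> nrm f"
  by (simp add: nrm_def ip_nonneg)

lemma ip_self: "f \<in> H \<Longrightarrow> ip f f = of_real ((nrm f)\<^sup>2)"
  using ip_cnj[of f f] ip_nonneg[of f] by (auto simp: nrm_def complex_eq_iff)

lemma Cauchy_Schwarz:
  assumes [simp]: "f \<in> H" "g \<in> H"
  shows "cmod (ip f g) \<le> nrm f * nrm g"
proof (cases "g = 0")
  case True
  then show ?thesis using ip_cnj[of g f] by (simp add: ip_zero_left nrm_nonneg zero_mem)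
next
  case False
  then have "ip g g \<noteq> 0" using ip_definite by auto
  then have g: "nrm g > 0" using ip_self[of g] nrm_nonneg[of g] by fastforce
  define c where "c = ip f g / ip g g"
  let ?h = "f - cscale c g"
  have [simp]: "cscale c g \<in> H" by (intro mem_intros assms)
  have [simp]: "?h \<in> H" by (intro mem_intros assms)
  have "ip ?h g = 0"
    using \<open>ip g g \<noteq> 0\<close> by (simp add: ip_diff ip_scale) (simp add: c_def)
  then have "ip ?h ?h = ip f f - c * ip g f"
    by (simp add: ip_diff_right ip_scale_right) (simp add: ip_diff ip_scale)
  also have "c * ip g f = of_real ((cmod (ip f g))\<^sup>2 / (nrm g)\<^sup>2)"
    using ip_cnj[of f g] by (simp add: c_def ip_self complex_norm_square[unfolded of_real_power])
  finally have e: "ip ?h ?h = ip f f - of_real ((cmod (ip f g))\<^sup>2 / (nrm g)\<^sup>2)" .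
  have "0 \<le> (nrm f)\<^sup>2 - (cmod (ip f g))\<^sup>2 / (nrm g)\<^sup>2"
    using ip_nonneg[of ?h, unfolded e] ip_self[of f] by simp
  then have "(cmod (ip f g))\<^sup>2 \<le> (nrm f * nrm g)\<^sup>2"
    using g by (simp add: field_simps power_mult_distrib)
  then show ?thesis by (rule power2_le_imp_le) (simp add: nrm_nonneg)
qed

lemma tendsto_ip_right:
  assumes "\<And>i. f i \<in> H" "g \<in> H" "h \<in> H" and lim: "((\<lambda>i. nrm (f i - g)) \<longlongrightarrow> 0) A"
  shows "((\<lambda>i. ip h (f i)) \<longlongrightarrow> ip h g) A"
proof (rule LIM_zero_cancel, rule Lim_null_comparison)
  show "\<forall>\<^sub>F i in A. cmod (ip h (f i) - ip h g) \<le> nrm h * nrm (f i - g)"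
    using assms Cauchy_Schwarz[of h "f _ - g"] by (auto simp: ip_diff_right mem_intros)
  show "((\<lambda>i. nrm h * nrm (f i - g)) \<longlongrightarrow> 0) A"
    using tendsto_mult_left[OF lim, of "nrm h"] by simp
qed

lemma tendsto_eval:
  assumes "\<And>i. f i \<in> H" "g \<in> H" and lim: "((\<lambda>i. nrm (f i - g)) \<longlongrightarrow> 0) A"
  shows "((\<lambda>i. f i x) \<longlongrightarrow> g x) A"
proof -
  have "((\<lambda>i. cnj (ip (k x) (f i))) \<longlongrightarrow> cnj (ip (k x) g)) A"
    by (intro tendsto_cnj tendsto_ip_right assms mem_intros)
  then show ?thesis
    using assms ip_cnj[of "k x"] by (simp add: kernel_mem flip: reproducing)
qed


end


section \<open>Taylor expansion of elements of the space with exponential remainders\<close>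

definition exp_tail :: "nat \<Rightarrow> real \<Rightarrow> real" where
  "exp_tail n x = exp x - (\<Sum>j<n. x ^ j / fact j)"

lemma abs_exp_tail_le: "\<bar>exp_tail n x\<bar> \<le> \<bar>x\<bar> ^ n / fact n * exp \<bar>x\<bar>"
proof -
  obtain t where t: "\<bar>t\<bar> \<le> \<bar>x\<bar>" "exp x = (\<Sum>m<n. x ^ m / fact m) + exp t / fact n * x ^ n"
    using Maclaurin_exp_le by blast
  then have "\<bar>exp_tail n x\<bar> = \<bar>x\<bar> ^ n / fact n * exp t"
    by (simp add: exp_tail_def abs_mult power_abs)
  also have "\<dots> \<le> \<bar>x\<bar> ^ n / fact n * exp \<bar>x\<bar>"
    using t(1) by (intro mult_left_mono) auto
  finally show ?thesis .
qed

text \<open>The leading term of the tail is (t a)^n / n!, and the next tail is O(t^(n+1)). In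
  \<open>pw_aux\<close> this one limit serves twice: for the Gram matrix of the divided differences
  and for their pointwise values.\<close>

lemma exp_tail_div_tendsto: "((\<lambda>t. exp_tail n (t * a) / t ^ n) \<longlongrightarrow> a ^ n / fact n) (at 0)"
proof (rule LIM_zero_cancel, rule Lim_null_comparison)
  show "\<forall>\<^sub>F t in at 0. norm (exp_tail n (t * a) / t ^ n - a ^ n / fact n)
    \<le> \<bar>t\<bar> * (\<bar>a\<bar> ^ Suc n / fact (Suc n) * exp \<bar>t * a\<bar>)"
  proof (rule eventually_at_filter[THEN iffD2], rule always_eventually, intro allI impI)
    fix t :: real assume "t \<noteq> 0"
    have "exp_tail n (t * a) = (t * a) ^ n / fact n + exp_tail (Suc n) (t * a)"
      by (simp add: exp_tail_def)
    then have "exp_tail n (t * a) / t ^ n - a ^ n / fact n = exp_tail (Suc n) (t * a) / t ^ n"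
      using \<open>t \<noteq> 0\<close> by (simp add: power_mult_distrib add_divide_distrib)
    also have "\<bar>\<dots>\<bar> \<le> (\<bar>t * a\<bar> ^ Suc n / fact (Suc n) * exp \<bar>t * a\<bar>) / \<bar>t\<bar> ^ n"
      unfolding abs_divide power_abs by (rule divide_right_mono[OF abs_exp_tail_le]) simp
    also have "\<dots> = \<bar>t\<bar> * (\<bar>a\<bar> ^ Suc n / fact (Suc n) * exp \<bar>t * a\<bar>)"
      using \<open>t \<noteq> 0\<close> by (simp add: abs_mult power_mult_distrib del: fact_Suc)
    finally show "norm (exp_tail n (t * a) / t ^ n - a ^ n / fact n)
      \<le> \<bar>t\<bar> * (\<bar>a\<bar> ^ Suc n / fact (Suc n) * exp \<bar>t * a\<bar>)" by simp
  qed
  show "((\<lambda>t. \<bar>t\<bar> * (\<bar>a\<bar> ^ Suc n / fact (Suc n) * exp \<bar>t * a\<bar>)) \<longlongrightarrow> 0) (at 0)"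
    by (rule tendsto_eq_intros | simp)+
qed

text \<open>
  With \<open>c = 0\<close> this is the exponential kernel, with \<open>c = 1\<close> the Gaussian one. Completing squares
  around any base point \<open>q\<close> gives \<open>k x y = wt q x * wt q y * exp ((x - q) \<bullet> (y - q) / \<sigma>\<^sup>2)\<close>, so that
  Taylor expansion at \<open>q\<close> is an orthogonal decomposition of \<open>H\<close>, for every \<open>q\<close>.
\<close>

locale gaussian_rkhs = complex_rkhs H ip k
  for H :: "(real ^ 'd \<Rightarrow> complex) set" and ip and k +
  fixes \<sigma> c :: real and b :: "real ^ 'd"
  assumes \<sigma>_pos: "0 < \<sigma>"
    and k_eq: "\<And>x y. k x y = complex_of_real
      (exp (((x - b) \<bullet> (y - b) - c * ((norm (x - b))\<^sup>2 + (norm (y - b))\<^sup>2) / 2) / \<sigma>\<^sup>2))"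
begin

text \<open>By \<open>k_wt\<close> this is k(x, q) / sqrt (k(q, q)), the normalised kernel function
  at q. For c = 1 it equals exp (- |x - q|^2 / (2 \<sigma>^2)); for c = 0 it is the exponential of
  an affine function of x.\<close>

definition wt :: "real ^ 'd \<Rightarrow> real ^ 'd \<Rightarrow> real" where
  "wt q x = exp (((x - q) \<bullet> (q - b) + (norm (q - b))\<^sup>2 / 2 - c * (norm (x - b))\<^sup>2 / 2) / \<sigma>\<^sup>2)"

lemma wt_pos [simp]: "0 < wt q x" "wt q x \<noteq> 0"
  by (simp_all add: wt_def)

lemma k_wt: "k x y = of_real (wt q x * wt q y * exp ((x - q) \<bullet> (y - q) / \<sigma>\<^sup>2))"
proof -
  have "(x - b) \<bullet> (y - b) - c * ((norm (x - b))\<^sup>2 + (norm (y - b))\<^sup>2) / 2 =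
    ((x - q) \<bullet> (q - b) + (norm (q - b))\<^sup>2 / 2 - c * (norm (x - b))\<^sup>2 / 2) +
    ((y - q) \<bullet> (q - b) + (norm (q - b))\<^sup>2 / 2 - c * (norm (y - b))\<^sup>2 / 2) + (x - q) \<bullet> (y - q)"
    by (simp add: power2_norm_eq_inner inner_diff_left inner_diff_right inner_commute field_simps)
  then show ?thesis
    unfolding k_eq wt_def exp_add[symmetric] add_divide_distrib[symmetric] by simp
qed

text \<open>Generating function of the family \<open>pw q j u\<close>: its values
  \<open>wt q y\<close> * exp (u . (y - q) / \<sigma>^2) are the sums of theirs over j, while
  pairing with it evaluates at q + u up to the weight.\<close>

definition kap :: "real ^ 'd \<Rightarrow> real ^ 'd \<Rightarrow> real ^ 'd \<Rightarrow> complex" where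
  "kap q u = cscale (1 / of_real (wt q (q + u))) (k (q + u))"

text \<open>The representer of a Taylor coefficient: for h in H, \<open>ip h (pw q j u)\<close> is
  the homogeneous part of degree j, evaluated at u, of the expansion of h / \<open>wt q\<close> at
  q.\<close>

definition pw :: "real ^ 'd \<Rightarrow> nat \<Rightarrow> real ^ 'd \<Rightarrow> real ^ 'd \<Rightarrow> complex" where
  "pw q j u = (\<lambda>y. of_real (wt q y * (u \<bullet> (y - q) / \<sigma>\<^sup>2) ^ j / fact j))"

definition rest :: "real ^ 'd \<Rightarrow> nat \<Rightarrow> real ^ 'd \<Rightarrow> real ^ 'd \<Rightarrow> complex" where
  "rest q n u = kap q u - (\<Sum>j<n. pw q j u)"

lemma kap_mem [simp]: "kap q u \<in> H"
  by (simp add: kap_def mem_intros)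

lemma kap_apply: "kap q u y = of_real (wt q y * exp (u \<bullet> (y - q) / \<sigma>\<^sup>2))"
  by (simp add: kap_def k_wt[of "q + u" y q])

lemma ip_kap: "h \<in> H \<Longrightarrow> ip h (kap q u) = h (q + u) / of_real (wt q (q + u))"
  by (simp add: kap_def ip_scale_right kernel_mem reproducing)

lemma rest_apply: "rest q n u y = of_real (wt q y * exp_tail n (u \<bullet> (y - q) / \<sigma>\<^sup>2))"
  by (simp add: rest_def kap_apply pw_def exp_tail_def sum_fun_apply sum_distrib_left algebra_simps)

lemma pw_scale: "pw q j (t *\<^sub>R u) = cscale (of_real (t ^ j)) (pw q j u)"
  by (simp add: pw_def cscale_def fun_eq_iff power_mult_distrib power_divide)

text \<open>The three terms involving a partial sum all equal the truncated exponential series, so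
  what remains of \<open>ip (kap q u) (kap q w)\<close> is the tail. The hypotheses concern only
  degrees below n, which makes the lemma available inside the induction that proves them.\<close>

lemma ip_rest_aux:
  assumes mem: "\<And>j u. j < n \<Longrightarrow> pw q j u \<in> H"
    and orth: "\<And>j i u w. j < n \<Longrightarrow> i < n \<Longrightarrow>
      ip (pw q i w) (pw q j u) = (if i = j then of_real ((u \<bullet> w / \<sigma>\<^sup>2) ^ j / fact j) else 0)"
  shows "ip (rest q n u) (rest q n w) = of_real (exp_tail n (u \<bullet> w / \<sigma>\<^sup>2))"
proof -
  let ?S = "\<lambda>u. \<Sum>j<n. pw q j u"
  let ?T = "\<Sum>j<n. (u \<bullet> w / \<sigma>\<^sup>2) ^ j / fact j"
  have [simp]: "?S u \<in> H" for u by (intro mem_intros mem) auto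
  have SS: "ip (?S u) (?S w) = of_real ?T"
  proof -
    have "ip (?S u) (?S w) = (\<Sum>i<n. \<Sum>j<n. ip (pw q i u) (pw q j w))"
      by (subst ip_sum) (auto intro!: sum.cong ip_sum_right mem)
    also have "\<dots> = (\<Sum>i<n. \<Sum>j<n. if i = j then of_real ((u \<bullet> w / \<sigma>\<^sup>2) ^ j / fact j) else 0)"
      by (intro sum.cong refl) (auto simp: orth inner_commute)
    finally show ?thesis by simp
  qed
  have Sk: "ip (?S u) (kap q w) = of_real ?T"
    by (subst ip_kap, simp) (simp add: sum_fun_apply pw_def sum_divide_distrib)
  have "ip (?S w) (kap q u) = of_real ?T"
    by (subst ip_kap, simp) (simp add: sum_fun_apply pw_def sum_divide_distrib inner_commute)
  then have kS: "ip (kap q u) (?S w) = of_real ?T"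
    using ip_cnj[of "?S w" "kap q u"] by simp
  have "ip (kap q u) (kap q w) = of_real (exp (u \<bullet> w / \<sigma>\<^sup>2))"
    by (simp add: ip_kap kap_apply)
  then show ?thesis unfolding rest_def
    by (simp add: ip_diff ip_diff_right mem_intros SS Sk kS exp_tail_def)
qed

text \<open>
  By strong induction on \<open>n\<close>: the divided differences \<open>rest q n (t *\<^sub>R u) / t ^ n\<close> form a Cauchy sequence
  as \<open>t\<close> tends to 0, because their Gram matrix is known, and they converge pointwise to \<open>pw q n u\<close>.
\<close>

lemma pw_aux:
  "pw q n u \<in> H \<and> (\<forall>i w. pw q i w \<in> H \<longrightarrow>
     ip (pw q i w) (pw q n u) = (if i = n then of_real ((u \<bullet> w / \<sigma>\<^sup>2) ^ n / fact n) else 0))"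
proof (induction n arbitrary: u rule: less_induct)
  case (less n)
  define t :: "nat \<Rightarrow> real" where "t i = inverse (of_nat (Suc i))" for i
  have t0: "t i > 0" for i by (simp add: t_def)
  have tlim: "t \<longlonglongrightarrow> 0" unfolding t_def by (rule LIMSEQ_inverse_real_of_nat)
  define D where "D i = cscale (of_real (1 / t i ^ n)) (rest q n (t i *\<^sub>R u))" for i
  have mem: "\<And>j u. j < n \<Longrightarrow> pw q j u \<in> H" using less by auto
  have R: "rest q n u \<in> H" for u unfolding rest_def by (intro mem_intros mem kap_mem) auto
  have D: "D i \<in> H" for i unfolding D_def by (intro mem_intros R)
  define E where "E x = exp_tail n (x * (u \<bullet> u / \<sigma>\<^sup>2)) / x ^ n" for x
  define L where "L = (u \<bullet> u / \<sigma>\<^sup>2) ^ n / fact n"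
  have E: "(E \<longlongrightarrow> L) (at 0)" unfolding E_def L_def by (rule exp_tail_div_tendsto)
  \<comment> \<open>The Gram entries depend only on \<open>t i * t j\<close>. The squared distance
    of \<open>D i\<close> and \<open>D j\<close> is therefore a signed sum of four values of
    \<open>E\<close>, in which the common limit \<open>L\<close> cancels; hence the tolerance e^2 /
    4 below.\<close>
  have ipD: "ip (D i) (D j) = of_real (E (t i * t j))" for i j
  proof -
    have "ip (rest q n (t i *\<^sub>R u)) (rest q n (t j *\<^sub>R u)) = of_real (exp_tail n (t i * t j * (u \<bullet> u / \<sigma>\<^sup>2)))"
      using ip_rest_aux[of n q "t i *\<^sub>R u" "t j *\<^sub>R u"] less by (simp add: mult_ac)
    then show ?thesis
      by (simp add: D_def ip_scale ip_scale_right R scale_mem E_def power_mult_distrib)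
  qed
  have "\<exists>K. \<forall>i\<ge>K. \<forall>j\<ge>K. sqrt (Re (ip (D i - D j) (D i - D j))) < e" if "e > 0" for e
  proof -
    have "\<forall>\<^sub>F x in at 0. dist (E x) L < e\<^sup>2 / 4" using E that by (intro tendstoD) auto
    then obtain d where d: "d > 0" "\<And>x. x \<noteq> 0 \<Longrightarrow> \<bar>x\<bar> < d \<Longrightarrow> \<bar>E x - L\<bar> < e\<^sup>2 / 4"
      unfolding eventually_at by (auto simp: dist_real_def)
    have "\<forall>\<^sub>F i in sequentially. t i < min d 1"
      using order_tendstoD(2)[OF tlim, of "min d 1"] d by simp
    then obtain K where K: "\<And>i. i \<ge> K \<Longrightarrow> t i < min d 1" unfolding eventually_sequentially by auto
    have small: "\<bar>E (t i * t j) - L\<bar> < e\<^sup>2 / 4" if "i \<ge> K" "j \<ge> K" for i j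
    proof (rule d(2))
      have "t i * t j \<le> t i" using K[OF \<open>j \<ge> K\<close>] t0 by (simp add: mult_left_le less_imp_le)
      moreover have "t i < d" using K[OF \<open>i \<ge> K\<close>] by simp
      ultimately show "\<bar>t i * t j\<bar> < d" using mult_pos_pos[OF t0[of i] t0[of j]] by linarith
      show "t i * t j \<noteq> 0" using t0 by (metis less_irrefl mult_eq_0_iff)
    qed
    have "sqrt (Re (ip (D i - D j) (D i - D j))) < e" if "i \<ge> K" "j \<ge> K" for i j
    proof -
      have "Re (ip (D i - D j) (D i - D j)) = E (t i * t i) - E (t i * t j) - (E (t j * t i) - E (t j * t j))"
        using D by (simp add: ip_diff ip_diff_right diff_mem ipD)
      also have "\<dots> < e\<^sup>2"
        using small[OF that] small[OF that(1) that(1)] small[OF that(2) that(2)]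
        unfolding mult.commute[of "t j" "t i"] by linarith
      finally have "sqrt (Re (ip (D i - D j) (D i - D j))) < sqrt (e\<^sup>2)"
        by (rule real_sqrt_less_mono)
      then show ?thesis using \<open>e > 0\<close> by simp
    qed
    then show ?thesis by blast
  qed
  then obtain g where g: "g \<in> H" "(\<lambda>j. nrm (D j - g)) \<longlonglongrightarrow> 0"
    using complete[of D] D unfolding nrm_def by blast
  have tat: "filterlim t (at 0) sequentially"
    using tlim t0 by (simp add: filterlim_at less_imp_neq[symmetric])
  have "g y = pw q n u y" for y
  proof (rule LIMSEQ_unique)
    show "(\<lambda>i. D i y) \<longlonglongrightarrow> g y" by (rule tendsto_eval[OF D g])
    have "(\<lambda>i. complex_of_real (wt q y * (exp_tail n (t i * (u \<bullet> (y - q) / \<sigma>\<^sup>2)) / t i ^ n)))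
      \<longlonglongrightarrow> of_real (wt q y * ((u \<bullet> (y - q) / \<sigma>\<^sup>2) ^ n / fact n))"
      by (intro tendsto_of_real tendsto_mult_left filterlim_compose[OF exp_tail_div_tendsto tat])
    then show "(\<lambda>i. D i y) \<longlonglongrightarrow> pw q n u y"
      by (simp add: D_def rest_apply pw_def)
  qed
  then have g_eq: "g = pw q n u" by auto
  have "ip (pw q i w) (pw q n u) = (if i = n then of_real ((u \<bullet> w / \<sigma>\<^sup>2) ^ n / fact n) else 0)"
    if w: "pw q i w \<in> H" for i w
  proof (rule LIMSEQ_unique)
    show "(\<lambda>j. ip (pw q i w) (D j)) \<longlonglongrightarrow> ip (pw q i w) (pw q n u)"
      using tendsto_ip_right[OF D g(1) w g(2)] by (simp add: g_eq)
    define X where "X = complex_of_real ((u \<bullet> w / \<sigma>\<^sup>2) ^ i / fact i)"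
    \<comment> \<open>Degrees i < n are removed by the subtraction in \<open>rest\<close>; for i
      \<ge> n a factor t^(i-n) survives, with limit 1 for i = n and 0 for i > n. Degrees i > n occur
      here, which is why the induction claim quantifies over every i with \<open>pw q i w\<close> in
      H.\<close>
    have ipj: "ip (pw q i w) (D j) = (if i < n then 0 else of_real (t j ^ (i - n)) * X)" for j
    proof -
      have "ip (pw q i w) (kap q (t j *\<^sub>R u)) = of_real (t j ^ i) * X"
        by (subst ip_kap[OF w]) (simp add: pw_def X_def inner_commute power_mult_distrib power_divide)
      moreover have "ip (pw q i w) (pw q l (t j *\<^sub>R u)) = (if i = l then of_real (t j ^ i) * X else 0)"
        if "l < n" for l
        using less[OF that, of "t j *\<^sub>R u"] w by (simp add: X_def power_mult_distrib power_divide)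
      moreover have "ip (pw q i w) (rest q n (t j *\<^sub>R u)) =
        ip (pw q i w) (kap q (t j *\<^sub>R u)) - (\<Sum>l<n. ip (pw q i w) (pw q l (t j *\<^sub>R u)))"
        unfolding rest_def by (subst ip_diff_right) (auto intro!: w mem sum_mem ip_sum_right)
      ultimately have "ip (pw q i w) (rest q n (t j *\<^sub>R u)) = (if i < n then 0 else of_real (t j ^ i) * X)"
        by simp
      then show ?thesis
        using t0[of j] by (simp add: D_def ip_scale_right w R power_diff)
    qed
    have "(\<lambda>j. t j ^ (i - n)) \<longlonglongrightarrow> 0" if "i > n"
      using tendsto_power[OF tlim, of "i - n"] that by (simp add: power_0_left)
    then have "(\<lambda>j. of_real (t j ^ (i - n)) * X) \<longlonglongrightarrow> (if i = n then X else 0)" if "\<not> i < n"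
      using that tendsto_mult_right[OF tendsto_of_real, of "\<lambda>j. t j ^ (i - n)" 0 sequentially X]
      by (cases "i = n") auto
    moreover have "(if i = n then of_real ((u \<bullet> w / \<sigma>\<^sup>2) ^ n / fact n) else 0) = (if i = n then X else 0)"
      by (simp add: X_def)
    ultimately show "(\<lambda>j. ip (pw q i w) (D j)) \<longlonglongrightarrow> (if i = n then of_real ((u \<bullet> w / \<sigma>\<^sup>2) ^ n / fact n) else 0)"
      unfolding ipj by (cases "i < n") auto
  qed
  then show ?case using g(1) g_eq by auto
qed

lemma pw_mem [simp]: "pw q n u \<in> H"
  using pw_aux by blast

lemma ip_pw: "ip (pw q i w) (pw q n u) = (if i = n then of_real ((u \<bullet> w / \<sigma>\<^sup>2) ^ n / fact n) else 0)"
  using pw_aux by simp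

lemma rest_mem [simp]: "rest q n u \<in> H"
  by (simp add: rest_def mem_intros)

lemma nrm_rest: "(nrm (rest q n u))\<^sup>2 = exp_tail n ((norm u)\<^sup>2 / \<sigma>\<^sup>2)"
  using ip_rest_aux[of n q u u] ip_self[of "rest q n u"] by (simp add: ip_pw power2_norm_eq_inner flip: of_real_power)

text \<open>Splitting \<open>kap q u\<close> into its first n terms and \<open>rest\<close> in the
  reproducing property. Continuity, derivatives and orders of vanishing of elements of H are all
  read off from this identity.\<close>

lemma taylor:
  assumes "h \<in> H"
  shows "h (q + u) = of_real (wt q (q + u)) * ((\<Sum>j<n. ip h (pw q j u)) + ip h (rest q n u))"
  using assms by (simp add: rest_def ip_diff_right ip_sum_right ip_kap mem_intros)

lemma ip_pw_scale: "h \<in> H \<Longrightarrow> ip h (pw q j (t *\<^sub>R u)) = of_real t ^ j * ip h (pw q j u)"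
  by (simp add: pw_scale ip_scale_right)

text \<open>Source of the factor 1 / sqrt (n!): Cauchy-Schwarz brings in
  \<open>nrm (rest q n u)\<close>, whose square is the exponential tail at x = |u|^2 / \<sigma>^2,
  at most x^n / n! * exp x.\<close>

lemma ip_rest_le:
  assumes "h \<in> H"
  shows "cmod (ip h (rest q n u)) \<le> nrm h * ((norm u / \<sigma>) ^ n * exp ((norm u)\<^sup>2 / (2 * \<sigma>\<^sup>2)) / sqrt (fact n))"
proof -
  have "(nrm (rest q n u))\<^sup>2 \<le> ((norm u)\<^sup>2 / \<sigma>\<^sup>2) ^ n / fact n * exp ((norm u)\<^sup>2 / \<sigma>\<^sup>2)"
    using abs_exp_tail_le[of n "(norm u)\<^sup>2 / \<sigma>\<^sup>2"] by (simp add: nrm_rest)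
  also have "\<dots> = ((norm u / \<sigma>) ^ n * exp ((norm u)\<^sup>2 / (2 * \<sigma>\<^sup>2)) / sqrt (fact n))\<^sup>2"
    by (simp add: power_mult_distrib power_divide exp_double[symmetric] power_mult[symmetric] mult.commute)
  finally have "nrm (rest q n u) \<le> (norm u / \<sigma>) ^ n * exp ((norm u)\<^sup>2 / (2 * \<sigma>\<^sup>2)) / sqrt (fact n)"
    by (rule power2_le_imp_le) (use \<sigma>_pos in simp)
  then show ?thesis using Cauchy_Schwarz[OF assms, of "rest q n u"] nrm_nonneg[OF assms]
    by (smt (verit, best) mult_left_mono rest_mem)
qed

lemma vanishing_le:
  assumes h: "h \<in> H" and "\<And>j. j < n \<Longrightarrow> ip h (pw q j u) = 0"
  shows "cmod (h (q + u)) \<le> wt q (q + u) *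
    (nrm h * ((norm u / \<sigma>) ^ n * exp ((norm u)\<^sup>2 / (2 * \<sigma>\<^sup>2)) / sqrt (fact n)))"
proof -
  have "h (q + u) = of_real (wt q (q + u)) * ip h (rest q n u)"
    using assms(2) by (subst taylor[OF h, of q u n]) simp
  then have "cmod (h (q + u)) = wt q (q + u) * cmod (ip h (rest q n u))"
    by (simp only: norm_mult norm_of_real abs_of_pos[OF wt_pos(1)])
  then show ?thesis using mult_left_mono[OF ip_rest_le[OF h, of q n u], of "wt q (q + u)"] by (simp add: less_imp_le)
qed

text \<open>Passes from values of h along a line to its Taylor polynomial along that line, so that
  the one-variable coefficient estimates become applicable.\<close>

lemma taylor_poly_le:
  assumes h: "h \<in> H" and l: "0 < l" "l \<le> wt q (q + s *\<^sub>R u)"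
    and "cmod (h (q + s *\<^sub>R u)) \<le> A" "cmod (ip h (rest q (Suc n) (s *\<^sub>R u))) \<le> R"
  shows "cmod (\<Sum>i\<le>n. of_real s ^ i * ip h (pw q i u)) \<le> A / l + R"
proof -
  let ?w = "wt q (q + s *\<^sub>R u)"
  have "(\<Sum>i\<le>n. of_real s ^ i * ip h (pw q i u)) = h (q + s *\<^sub>R u) / of_real ?w - ip h (rest q (Suc n) (s *\<^sub>R u))"
    using taylor[OF h, of q "s *\<^sub>R u" "Suc n"] by (simp add: ip_pw_scale[OF h] lessThan_Suc_atMost)
  also have "cmod \<dots> \<le> cmod (h (q + s *\<^sub>R u)) / ?w + cmod (ip h (rest q (Suc n) (s *\<^sub>R u)))"
    by (rule order_trans[OF norm_triangle_ineq4]) (simp add: norm_divide abs_of_pos)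
  also have "\<dots> \<le> A / l + R"
    using assms by (intro add_mono frac_le) (auto intro: order_trans[OF norm_ge_zero])
  finally show ?thesis .
qed

end


section \<open>Regularity and orders of vanishing\<close>

lemma power_over_sqrt_fact_tendsto_0: "(\<lambda>n. x ^ n / sqrt (fact n)) \<longlonglongrightarrow> (0::real)"
proof -
  have "(\<lambda>n. (x\<^sup>2) ^ n /\<^sub>R fact n) \<longlonglongrightarrow> 0"
    by (rule summable_LIMSEQ_zero[OF summable_exp_generic])
  then have "(\<lambda>n. sqrt ((x\<^sup>2) ^ n /\<^sub>R fact n)) \<longlonglongrightarrow> sqrt 0"
    by (rule tendsto_real_sqrt)
  moreover have "sqrt ((x\<^sup>2) ^ n /\<^sub>R fact n) = \<bar>x ^ n / sqrt (fact n)\<bar>" for n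
  proof -
    have "(x\<^sup>2) ^ n = (x ^ n)\<^sup>2" by (simp add: power_mult[symmetric] mult.commute)
    then show ?thesis by (simp add: real_sqrt_divide abs_divide divide_inverse_commute[symmetric])
  qed
  ultimately have "(\<lambda>n. \<bar>x ^ n / sqrt (fact n)\<bar>) \<longlonglongrightarrow> 0" by simp
  then show ?thesis by (rule tendsto_rabs_zero_cancel)
qed

lemma dist_self_add: "dist p (p + v) = norm v" for v :: "'a::real_normed_vector"
  by (simp add: dist_norm norm_minus_commute del: diff_add_eq_diff_diff_swap)

lemma norm_scaleR_le_1:
  fixes u :: "'a::real_normed_vector"
  assumes "\<bar>s\<bar> \<le> 1 / (norm u + 1)"
  shows "norm (s *\<^sub>R u) \<le> 1"
proof -
  have "\<bar>s\<bar> * (norm u + 1) \<le> 1"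
    using assms by (subst pos_le_divide_eq[symmetric]) (auto simp: add_nonneg_pos)
  then show ?thesis by (simp add: algebra_simps)
qed

context gaussian_rkhs
begin

lemma continuous_on_wt: "continuous_on S (\<lambda>x. wt (fst x) (snd x))"
  unfolding wt_def using \<sigma>_pos by (intro continuous_intros) auto

lemma continuous_on_wt_right [continuous_intros]: "continuous_on S (wt q)"
  unfolding wt_def using \<sigma>_pos by (intro continuous_intros) auto

lemma wt_bounds:
  obtains l M where "0 < l" "\<And>q y. dist p q \<le> R \<Longrightarrow> dist p y \<le> R \<Longrightarrow> l \<le> wt q y \<and> wt q y \<le> M"
proof (cases "R \<ge> 0")
  case True
  let ?K = "cball p R \<times> cball p R"
  have K: "compact ?K" "?K \<noteq> {}" using True by (auto intro: compact_Times)
  obtain x where "x \<in> ?K" and x: "\<forall>y\<in>?K. wt (fst x) (snd x) \<le> wt (fst y) (snd y)"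
    using continuous_attains_inf[OF K continuous_on_wt] by blast
  obtain x' where "x' \<in> ?K" and x': "\<forall>y\<in>?K. wt (fst y) (snd y) \<le> wt (fst x') (snd x')"
    using continuous_attains_sup[OF K continuous_on_wt] by blast
  show ?thesis
    by (rule that[of "wt (fst x) (snd x)" "wt (fst x') (snd x')"]) (use x x' in force)+
next
  case False
  then show ?thesis
    by (intro that[of 1 1]) (auto dest: order_trans[OF zero_le_dist])
qed

lemma ip_rest_tendsto_0: "h \<in> H \<Longrightarrow> (\<lambda>n. ip h (rest q n u)) \<longlonglongrightarrow> 0"
proof (rule Lim_null_comparison[where g = "\<lambda>n. nrm h * exp ((norm u)\<^sup>2 / (2 * \<sigma>\<^sup>2)) * ((norm u / \<sigma>) ^ n / sqrt (fact n))"])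
  assume "h \<in> H"
  then show "\<forall>\<^sub>F n in sequentially. cmod (ip h (rest q n u)) \<le>
    nrm h * exp ((norm u)\<^sup>2 / (2 * \<sigma>\<^sup>2)) * ((norm u / \<sigma>) ^ n / sqrt (fact n))"
    using ip_rest_le[of h q _ u] by (simp add: mult_ac)
  show "(\<lambda>n. nrm h * exp ((norm u)\<^sup>2 / (2 * \<sigma>\<^sup>2)) * ((norm u / \<sigma>) ^ n / sqrt (fact n))) \<longlonglongrightarrow> 0"
    by (rule tendsto_mult_right_zero[OF power_over_sqrt_fact_tendsto_0])
qed

text \<open>The Taylor series at q represents h everywhere, because (|u| / \<sigma>)^n / sqrt (n!)
  tends to 0 for every u.\<close>

lemma eq_0_if_pw_0:
  assumes "h \<in> H" "\<And>j. ip h (pw q j u) = 0"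
  shows "h (q + u) = 0"
proof -
  have "ip h (rest q n u) = h (q + u) / of_real (wt q (q + u))" for n
    using taylor[OF assms(1), of q u n] assms(2) by simp
  then have "h (q + u) / of_real (wt q (q + u)) = 0"
    using LIMSEQ_unique[OF tendsto_const, of "h (q + u) / of_real (wt q (q + u))" 0] ip_rest_tendsto_0[OF assms(1), of q u]
    by simp
  then show ?thesis by simp
qed

text \<open>The constant is uniform in the base point, since the estimate of
  \<open>ip_rest_le\<close> does not involve q. In \<open>vanishing_bounds\<close> the base point
  moves.\<close>

lemma rest_bound:
  assumes "h \<in> H"
  shows "\<exists>C\<ge>0. \<forall>q u. norm u \<le> 1 \<longrightarrow> cmod (ip h (rest q n u)) \<le> C * norm u ^ n"
proof (intro exI conjI allI impI)
  let ?C = "nrm h * ((1 / \<sigma>) ^ n * exp (1 / (2 * \<sigma>\<^sup>2)) / sqrt (fact n))"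
  show "?C \<ge> 0" using \<sigma>_pos assms by (simp add: nrm_nonneg)
  fix q u :: "real ^ 'd" assume u: "norm u \<le> 1"
  have "cmod (ip h (rest q n u)) \<le> nrm h * ((norm u / \<sigma>) ^ n * exp ((norm u)\<^sup>2 / (2 * \<sigma>\<^sup>2)) / sqrt (fact n))"
    by (rule ip_rest_le[OF assms])
  also have "\<dots> \<le> nrm h * ((norm u / \<sigma>) ^ n * exp (1 / (2 * \<sigma>\<^sup>2)) / sqrt (fact n))"
    using u \<sigma>_pos assms nrm_nonneg
    by (intro mult_left_mono divide_right_mono) (auto intro!: divide_right_mono simp: power_le_one)
  also have "\<dots> = ?C * norm u ^ n" by (simp add: power_divide)
  finally show "cmod (ip h (rest q n u)) \<le> ?C * norm u ^ n" .
qed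

lemma continuous_on_mem:
  assumes "h \<in> H"
  shows "continuous_on S h"
proof (rule continuous_at_imp_continuous_on, rule ballI)
  fix q
  obtain C where C: "\<And>q u. norm u \<le> 1 \<Longrightarrow> cmod (ip h (rest q 1 u)) \<le> C * norm u ^ 1"
    using rest_bound[OF assms, of 1] by blast
  have "((\<lambda>u. ip h (rest q 1 u)) \<longlongrightarrow> 0) (at 0)"
  proof (rule Lim_null_comparison)
    show "\<forall>\<^sub>F u in at 0. cmod (ip h (rest q 1 u)) \<le> C * norm u ^ 1"
      unfolding eventually_at using C by (auto intro!: exI[of _ 1])
    show "((\<lambda>u. C * norm u ^ 1) \<longlongrightarrow> 0) (at 0)" by (auto intro!: tendsto_eq_intros)
  qed
  moreover have "((\<lambda>u. wt q (q + u)) \<longlongrightarrow> wt q q) (at 0)"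
    using continuous_on_wt_right[of UNIV q] by (simp add: continuous_on_eq_continuous_at isCont_iff)
  ultimately have "((\<lambda>u. of_real (wt q (q + u)) * ((\<Sum>j<1. ip h (pw q j u)) + ip h (rest q 1 u)))
      \<longlongrightarrow> of_real (wt q q) * (ip h (pw q 0 0) + 0)) (at 0)"
    by (intro tendsto_intros) (simp_all add: pw_def)
  moreover have "h q = of_real (wt q q) * (ip h (pw q 0 0) + 0)"
    using taylor[OF assms, of q 0 1] C[of 0 q] by simp
  ultimately have "((\<lambda>u. of_real (wt q (q + u)) * ((\<Sum>j<1. ip h (pw q j u)) + ip h (rest q 1 u))) \<longlongrightarrow> h q) (at 0)"
    by (simp only:)
  then show "isCont h q"
    unfolding isCont_iff by (simp only: taylor[OF assms, of q _ 1])
qed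

lemma mem_borel_measurable: "h \<in> H \<Longrightarrow> h \<in> borel_measurable borel"
  by (intro borel_measurable_continuous_onI continuous_on_mem)

text \<open>Expand to order 2 along the line: the remainder is O(s^2) and has derivative 0. The
  first summand comes from the weight, whose logarithmic derivative at q is
  \<open>(1 - c) * (w \<bullet> (q - b)) / \<sigma>\<^sup>2\<close>.\<close>

lemma has_vector_derivative_mem:
  assumes "h \<in> H"
  shows "((\<lambda>s. h (q + s *\<^sub>R w)) has_vector_derivative
    of_real (wt q q) * (of_real ((1 - c) * (w \<bullet> (q - b)) / \<sigma>\<^sup>2) * ip h (pw q 0 w) + ip h (pw q 1 w))) (at 0)"
proof -
  let ?R = "\<lambda>s. ip h (rest q 2 (s *\<^sub>R w))"
  obtain C where C: "\<And>q u. norm u \<le> 1 \<Longrightarrow> cmod (ip h (rest q 2 u)) \<le> C * norm u ^ 2"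
    using rest_bound[OF assms, of 2] by blast
  have R0: "?R 0 = 0" using C[where u = 0 and q = q] by (simp only: scaleR_zero_left norm_zero) simp
  have R: "(?R has_vector_derivative 0) (at 0)"
    unfolding has_vector_derivative_def has_derivative_at
  proof (rule conjI, simp add: bounded_linear_zero, rule Lim_null_comparison[where g = "\<lambda>s. C * \<bar>s\<bar> * (norm w)\<^sup>2"])
    show "\<forall>\<^sub>F s in at 0. norm (cmod (?R (0 + s) - ?R 0 - s *\<^sub>R 0) / norm s) \<le> C * \<bar>s\<bar> * (norm w)\<^sup>2"
      unfolding eventually_at
    proof (intro exI[of _ "1 / (norm w + 1)"] conjI ballI impI)
      fix s :: real assume s: "s \<noteq> 0 \<and> dist s 0 < 1 / (norm w + 1)"
      then have "\<bar>s\<bar> * (norm w + 1) < 1" by (subst pos_less_divide_eq[symmetric]) (auto simp: add_nonneg_pos)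
      then have "norm (s *\<^sub>R w) \<le> 1" by (simp add: algebra_simps)
      from C[OF this, of q] s show "norm (cmod (?R (0 + s) - ?R 0 - s *\<^sub>R 0) / norm s) \<le> C * \<bar>s\<bar> * (norm w)\<^sup>2"
        by (simp add: R0[simplified scaleR_zero_left] divide_le_eq power2_eq_square mult_ac)
    qed (simp add: add_nonneg_pos)
    show "((\<lambda>s. C * \<bar>s\<bar> * (norm w)\<^sup>2) \<longlongrightarrow> 0) (at 0)" by (auto intro!: tendsto_eq_intros)
  qed
  have W: "((\<lambda>s. wt q (q + s *\<^sub>R w)) has_real_derivative wt q q * ((1 - c) * (w \<bullet> (q - b)) / \<sigma>\<^sup>2)) (at 0)"
  proof -
    have e: "(norm (q + s *\<^sub>R w - b))\<^sup>2 = (norm (q - b))\<^sup>2 + 2 * s * (w \<bullet> (q - b)) + s\<^sup>2 * (norm w)\<^sup>2" for s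
      unfolding power2_norm_eq_inner
      by (simp add: inner_diff_left inner_diff_right inner_add_left inner_add_right inner_commute algebra_simps power2_eq_square)
    define A N N' where "A = w \<bullet> (q - b)" and "N = (norm (q - b))\<^sup>2" and "N' = (norm w)\<^sup>2"
    have wt: "wt q (q + s *\<^sub>R w) = exp ((s * A + N / 2 - c * (N + 2 * s * A + s\<^sup>2 * N') / 2) / \<sigma>\<^sup>2)" for s
      by (simp add: wt_def e A_def N_def N'_def)
    have "((\<lambda>s. (s * A + N / 2 - c * (N + 2 * s * A + s\<^sup>2 * N') / 2) / \<sigma>\<^sup>2) has_real_derivative
      (1 * A + 0 - c * (0 + 2 * 1 * A + 2 * 0 * N') / 2) / \<sigma>\<^sup>2) (at 0)"
      by (rule DERIV_cdivide) (auto intro!: derivative_eq_intros)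
    from DERIV_fun_exp[OF this] show ?thesis
      unfolding wt
      using wt[of 0] by (simp add: A_def[symmetric] left_diff_distrib diff_divide_distrib)
  qed
  have "((\<lambda>s. of_real (wt q (q + s *\<^sub>R w)) * (ip h (pw q 0 w) + of_real s * ip h (pw q 1 w) + ?R s)) has_vector_derivative
    of_real (wt q (q + 0 *\<^sub>R w)) * (0 + of_real 1 * ip h (pw q 1 w) + 0) +
    of_real (wt q q * ((1 - c) * (w \<bullet> (q - b)) / \<sigma>\<^sup>2)) * (ip h (pw q 0 w) + of_real 0 * ip h (pw q 1 w) + ?R 0)) (at 0)"
    by (intro has_vector_derivative_mult has_vector_derivative_add has_vector_derivative_of_real
        has_vector_derivative_mult_left has_vector_derivative_const R W DERIV_ident)
  then show ?thesis
    using R0 by (simp add: taylor[OF assms, of q _ 2] numeral_2_eq_2 ip_pw_scale[OF assms] algebra_simps)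
qed

lemma partial_deriv_mem:
  "h \<in> H \<Longrightarrow> partial_deriv i h q = of_real (wt q q) *
    (of_real ((1 - c) * (axis i 1 \<bullet> (q - b)) / \<sigma>\<^sup>2) * ip h (pw q 0 (axis i 1)) + ip h (pw q 1 (axis i 1)))"
  unfolding partial_deriv_def by (intro vector_derivative_at has_vector_derivative_mem)

text \<open>
  Applied with the base point \<open>q\<close> close to \<open>p\<close> and \<open>t = dist p q\<close>, this turns \<open>h = O(dist p q ^ m)\<close>
  into a bound \<open>O(dist p q ^ (m - 1))\<close> on the first derivatives of \<open>h\<close>.
\<close>

lemma pw_coeff_bound:
  assumes "h \<in> H" "0 < t" "t \<le> 1" "norm w \<le> 1" "j \<le> n" "0 < l"
    and l: "\<And>s. \<bar>s\<bar> \<le> t \<Longrightarrow> l \<le> wt q (q + s *\<^sub>R w)"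
    and M: "\<And>s. \<bar>s\<bar> \<le> t \<Longrightarrow> cmod (h (q + s *\<^sub>R w)) \<le> M * t ^ m"
    and C: "\<And>u. norm u \<le> 1 \<Longrightarrow> cmod (ip h (rest q (Suc n) u)) \<le> C * norm u ^ Suc n"
    and "m \<le> Suc n" "C \<ge> 0"
  shows "cmod (ip h (pw q j w)) * t ^ j \<le> (M / l + C) * t ^ m * 2 ^ n * 4 ^ j"
proof (rule coeff_bound_interval[OF \<open>0 < t\<close> _ \<open>j \<le> n\<close>])
  fix s :: real assume s: "\<bar>s\<bar> \<le> t"
  have nw: "norm (s *\<^sub>R w) \<le> t" using s assms(4) mult_mono[of "\<bar>s\<bar>" t "norm w" 1] \<open>0 < t\<close> by simp
  have "cmod (ip h (rest q (Suc n) (s *\<^sub>R w))) \<le> C * norm (s *\<^sub>R w) ^ Suc n"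
    using nw \<open>t \<le> 1\<close> by (intro C) auto
  also have "\<dots> \<le> C * t ^ Suc n" using nw \<open>C \<ge> 0\<close> by (intro mult_left_mono power_mono) auto
  also have "\<dots> \<le> C * t ^ m" using assms by (intro mult_left_mono power_decreasing) auto
  finally show "cmod (\<Sum>i\<le>n. of_real s ^ i * ip h (pw q i w)) \<le> (M / l + C) * t ^ m"
    using taylor_poly_le[OF assms(1) \<open>0 < l\<close> l[OF s] M[OF s], of n] by (simp add: algebra_simps)
qed

text \<open>A converse to \<open>vanishing_le\<close>: after division by the weight and removal of
  the remainder, a polynomial in s of degree at most n and size O(|s|^(n+1)) is left, and such a
  polynomial is 0.\<close>

lemma pw_0_if_vanishing:
  assumes h: "h \<in> H" and "0 < \<epsilon>"
    and bd: "\<And>s. \<bar>s\<bar> \<le> \<epsilon> \<Longrightarrow> cmod (h (q + s *\<^sub>R u)) \<le> M * \<bar>s\<bar> ^ Suc n" and "j \<le> n"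
  shows "ip h (pw q j u) = 0"
proof -
  obtain l M' where l: "0 < l" "\<And>q' y. dist q q' \<le> 1 \<Longrightarrow> dist q y \<le> 1 \<Longrightarrow> l \<le> wt q' y \<and> wt q' y \<le> M'"
    using wt_bounds by metis
  obtain C where C: "\<And>q u. norm u \<le> 1 \<Longrightarrow> cmod (ip h (rest q (Suc n) u)) \<le> C * norm u ^ Suc n"
    using rest_bound[OF h, of "Suc n"] by blast
  show ?thesis
  proof (rule coeff_0_if_vanishing[where d = "\<lambda>j. ip h (pw q j u)" and n = n
        and \<epsilon> = "min \<epsilon> (1 / (norm u + 1))" and C = "M / l + C * norm u ^ Suc n"])
    fix s assume s: "\<bar>s\<bar> \<le> min \<epsilon> (1 / (norm u + 1))"
    then have su: "norm (s *\<^sub>R u) \<le> 1" by (intro norm_scaleR_le_1) simp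
    have "l \<le> wt q (q + s *\<^sub>R u)" using l(2)[of q "q + s *\<^sub>R u"] su by (simp add: dist_self_add)
    moreover have "cmod (h (q + s *\<^sub>R u)) \<le> M * \<bar>s\<bar> ^ Suc n" using s by (intro bd) simp
    ultimately have "cmod (\<Sum>i\<le>n. of_real s ^ i * ip h (pw q i u)) \<le>
        M * \<bar>s\<bar> ^ Suc n / l + C * norm (s *\<^sub>R u) ^ Suc n"
      by (rule taylor_poly_le[OF h l(1) _ _ C[OF su]])
    then show "cmod (\<Sum>i\<le>n. of_real s ^ i * ip h (pw q i u)) \<le> (M / l + C * norm u ^ Suc n) * \<bar>s\<bar> ^ Suc n"
      by (simp add: power_mult_distrib algebra_simps)
  qed (use assms in \<open>auto simp: add_nonneg_pos\<close>)
qed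

text \<open>Identity theorem: if h vanishes near q, so do all its Taylor coefficients at q, and the
  Taylor series at q represents h on the whole space.\<close>

lemma eq_0_if_locally_0:
  assumes "h \<in> H" "0 < \<epsilon>" "\<And>y. dist q y < \<epsilon> \<Longrightarrow> h y = 0"
  shows "h = 0"
proof
  fix y
  have "ip h (pw q j (y - q)) = 0" for j
  proof (rule pw_0_if_vanishing[OF assms(1), of "\<epsilon> / (2 * (norm (y - q) + 1))" q "y - q" 0 j j])
    fix s :: real assume "\<bar>s\<bar> \<le> \<epsilon> / (2 * (norm (y - q) + 1))"
    then have "\<bar>s\<bar> * (2 * (norm (y - q) + 1)) \<le> \<epsilon>"
      by (subst pos_le_divide_eq[symmetric]) (auto simp: add_nonneg_pos)
    then have "\<bar>s\<bar> * norm (y - q) * 2 + \<bar>s\<bar> * 2 \<le> \<epsilon>" by (simp add: distrib_left mult_ac)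
    moreover have "dist q (q + s *\<^sub>R (y - q)) = \<bar>s\<bar> * norm (y - q)" by (simp add: dist_norm)
    ultimately have "dist q (q + s *\<^sub>R (y - q)) < \<epsilon>"
      using \<open>0 < \<epsilon>\<close> mult_nonneg_nonneg[OF abs_ge_zero[of s] norm_ge_zero[of "y - q"]] by linarith
    then show "cmod (h (q + s *\<^sub>R (y - q))) \<le> 0 * \<bar>s\<bar> ^ Suc j" using assms(3) by simp
  qed (use assms(2) in \<open>auto simp: add_nonneg_pos\<close>)
  then have "h (q + (y - q)) = 0" by (rule eq_0_if_pw_0[OF assms(1)])
  then show "h y = 0 y" by simp
qed


text \<open>On the segment of half-length |z| about p + z in a coordinate direction, h is at most C0
  (2 |z|)^(m+1). Recentring the expansion at p + z turns this into bounds on the coefficients of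
  degree 0 and 1 there, which make up the partial derivative; the coefficient of degree 1 costs one
  power of |z|, hence z \<noteq> 0.\<close>

lemma vanishing_bounds:
  assumes h: "h \<in> H" and van: "\<And>j u. j \<le> m \<Longrightarrow> ip h (pw p j u) = 0"
  shows "\<exists>C\<ge>0. \<forall>i z. z \<noteq> 0 \<longrightarrow> norm z \<le> 1 \<longrightarrow> cmod (partial_deriv i h (p + z)) \<le> C * norm z ^ m"
proof -
  obtain l M where l: "0 < l" and lM: "\<And>q y. dist p q \<le> 2 \<Longrightarrow> dist p y \<le> 2 \<Longrightarrow> l \<le> wt q y \<and> wt q y \<le> M"
    using wt_bounds[of p 2] by metis
  have M: "0 < M" using lM[of p p] l by simp
  obtain C0 where C0: "0 \<le> C0"
    "\<And>u. norm u \<le> 2 \<Longrightarrow> cmod (h (p + u)) \<le> C0 * norm u ^ Suc m"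
  proof
    let ?C = "M * (nrm h * ((1 / \<sigma>) ^ Suc m * exp (4 / (2 * \<sigma>\<^sup>2)) / sqrt (fact (Suc m))))"
    show "0 \<le> ?C" using M h \<sigma>_pos by (simp add: nrm_nonneg)
    fix u :: "real ^ 'd" assume u: "norm u \<le> 2"
    have "(norm u)\<^sup>2 \<le> 4" using power_mono[OF u, of 2] by simp
    then have u4: "(norm u)\<^sup>2 / (2 * \<sigma>\<^sup>2) \<le> 4 / (2 * \<sigma>\<^sup>2)" by (rule divide_right_mono) simp
    have "cmod (h (p + u)) \<le> wt p (p + u) *
        (nrm h * ((norm u / \<sigma>) ^ Suc m * exp ((norm u)\<^sup>2 / (2 * \<sigma>\<^sup>2)) / sqrt (fact (Suc m))))"
      by (rule vanishing_le[OF h van]) simp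
    also have "\<dots> \<le> M * (nrm h * ((norm u / \<sigma>) ^ Suc m * exp (4 / (2 * \<sigma>\<^sup>2)) / sqrt (fact (Suc m))))"
      using M lM[of p "p + u"] u \<sigma>_pos nrm_nonneg[OF h] u4
      by (intro mult_mono divide_right_mono mult_nonneg_nonneg) (auto simp: dist_self_add simp del: divide_le_cancel)
    also have "\<dots> = ?C * norm u ^ Suc m" by (simp add: power_divide del: power_Suc)
    finally show "cmod (h (p + u)) \<le> ?C * norm u ^ Suc m" .
  qed
  \<comment> \<open>Remainder of order m + 2, that is Taylor polynomials of degree m + 1: this
    degree is at least 1 even for m = 0, so the first-order coefficient is among those
    bounded.\<close>
  obtain C where C: "C \<ge> 0" "\<And>q u. norm u \<le> 1 \<Longrightarrow> cmod (ip h (rest q (Suc (Suc m)) u)) \<le> C * norm u ^ Suc (Suc m)"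
    using rest_bound[OF h, of "Suc (Suc m)"] by blast
  define K where "K = (C0 * 2 ^ Suc m / l + C) * 2 ^ Suc m * 4"
  have K: "K \<ge> 0" using C0 C l by (simp add: K_def)
  define E where "E = \<bar>1 - c\<bar> * (norm (p - b) + 1) / \<sigma>\<^sup>2"
  have E: "E \<ge> 0" by (simp add: E_def)
  show ?thesis
  proof (intro exI[of _ "M * (E * K + K)"] conjI allI impI)
    show "M * (E * K + K) \<ge> 0" using M E K by simp
    fix i and z :: "real ^ 'd" assume z: "z \<noteq> 0" "norm z \<le> 1"
    let ?t = "norm z" and ?w = "axis i 1 :: real ^ 'd"
    let ?b = "\<lambda>j. cmod (ip h (pw (p + z) j ?w))"
    have w: "norm ?w = 1" by simp
    have bd: "?b j * ?t ^ j \<le> K * ?t ^ Suc m" if "j \<le> 1" for j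
    proof -
      have "?b j * ?t ^ j \<le> (C0 * 2 ^ Suc m / l + C) * ?t ^ Suc m * 2 ^ Suc m * 4 ^ j"
      proof (rule pw_coeff_bound[OF h _ z(2) _ _ l _ _ C(2) _ C(1)])
        fix s :: real assume s: "\<bar>s\<bar> \<le> ?t"
        have n2: "norm (z + s *\<^sub>R ?w) \<le> 2 * ?t"
          using norm_triangle_ineq[of z "s *\<^sub>R ?w"] s by simp
        then show "l \<le> wt (p + z) (p + z + s *\<^sub>R ?w)"
          using lM[of "p + z" "p + (z + s *\<^sub>R ?w)"] z by (simp add: dist_self_add add.assoc)
        have "cmod (h (p + (z + s *\<^sub>R ?w))) \<le> C0 * norm (z + s *\<^sub>R ?w) ^ Suc m"
          using n2 z by (intro C0) auto
        also have "\<dots> \<le> C0 * (2 * ?t) ^ Suc m"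
          using n2 C0 by (intro mult_left_mono power_mono) auto
        finally show "cmod (h (p + z + s *\<^sub>R ?w)) \<le> C0 * 2 ^ Suc m * ?t ^ Suc m"
          by (simp add: power_mult_distrib mult_ac add.assoc)
      qed (use z that in auto)
      also have "\<dots> \<le> (C0 * 2 ^ Suc m / l + C) * ?t ^ Suc m * 2 ^ Suc m * 4 ^ 1"
        using that C0 C l by (intro mult_left_mono power_increasing) auto
      finally show ?thesis by (simp add: K_def mult_ac)
    qed
    have b0: "?b 0 \<le> K * ?t ^ m"
    proof -
      have "K * ?t ^ Suc m \<le> K * ?t ^ m" using z K by (intro mult_left_mono power_decreasing) auto
      then show ?thesis using bd[of 0] by simp
    qed
    have b1: "?b 1 \<le> K * ?t ^ m"
      using bd[of 1] z by (simp add: mult.assoc[symmetric] mult.commute[of ?t])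
    have e: "\<bar>(1 - c) * (?w \<bullet> (p + z - b)) / \<sigma>\<^sup>2\<bar> \<le> E"
    proof -
      have "\<bar>?w \<bullet> (p + z - b)\<bar> \<le> norm (p + z - b)"
        using Cauchy_Schwarz_ineq2[of ?w "p + z - b"] w by simp
      also have "\<dots> \<le> norm (p - b) + 1"
        using norm_triangle_ineq[of "p - b" z] z by (simp add: algebra_simps)
      finally show ?thesis unfolding E_def abs_divide abs_mult
        by (simp add: divide_right_mono mult_left_mono)
    qed
    have "cmod (partial_deriv i h (p + z)) \<le> wt (p + z) (p + z) *
      (\<bar>(1 - c) * (?w \<bullet> (p + z - b)) / \<sigma>\<^sup>2\<bar> * ?b 0 + ?b 1)"
      unfolding partial_deriv_mem[OF h] norm_mult norm_of_real abs_of_pos[OF wt_pos(1)]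
      by (intro mult_left_mono order_trans[OF norm_triangle_ineq]) (simp_all only: norm_mult norm_of_real order_refl less_imp_le wt_pos)
    also have "\<dots> \<le> M * (E * (K * ?t ^ m) + K * ?t ^ m)"
      using b0 b1 e E M lM[of "p + z" "p + z"] z
      by (intro mult_mono add_mono) (auto simp: dist_norm intro!: add_nonneg_nonneg)
    also have "\<dots> = M * (E * K + K) * ?t ^ m" by (simp add: algebra_simps)
    finally show "cmod (partial_deriv i h (p + z)) \<le> M * (E * K + K) * ?t ^ m" .
  qed
qed

text \<open>Differentiation loses one order of vanishing at p, and F, being O(|z|) there, restores
  it. \<open>pw_0_if_vanishing\<close> translates the resulting estimate back into Taylor
  coefficients.\<close>

lemma koopman_vanishing:
  assumes h: "h \<in> H" and Ah: "koopman_gen F h \<in> H"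
    and F: "\<And>z. norm z \<le> 1 \<Longrightarrow> norm (F (p + z)) \<le> L * norm z"
    and van: "\<And>j u. j \<le> m \<Longrightarrow> ip h (pw p j u) = 0" and "j \<le> m"
  shows "ip (koopman_gen F h) (pw p j u) = 0"
proof -
  obtain C where C: "C \<ge> 0" "\<And>i z. z \<noteq> 0 \<Longrightarrow> norm z \<le> 1 \<Longrightarrow> cmod (partial_deriv i h (p + z)) \<le> C * norm z ^ m"
    using vanishing_bounds[OF h van] by blast
  \<comment> \<open>Any vector of norm 1 forces L \<ge> 0; \<open>undefined\<close> only selects a
    coordinate.\<close>
  have L: "L \<ge> 0" using F[of "axis undefined 1"] by (smt (verit, best) norm_axis_1 norm_ge_zero mult_cancel_left1)
  show ?thesis
  proof (rule pw_0_if_vanishing[OF Ah _ _ \<open>j \<le> m\<close>, of "1 / (norm u + 1)" _ _ "real CARD('d) * L * C * norm u ^ Suc m"])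
    fix s :: real assume "\<bar>s\<bar> \<le> 1 / (norm u + 1)"
    then have s: "norm (s *\<^sub>R u) \<le> 1" by (rule norm_scaleR_le_1)
    show "cmod (koopman_gen F h (p + s *\<^sub>R u)) \<le> real CARD('d) * L * C * norm u ^ Suc m * \<bar>s\<bar> ^ Suc m"
    proof (cases "s *\<^sub>R u = 0")
      \<comment> \<open>The derivative estimate excludes the point p itself; there the generator
        gives 0 because F does.\<close>
      case True
      moreover have "F p = 0" using F[of 0] by simp
      ultimately have "F (p + s *\<^sub>R u) = 0" by (simp only: add_0_right)
      then show ?thesis using L C(1) by (simp add: koopman_gen_def)
    next
      case False
      have "cmod (koopman_gen F h (p + s *\<^sub>R u)) \<le> (\<Sum>i\<in>(UNIV::'d set). (L * norm (s *\<^sub>R u)) * (C * norm (s *\<^sub>R u) ^ m))"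
        unfolding koopman_gen_def
      proof (rule sum_norm_le)
        fix i
        have "\<bar>F (p + s *\<^sub>R u) $ i\<bar> \<le> L * norm (s *\<^sub>R u)"
          using component_le_norm_cart[of "F (p + s *\<^sub>R u)" i] F[OF s] by linarith
        then show "cmod (complex_of_real (F (p + s *\<^sub>R u) $ i) * partial_deriv i h (p + s *\<^sub>R u))
          \<le> L * norm (s *\<^sub>R u) * (C * norm (s *\<^sub>R u) ^ m)"
          unfolding norm_mult norm_of_real using C(2)[OF False s] L by (intro mult_mono) auto
      qed
      also have "\<dots> = real CARD('d) * L * C * norm u ^ Suc m * \<bar>s\<bar> ^ Suc m"
        by (simp add: power_mult_distrib mult_ac)
      finally show ?thesis .
    qed
  qed (simp add: add_nonneg_pos)
qed

end

text \<open>\<open>Ck_fun\<close> speaks of partial derivatives only, so p + z is reached from p by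
  moving one coordinate at a time, with the mean value inequality on each piece. The intermediate
  points stay in the unit ball about p because their displacements are componentwise dominated by
  z.\<close>

lemma linear_bound_if_Ck_1:
  fixes F :: "real ^ 'd \<Rightarrow> real ^ 'd"
  assumes "Ck_fun (Suc 0) F" "F p = 0"
  shows "\<exists>L. \<forall>z. norm z \<le> 1 \<longrightarrow> norm (F (p + z)) \<le> L * norm z"
proof -
  have diff: "(\<lambda>t. F (x + t *\<^sub>R axis i 1)) differentiable (at 0)"
    and cont: "continuous_on UNIV (partial_deriv i F)" for i x
    using assms(1) by auto
  have "\<exists>M. \<forall>x\<in>cball p 1. norm (partial_deriv i F x) \<le> M" for i
    using compact_imp_bounded[OF compact_continuous_image[OF continuous_on_subset[OF cont subset_UNIV] compact_cball]]
    by (auto simp: bounded_iff)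
  then obtain M where M: "\<And>i x. dist p x \<le> 1 \<Longrightarrow> norm (partial_deriv i F x) \<le> M i"
    unfolding mem_cball Ball_def by metis
  have M0: "0 \<le> M i" for i using M[of p i] order_trans[OF norm_ge_zero] by simp
  have step: "norm (F (x + T *\<^sub>R axis i 1) - F x) \<le> M i * \<bar>T\<bar>"
    if "\<And>t. t \<in> closed_segment 0 T \<Longrightarrow> dist p (x + t *\<^sub>R axis i 1) \<le> 1" for x T i
  proof -
    let ?d = "\<lambda>t. partial_deriv i F (x + t *\<^sub>R axis i 1)"
    have der: "((\<lambda>t. F (x + t *\<^sub>R axis i 1)) has_vector_derivative ?d t) (at t)" for t
    proof -
      have "((\<lambda>s. F ((x + t *\<^sub>R axis i 1) + s *\<^sub>R axis i 1)) has_vector_derivative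
          ?d t) (at (t - t))"
        unfolding partial_deriv_def using diff[of "x + t *\<^sub>R axis i 1" i]
        by (simp add: vector_derivative_works[symmetric])
      moreover have "((\<lambda>u. u - t) has_vector_derivative 1) (at t)"
        by (auto intro!: derivative_eq_intros)
      ultimately have "((\<lambda>s. F ((x + t *\<^sub>R axis i 1) + s *\<^sub>R axis i 1)) \<circ> (\<lambda>u. u - t) has_vector_derivative
          1 *\<^sub>R ?d t) (at t)"
        by (intro vector_diff_chain_at)
      then show ?thesis by (simp add: o_def algebra_simps)
    qed
    have "norm (F (x + T *\<^sub>R axis i 1) - F (x + 0 *\<^sub>R axis i 1)) \<le> M i * norm (T - 0)"
    proof (rule differentiable_bound[where S = "closed_segment 0 T" and f = "\<lambda>t. F (x + t *\<^sub>R axis i 1)"])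
      fix t assume t: "t \<in> closed_segment 0 T"
      show "((\<lambda>t. F (x + t *\<^sub>R axis i 1)) has_derivative (\<lambda>h. h *\<^sub>R ?d t))
        (at t within closed_segment 0 T)"
        using der[of t] unfolding has_vector_derivative_def by (rule has_derivative_at_withinI)
      show "onorm (\<lambda>h. h *\<^sub>R ?d t) \<le> M i"
        using M[OF that[OF t], of i] by (intro onorm_bound M0) (simp add: mult.commute mult_left_mono)
    qed auto
    then show ?thesis by simp
  qed
  have "norm (F (p + z)) \<le> (\<Sum>i\<in>UNIV. M i) * norm z" if z: "norm z \<le> 1" for z
  proof -
    have axis_nth: "axis i (1::real) $ j = (if j = i then 1 else 0)" for i j :: 'd
      by (simp add: axis_def)
    have comp: "(\<Sum>i\<in>S. (z $ i) *\<^sub>R axis i (1::real)) $ j = (if j \<in> S then z $ j else 0)" for S :: "'d set" and j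
    proof -
      have "(\<Sum>i\<in>S. (z $ i) *\<^sub>R axis i (1::real)) $ j = (\<Sum>i\<in>S. if i = j then z $ i else 0)"
        unfolding sum_component by (rule sum.cong) (auto simp: axis_def)
      then show ?thesis by simp
    qed
    \<comment> \<open>\<open>S\<close> is the set of coordinates already moved; the induction adds
      one edge of the path at a time.\<close>
    have tel: "norm (F (p + (\<Sum>i\<in>S. (z $ i) *\<^sub>R axis i 1))) \<le> (\<Sum>i\<in>S. M i) * norm z" for S :: "'d set"
      using finite[of S]
    proof (induction S rule: finite_induct)
      case (insert i S)
      let ?x = "p + (\<Sum>i\<in>S. (z $ i) *\<^sub>R axis i 1)"
      have "dist p (?x + t *\<^sub>R axis i 1) \<le> 1" if "t \<in> closed_segment 0 (z $ i)" for t
      proof -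
        have "\<bar>t\<bar> \<le> \<bar>z $ i\<bar>" using that by (auto simp: closed_segment_eq_real_ivl split: if_splits)
        then have "norm ((\<Sum>i\<in>S. (z $ i) *\<^sub>R axis i 1) + t *\<^sub>R axis i (1::real)) \<le> norm z"
          using insert.hyps
          by (intro norm_le_componentwise_cart) (auto simp: comp axis_nth simp del: sum_component)
        then show ?thesis using z by (simp add: dist_self_add add.assoc)
      qed
      from step[OF this] have "norm (F (?x + (z $ i) *\<^sub>R axis i 1) - F ?x) \<le> M i * norm z"
        using component_le_norm_cart[of z i] M0[of i] by (meson mult_left_mono order_trans)
      then have "norm (F (?x + (z $ i) *\<^sub>R axis i 1)) \<le> M i * norm z + (\<Sum>i\<in>S. M i) * norm z"
        using insert.IH norm_triangle_sub[of "F (?x + (z $ i) *\<^sub>R axis i 1)" "F ?x"] by linarith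
      then show ?case using insert.hyps by (simp add: algebra_simps)
    qed (simp add: assms(2))
    have "(\<Sum>i\<in>UNIV. (z $ i) *\<^sub>R axis i (1::real)) = z" by (simp add: Finite_Cartesian_Product.vec_eq_iff comp del: sum_component)
    then show ?thesis using tel[of UNIV] by simp
  qed
  then show ?thesis by blast
qed


section \<open>The jet spaces\<close>

text \<open>
  These Hermite polynomials satisfy \<open>(\<partial>/\<partial>x\<^sub>i)\<^sup>n k x y = herm (c / \<sigma>\<^sup>2) n (lin i x y) * k x y\<close>,
  where \<open>lin i x y\<close> is the logarithmic derivative of \<open>k\<close> (see \<open>funpow_partial_deriv\<close> below).
\<close>

fun herm :: "real \<Rightarrow> nat \<Rightarrow> real \<Rightarrow> real" where
  "herm \<tau> 0 x = 1"
| "herm \<tau> (Suc 0) x = x"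
| "herm \<tau> (Suc (Suc n)) x = x * herm \<tau> (Suc n) x - \<tau> * real (Suc n) * herm \<tau> n x"

lemma herm_Suc: "herm \<tau> (Suc n) x = x * herm \<tau> n x - \<tau> * (real n * herm \<tau> (n - 1) x)"
  by (cases n) auto

text \<open>Together with \<open>herm_Suc\<close> this reads herm (n+1) = x * herm n - \<tau> *
  (herm n)', which is what differentiating k times \<open>herm\<close> of its logarithmic derivative
  produces. At n = 0 the truncated index \<open>n - 1\<close> is multiplied by 0.\<close>

lemma DERIV_herm: "(herm \<tau> n has_real_derivative real n * herm \<tau> (n - 1) x) (at x)"
proof (induction n rule: less_induct)
  case (less n)
  consider "n = 0" | "n = 1" | m where "n = Suc (Suc m)"
    by (metis One_nat_def not0_implies_Suc)
  then show ?case
  proof cases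
    case 1
    then have "herm \<tau> n = (\<lambda>x. 1)" by auto
    then show ?thesis using 1 by simp
  next
    case 2
    then have "herm \<tau> n = (\<lambda>x. x)" by auto
    then show ?thesis using 2 by simp
  next
    case 3
    have "((\<lambda>x. x * herm \<tau> (Suc m) x - \<tau> * real (Suc m) * herm \<tau> m x) has_real_derivative
      1 * herm \<tau> (Suc m) x + real (Suc m) * herm \<tau> m x * x - \<tau> * real (Suc m) * (real m * herm \<tau> (m - 1) x)) (at x)"
      using less[of "Suc m"] less[of m] 3
      by (intro DERIV_diff DERIV_mult DERIV_cmult DERIV_ident) auto
    moreover have "herm \<tau> n = (\<lambda>x. x * herm \<tau> (Suc m) x - \<tau> * real (Suc m) * herm \<tau> m x)"
      using 3 by auto
    moreover have "1 * herm \<tau> (Suc m) x + real (Suc m) * herm \<tau> m x * x - \<tau> * real (Suc m) * (real m * herm \<tau> (m - 1) x)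
      = real n * herm \<tau> (n - 1) x"
      using 3 by (simp add: herm_Suc algebra_simps)
    ultimately show ?thesis by simp
  qed
qed

lemma herm_affine_poly:
  "\<exists>P :: complex poly. degree P \<le> n \<and> (\<forall>t. of_real (herm \<tau> n (a + t * d)) = poly P (of_real t))"
\<comment> \<open>The rule also inducts over the argument x, which does not occur in the claim; 0 is
  a dummy for it.\<close>
proof (induction \<tau> n "0::real" rule: herm.induct)
  case (3 \<tau> n)
  then obtain P Q :: "complex poly" where P: "degree P \<le> Suc n" "\<And>t. of_real (herm \<tau> (Suc n) (a + t * d)) = poly P (of_real t)"
    and Q: "degree Q \<le> n" "\<And>t. of_real (herm \<tau> n (a + t * d)) = poly Q (of_real t)" by blast
  have "degree ([:of_real a, of_real d:] * P) \<le> Suc (Suc n)"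
    using P(1) by (intro order_trans[OF degree_mult_le]) (auto simp: degree_pCons_eq_if)
  then have "degree ([:of_real a, of_real d:] * P - Polynomial.smult (of_real (\<tau> * real (Suc n))) Q) \<le> Suc (Suc n)"
    using Q(1) by (intro degree_diff_le) (auto intro: order_trans[OF degree_smult_le])
  moreover have "of_real (herm \<tau> (Suc (Suc n)) (a + t * d)) =
    poly ([:of_real a, of_real d:] * P - Polynomial.smult (of_real (\<tau> * real (Suc n))) Q) (of_real t)" for t
    by (simp add: P(2)[symmetric] Q(2)[symmetric] algebra_simps del: of_nat_Suc)
  ultimately show ?case by blast
next
  case (1 \<tau>)
  show ?case by (rule exI[of _ 1]) simp
next
  case (2 \<tau>)
  show ?case by (rule exI[of _ "[:of_real a, of_real d:]"]) (simp add: degree_pCons_eq_if)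
qed

lemma coords: "set (coords :: 'd::finite list) = UNIV \<and> distinct (coords :: 'd list)"
  unfolding coords_def by (rule someI_ex) (rule finite_distinct_list[OF finite])

context gaussian_rkhs
begin

definition lin :: "'d \<Rightarrow> real ^ 'd \<Rightarrow> real ^ 'd \<Rightarrow> real" where
  "lin i x y = ((y - b) $ i - c * (x - b) $ i) / \<sigma>\<^sup>2"

lemma lin_axis: "lin j (x + t *\<^sub>R axis i 1) y = (if i = j then lin j x y - t * (c / \<sigma>\<^sup>2) else lin j x y)"
  by (auto simp: lin_def axis_def diff_divide_distrib add_divide_distrib algebra_simps)

lemma kernel_has_derivative:
  "((\<lambda>t. k (x + t *\<^sub>R axis i 1) y) has_vector_derivative of_real (lin i x y) * k x y) (at 0)"
proof -
  define X Y where "X = x - b" and "Y = y - b"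
  have x: "x + t *\<^sub>R axis i 1 - b = X + t *\<^sub>R axis i 1" for t by (simp add: X_def)
  have e: "(norm (X + t *\<^sub>R axis i 1))\<^sup>2 = (norm X)\<^sup>2 + 2 * t * X $ i + t\<^sup>2"
    "(X + t *\<^sub>R axis i 1) \<bullet> Y = X \<bullet> Y + t * Y $ i" for t
    unfolding power2_norm_eq_inner
    by (simp_all add: inner_add_left inner_add_right inner_axis inner_axis' power2_eq_square algebra_simps)
  let ?e = "\<lambda>t. (X \<bullet> Y + t * Y $ i - c * ((norm X)\<^sup>2 + 2 * t * X $ i + t\<^sup>2 + (norm Y)\<^sup>2) / 2) / \<sigma>\<^sup>2"
  have k: "k (x + t *\<^sub>R axis i 1) y = of_real (exp (?e t))" for t
    by (simp add: k_eq x e flip: Y_def)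
  have "(?e has_real_derivative lin i x y) (at 0)"
    unfolding lin_def X_def[symmetric] Y_def[symmetric]
    by (rule DERIV_cdivide) (auto intro!: derivative_eq_intros)
  from DERIV_fun_exp[OF this]
  have "((\<lambda>t. complex_of_real (exp (?e t))) has_vector_derivative of_real (exp (?e 0) * lin i x y)) (at 0)"
    by (rule has_vector_derivative_of_real)
  then show ?thesis using k[of 0] by (simp add: k mult.commute)
qed

definition jet :: "real ^ 'd \<Rightarrow> ('d \<Rightarrow> nat) \<Rightarrow> real ^ 'd \<Rightarrow> complex" where
  "jet p \<alpha> y = k p y * of_real (\<Prod>i\<in>UNIV. herm (c / \<sigma>\<^sup>2) (\<alpha> i) (lin i p y))"

text \<open>Along axis i only \<open>lin i\<close> varies, with slope -c / \<sigma>^2. The factors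
  of the coordinates in S, which the fold has already treated, behave as constants.\<close>

lemma funpow_partial_deriv:
  assumes "i \<notin> S"
  shows "(partial_deriv i ^^ n) (\<lambda>x. k x y * of_real (\<Prod>j\<in>S. herm (c / \<sigma>\<^sup>2) (\<alpha> j) (lin j x y))) =
    (\<lambda>x. k x y * of_real (herm (c / \<sigma>\<^sup>2) n (lin i x y) * (\<Prod>j\<in>S. herm (c / \<sigma>\<^sup>2) (\<alpha> j) (lin j x y))))"
proof (induction n)
  case (Suc n)
  let ?\<tau> = "c / \<sigma>\<^sup>2"
  show ?case
  proof
    fix x
    let ?P = "\<Prod>j\<in>S. herm ?\<tau> (\<alpha> j) (lin j x y)"
    have P: "(\<Prod>j\<in>S. herm ?\<tau> (\<alpha> j) (lin j (x + t *\<^sub>R axis i 1) y)) = ?P" for t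
      using assms by (intro prod.cong) (auto simp: lin_axis)
    have L: "lin i (x + t *\<^sub>R axis i 1) y = lin i x y - t * ?\<tau>" for t by (simp add: lin_axis)
    have "((\<lambda>t. herm ?\<tau> n (lin i x y - t * ?\<tau>)) has_real_derivative
       real n * herm ?\<tau> (n - 1) (lin i x y) * (- ?\<tau>)) (at 0)"
    proof -
      have "((\<lambda>t. lin i x y - t * T) has_real_derivative - T) (at 0)" for T
        by (auto intro!: derivative_eq_intros)
      from DERIV_chain'[OF this[of ?\<tau>], of "herm ?\<tau> n"] DERIV_herm[of ?\<tau> n "lin i x y"] show ?thesis by simp
    qed
    then have "((\<lambda>t. complex_of_real (herm ?\<tau> n (lin i x y - t * ?\<tau>) * ?P)) has_vector_derivative
       of_real (real n * herm ?\<tau> (n - 1) (lin i x y) * (- ?\<tau>) * ?P)) (at 0)"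
      by (intro has_vector_derivative_of_real DERIV_cmult_right)
    from has_vector_derivative_mult[OF kernel_has_derivative[of x i y] this]
    have "((\<lambda>t. k (x + t *\<^sub>R axis i 1) y * of_real (herm ?\<tau> n (lin i (x + t *\<^sub>R axis i 1) y) *
        (\<Prod>j\<in>S. herm ?\<tau> (\<alpha> j) (lin j (x + t *\<^sub>R axis i 1) y)))) has_vector_derivative
      k x y * of_real (herm ?\<tau> (Suc n) (lin i x y) * ?P)) (at 0)"
      unfolding P L by (rule has_vector_derivative_eq_rhs) (simp add: herm_Suc algebra_simps)
    then have "partial_deriv i (\<lambda>x. k x y * of_real (herm ?\<tau> n (lin i x y) * (\<Prod>j\<in>S. herm ?\<tau> (\<alpha> j) (lin j x y)))) x =
      k x y * of_real (herm ?\<tau> (Suc n) (lin i x y) * ?P)"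
      unfolding partial_deriv_def by (rule vector_derivative_at)
    then show "(partial_deriv i ^^ Suc n) (\<lambda>x. k x y * of_real (\<Prod>j\<in>S. herm ?\<tau> (\<alpha> j) (lin j x y))) x =
      k x y * of_real (herm ?\<tau> (Suc n) (lin i x y) * ?P)"
      by (simp only: funpow.simps o_apply Suc)
  qed
qed simp

lemma multi_deriv_kernel: "(\<lambda>y. multi_deriv \<alpha> (\<lambda>x. k x y) p) = jet p \<alpha>"
proof
  fix y
  have "foldr (\<lambda>i. partial_deriv i ^^ \<alpha> i) xs (\<lambda>x. k x y) =
    (\<lambda>x. k x y * of_real (\<Prod>j\<in>set xs. herm (c / \<sigma>\<^sup>2) (\<alpha> j) (lin j x y)))" if "distinct xs" for xs
    using that by (induction xs) (auto simp: funpow_partial_deriv simp del: of_real_mult of_real_prod)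
  from this[of coords] show "multi_deriv \<alpha> (\<lambda>x. k x y) p = jet p \<alpha> y"
    using coords[where 'd = 'd] by (simp add: multi_deriv_def jet_def del: of_real_prod)
qed

lemma jet_space_eq: "jet_space k p n = cfun.span {jet p \<alpha> | \<alpha>. (\<Sum>i\<in>UNIV. \<alpha> i) \<le> n}"
  by (simp add: jet_space_def multi_deriv_kernel)

lemma subspace_jet_space: "cfun.subspace (jet_space k p n)"
  by (simp add: jet_space_def)

lemma jet_space_mono: "m \<le> n \<Longrightarrow> jet_space k p m \<subseteq> jet_space k p n"
  unfolding jet_space_def by (rule cfun.span_mono) auto

text \<open>The Hermite recursion read backwards: x * herm n = herm (n+1) + \<tau> n * herm (n-1),
  so multiplication by a coordinate raises the order of a jet by at most one.\<close>

lemma lin_mult_mem: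
  assumes "f \<in> jet_space k p n"
  shows "(\<lambda>y. of_real (lin i p y) * f y) \<in> jet_space k p (Suc n)"
  using assms unfolding jet_space_eq[of p n]
proof (induction rule: cfun.span_induct_alt)
  case base
  then show ?case using cfun.subspace_0[OF subspace_jet_space] by (simp add: zero_fun_def)
next
  case (step a f g)
  then obtain \<alpha> where \<alpha>: "f = jet p \<alpha>" "sum \<alpha> UNIV \<le> n" by auto
  let ?\<tau> = "c / \<sigma>\<^sup>2"
  have sum_upd: "sum (\<alpha>(i := l)) UNIV = l + sum \<alpha> (UNIV - {i})" for l
    by (subst sum.remove[of _ i]) (auto intro!: sum.cong)
  have "jet p (\<alpha>(i := l)) \<in> jet_space k p (Suc n)" if "l \<le> Suc (\<alpha> i)" for l
  proof -
    have "sum (\<alpha>(i := l)) UNIV \<le> Suc n"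
      using that \<alpha>(2) sum.remove[of UNIV i \<alpha>] by (simp add: sum_upd del: fun_upd_apply)
    then show ?thesis unfolding jet_space_eq by (intro cfun.span_base) blast
  qed
  moreover have "(\<lambda>y. of_real (lin i p y) * jet p \<alpha> y) =
    jet p (\<alpha>(i := Suc (\<alpha> i))) + cscale (of_real (?\<tau> * real (\<alpha> i))) (jet p (\<alpha>(i := \<alpha> i - 1)))"
  proof
    fix y
    have prod_upd: "(\<Prod>j\<in>UNIV. herm ?\<tau> ((\<alpha>(i := l)) j) (lin j p y)) =
      herm ?\<tau> l (lin i p y) * (\<Prod>j\<in>UNIV - {i}. herm ?\<tau> (\<alpha> j) (lin j p y))" for l
      by (subst prod.remove[of _ i]) (auto intro!: prod.cong)
    show "of_real (lin i p y) * jet p \<alpha> y =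
      (jet p (\<alpha>(i := Suc (\<alpha> i))) + cscale (of_real (?\<tau> * real (\<alpha> i))) (jet p (\<alpha>(i := \<alpha> i - 1)))) y"
      unfolding jet_def plus_fun_apply cscale_apply prod_upd prod_upd[of "\<alpha> i", simplified fun_upd_triv] herm_Suc
      by (simp add: algebra_simps)
  qed
  ultimately have "(\<lambda>y. of_real (lin i p y) * f y) \<in> jet_space k p (Suc n)"
    unfolding \<alpha>(1) by (simp add: cfun.subspace_add[OF subspace_jet_space] cfun.subspace_scale[OF subspace_jet_space])
  moreover have "(\<lambda>y. of_real (lin i p y) * (cscale a f + g) y) =
    cscale a (\<lambda>y. of_real (lin i p y) * f y) + (\<lambda>y. of_real (lin i p y) * g y)"
    by (auto simp: fun_eq_iff algebra_simps)
  ultimately show ?case using step.IH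
    by (simp add: cfun.subspace_add[OF subspace_jet_space] cfun.subspace_scale[OF subspace_jet_space])
qed

text \<open>The part of \<open>lin i p y\<close> that does not depend on y cancels in
  \<open>lin i p y - lin i p p\<close>. Hence u . (y - p) / \<sigma>^2 is a combination of these
  differences, and each multiplication by it raises the order by one.\<close>

lemma pw_mem_jet_space_self: "pw p j u \<in> jet_space k p j"
proof (induction j)
  case 0
  have "jet p (\<lambda>_. 0) \<in> jet_space k p 0" unfolding jet_space_eq by (intro cfun.span_base) auto
  moreover have "pw p 0 u = cscale (1 / of_real (wt p p)) (jet p (\<lambda>_. 0))"
    by (simp add: pw_def jet_def k_wt[of p _ p] fun_eq_iff)
  ultimately show ?case by (simp only: cfun.subspace_scale[OF subspace_jet_space])
next
  case (Suc j)
  note sub = subspace_jet_space[of p "Suc j"]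
  let ?S = "\<Sum>i\<in>UNIV. cscale (of_real (u $ i))
    ((\<lambda>y. of_real (lin i p y) * pw p j u y) - cscale (of_real (lin i p p)) (pw p j u))"
  have e: "u \<bullet> (y - p) / \<sigma>\<^sup>2 = (\<Sum>i\<in>UNIV. u $ i * (lin i p y - lin i p p))" for y
  proof -
    have "u \<bullet> (y - p) = (\<Sum>i\<in>UNIV. u $ i * (y - p) $ i)" by (simp add: inner_vec_def)
    then show ?thesis
      by (simp add: lin_def sum_divide_distrib diff_divide_distrib[symmetric])
  qed
  have "(\<lambda>y. of_real (lin i p y) * pw p j u y) - cscale (of_real (lin i p p)) (pw p j u) \<in> jet_space k p (Suc j)" for i
    using lin_mult_mem[OF Suc] subsetD[OF jet_space_mono[of j "Suc j"] Suc]
    by (intro cfun.subspace_diff[OF sub] cfun.subspace_scale[OF sub]) auto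
  then have "?S \<in> jet_space k p (Suc j)"
    by (intro cfun.subspace_sum[OF sub] cfun.subspace_scale[OF sub])
  then have "cscale (1 / of_nat (Suc j)) ?S \<in> jet_space k p (Suc j)"
    by (rule cfun.subspace_scale[OF sub])
  moreover have "pw p (Suc j) u = cscale (1 / of_nat (Suc j)) ?S"
  proof
    fix y
    have "pw p (Suc j) u y = 1 / of_nat (Suc j) * (of_real (u \<bullet> (y - p) / \<sigma>\<^sup>2) * pw p j u y)"
      by (simp add: pw_def field_simps)
    also have "\<dots> = 1 / of_nat (Suc j) * (\<Sum>i\<in>UNIV. of_real (u $ i) * (of_real (lin i p y) * pw p j u y - of_real (lin i p p) * pw p j u y))"
      unfolding e of_real_sum sum_distrib_right by (rule arg_cong[where f = "\<lambda>x. _ * x"], rule sum.cong) (auto simp: algebra_simps)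
    finally show "pw p (Suc j) u y = cscale (1 / of_nat (Suc j)) ?S y"
      by (simp add: sum_fun_apply)
  qed
  ultimately show ?case by (simp only:)
qed

lemma pw_mem_jet_space: "j \<le> n \<Longrightarrow> pw p j u \<in> jet_space k p n"
  using pw_mem_jet_space_self jet_space_mono by blast

text \<open>On a line through p each \<open>lin i p\<close> is affine, so the Hermite factor of
  index i becomes a polynomial of degree at most \<alpha> i and a product of them one of degree at
  most the order of the jet.\<close>

lemma jet_space_poly:
  assumes "f \<in> jet_space k p n"
  shows "\<exists>P :: complex poly. degree P \<le> n \<and> (\<forall>t. f (p + t *\<^sub>R u) = of_real (wt p (p + t *\<^sub>R u)) * poly P (of_real t))"
  using assms unfolding jet_space_eq[of p n]
proof (induction rule: cfun.span_induct_alt)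
  case base
  show ?case by (rule exI[of _ 0]) simp
next
  case (step a f g)
  then obtain \<alpha> where \<alpha>: "f = jet p \<alpha>" "sum \<alpha> UNIV \<le> n" by auto
  have "\<exists>P :: complex poly. degree P \<le> \<alpha> i \<and>
    (\<forall>t. of_real (herm (c / \<sigma>\<^sup>2) (\<alpha> i) (lin i p (p + t *\<^sub>R u))) = poly P (of_real t))" for i
  proof -
    have "lin i p (p + t *\<^sub>R u) = lin i p p + t * (u $ i / \<sigma>\<^sup>2)" for t
      by (simp add: lin_def add_divide_distrib[symmetric])
    then show ?thesis using herm_affine_poly[of "\<alpha> i" "c / \<sigma>\<^sup>2" "lin i p p" "u $ i / \<sigma>\<^sup>2"] by simp
  qed
  then obtain P :: "'d \<Rightarrow> complex poly" where P: "\<And>i. degree (P i) \<le> \<alpha> i"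
    "\<And>i t. of_real (herm (c / \<sigma>\<^sup>2) (\<alpha> i) (lin i p (p + t *\<^sub>R u))) = poly (P i) (of_real t)" by metis
  obtain Q where Q: "degree Q \<le> n" "\<And>t. g (p + t *\<^sub>R u) = of_real (wt p (p + t *\<^sub>R u)) * poly Q (of_real t)"
    using step.IH by blast
  have "degree (\<Prod>i\<in>UNIV. P i) \<le> n"
    using degree_prod_sum_le[of UNIV P] sum_mono[of UNIV "\<lambda>i. degree (P i)" \<alpha>] P(1) \<alpha>(2) by (simp add: o_def)
  then have "degree (Polynomial.smult (a * of_real (wt p p)) (\<Prod>i\<in>UNIV. P i) + Q) \<le> n"
    using Q(1) by (intro degree_add_le order_trans[OF degree_smult_le])
  moreover have "(cscale a f + g) (p + t *\<^sub>R u) = of_real (wt p (p + t *\<^sub>R u)) *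
      poly (Polynomial.smult (a * of_real (wt p p)) (\<Prod>i\<in>UNIV. P i) + Q) (of_real t)" for t
    by (simp add: \<alpha>(1) jet_def k_wt[of p _ p] Q(2) P(2) poly_prod algebra_simps)
  ultimately show ?case by blast
qed

text \<open>\<open>jet_space_poly\<close> supplies some polynomial for each direction; uniqueness of
  Taylor coefficients identifies it with the pairings against \<open>pw p j u\<close>, so the
  expansion stops at degree n.\<close>

lemma jet_space_taylor:
  assumes f: "f \<in> jet_space k p n" "f \<in> H"
  shows "n < j \<Longrightarrow> ip f (pw p j u) = 0"
    and "f (p + u) = of_real (wt p (p + u)) * (\<Sum>j\<le>n. ip f (pw p j u))"
proof -
  obtain P :: "complex poly" where P: "degree P \<le> n"
    "\<And>t. f (p + t *\<^sub>R u) = of_real (wt p (p + t *\<^sub>R u)) * poly P (of_real t)"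
    using jet_space_poly[OF f(1)] by blast
  have eq: "ip f (pw p j u) = coeff P j" for j
  proof -
    \<comment> \<open>Large enough both for the polynomial, of degree at most n, and for the
      coefficient of index j under comparison.\<close>
    define N where "N = max n j"
    obtain C where C: "C \<ge> 0" "\<And>q u. norm u \<le> 1 \<Longrightarrow> cmod (ip f (rest q (Suc N) u)) \<le> C * norm u ^ Suc N"
      using rest_bound[OF f(2), of "Suc N"] by blast
    have "ip f (pw p j u) - coeff P j = 0"
    proof (rule coeff_0_if_vanishing[where \<epsilon> = "1 / (norm u + 1)" and n = N and C = "C * norm u ^ Suc N"])
      fix s :: real assume "\<bar>s\<bar> \<le> 1 / (norm u + 1)"
      then have s: "norm (s *\<^sub>R u) \<le> 1" by (rule norm_scaleR_le_1)
      have "poly P (of_real s) = (\<Sum>j<Suc N. ip f (pw p j (s *\<^sub>R u))) + ip f (rest p (Suc N) (s *\<^sub>R u))"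
        using P(2)[of s] taylor[OF f(2), of p "s *\<^sub>R u" "Suc N"] by simp
      moreover have "poly P (of_real s) = (\<Sum>i\<le>N. coeff P i * of_real s ^ i)"
        using P(1) by (intro poly_altdef_le) (simp add: N_def)
      ultimately have "(\<Sum>i\<le>N. of_real s ^ i * (ip f (pw p i u) - coeff P i)) = - ip f (rest p (Suc N) (s *\<^sub>R u))"
        by (simp add: ip_pw_scale[OF f(2)] lessThan_Suc_atMost right_diff_distrib sum_subtractf mult.commute)
      then show "cmod (\<Sum>i\<le>N. of_real s ^ i * (ip f (pw p i u) - coeff P i)) \<le> C * norm u ^ Suc N * \<bar>s\<bar> ^ Suc N"
        using C(2)[OF s, of p] by (simp add: power_mult_distrib mult_ac del: power_Suc)
    qed (auto simp: N_def add_nonneg_pos)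
    then show ?thesis by simp
  qed
  show "n < j \<Longrightarrow> ip f (pw p j u) = 0" using P(1) by (simp add: eq coeff_eq_0)
  show "f (p + u) = of_real (wt p (p + u)) * (\<Sum>j\<le>n. ip f (pw p j u))"
    using P(2)[of 1] poly_altdef_le[OF P(1), of 1] by (simp add: eq)
qed

end


section \<open>The adjoint of the Koopman generator on the jet spaces\<close>

context gaussian_rkhs
begin

lemma partial_deriv_linear:
  assumes "f \<in> H" "g \<in> H"
  shows "partial_deriv i (cscale a f + g) x = a * partial_deriv i f x + partial_deriv i g x"
  using assms
  by (simp add: partial_deriv_mem mem_intros ip_add ip_scale algebra_simps
      del: of_real_divide of_real_mult of_real_diff of_real_add)

lemma koopman_gen_linear:
  assumes "f \<in> H" "g \<in> H"
  shows "koopman_gen F (cscale a f + g) = cscale a (koopman_gen F f) + koopman_gen F g"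
  using assms
  by (simp add: koopman_gen_def fun_eq_iff partial_deriv_linear sum_distrib_left distrib_left sum.distrib mult.left_commute)

lemma partial_deriv_cnj:
  assumes "h \<in> H"
  shows "partial_deriv i (\<lambda>y. cnj (h y)) x = cnj (partial_deriv i h x)"
  using bounded_linear.has_vector_derivative[OF bounded_linear_cnj has_vector_derivative_mem[OF assms, of x "axis i 1"]]
  unfolding partial_deriv_mem[OF assms] by (auto simp: partial_deriv_def intro: vector_derivative_at)

end

locale koopman_jets = gaussian_rkhs H ip k \<sigma> c b
  for H :: "(real ^ 'd \<Rightarrow> complex) set" and ip and k and \<sigma> c :: real and b :: "real ^ 'd" +
  fixes F :: "real ^ 'd \<Rightarrow> real ^ 'd" and p :: "real ^ 'd" and v :: "nat \<Rightarrow> real ^ 'd \<Rightarrow> complex" and L :: real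
  assumes F: "\<And>z. norm z \<le> 1 \<Longrightarrow> norm (F (p + z)) \<le> L * norm z"
    and jets_in_dom: "(\<Union>n. jet_space k p n) \<subseteq> koopman_dom H F"
    and basis: "adapted_orthogonal_basis ip (jet_space k p) v"
begin

definition r :: "nat \<Rightarrow> nat" where "r n = cfun.dim (jet_space k p n)"

definition vv :: "nat \<Rightarrow> real" where "vv i = (nrm (v i))\<^sup>2"

definition Av :: "nat \<Rightarrow> real ^ 'd \<Rightarrow> complex" where "Av i = koopman_gen F (v i)"

definition proj :: "nat \<Rightarrow> (real ^ 'd \<Rightarrow> complex) \<Rightarrow> real ^ 'd \<Rightarrow> complex" where
  "proj n f = (\<Sum>i<r n. cscale (ip f (v i) / of_real (vv i)) (v i))"

lemma jet_mem: "f \<in> jet_space k p n \<Longrightarrow> f \<in> H"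
  and koopman_jet_mem: "f \<in> jet_space k p n \<Longrightarrow> koopman_gen F f \<in> H"
  using jets_in_dom by (auto simp: koopman_dom_def)

lemma v_union: "v i \<in> (\<Union>n. jet_space k p n)"
proof -
  have "v i \<in> cfun.span (range v)" by (rule cfun.span_base) auto
  then show ?thesis using basis by (simp add: adapted_orthogonal_basis_def is_basis_of_def)
qed

lemma v_mem [simp]: "v i \<in> H" and Av_mem [simp]: "Av i \<in> H"
  using v_union[of i] jet_mem koopman_jet_mem unfolding Av_def by blast+

lemma span_v: "cfun.span (v ` {..<r n}) = jet_space k p n"
  and independent_v: "\<not> cfun.dependent (v ` {..<r n})"
  using basis by (auto simp: adapted_orthogonal_basis_def is_basis_of_def r_def)

lemma v_mem_jet: "i < r n \<Longrightarrow> v i \<in> jet_space k p n"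
  unfolding span_v[symmetric] by (rule cfun.span_base) auto

lemma v_nonzero: "v i \<noteq> 0"
proof
  assume "v i = 0"
  then have "0 \<in> range v" by (metis rangeI)
  then show False
    using basis cfun.dependent_zero by (auto simp: adapted_orthogonal_basis_def is_basis_of_def)
qed

lemma vv_pos [simp]: "0 < vv i"
  using v_nonzero[of i] ip_definite[of "v i"] ip_self[of "v i"] by (auto simp: vv_def)

lemma ip_v: "ip (v i) (v j) = (if i = j then of_real (vv i) else 0)"
  using basis ip_self[of "v i"] by (auto simp: adapted_orthogonal_basis_def vv_def)

lemma ip_sum_v: "ip (\<Sum>i<n. cscale (a i) (v i)) (v j) = (if j < n then a j * of_real (vv j) else 0)"
proof -
  have "ip (\<Sum>i<n. cscale (a i) (v i)) (v j) = (\<Sum>i<n. ip (cscale (a i) (v i)) (v j))"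
    by (rule ip_sum) (auto intro: mem_intros)
  also have "\<dots> = (\<Sum>i<n. if i = j then a j * of_real (vv j) else 0)"
    by (rule sum.cong) (auto simp: ip_scale ip_v)
  finally show ?thesis by simp
qed

lemma sum_v_mem_jet: "(\<Sum>i<r n. cscale (a i) (v i)) \<in> jet_space k p n"
  by (intro cfun.subspace_sum cfun.subspace_scale subspace_jet_space v_mem_jet) auto

lemma proj_mem_jet [simp]: "proj n f \<in> jet_space k p n" and proj_mem [simp]: "proj n f \<in> H"
  unfolding proj_def by (auto intro: sum_v_mem_jet jet_mem)

lemma ip_proj_v: "j < r n \<Longrightarrow> ip (proj n f) (v j) = ip f (v j)"
  using vv_pos[of j] by (simp add: proj_def ip_sum_v del: vv_pos)

lemma proj_sum_v: "proj n (\<Sum>i<r n. cscale (a i) (v i)) = (\<Sum>i<r n. cscale (a i) (v i))"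
  unfolding proj_def using vv_pos by (intro sum.cong) (auto simp: ip_sum_v less_imp_neq[symmetric] simp del: vv_pos)

lemma jet_cases:
  assumes "f \<in> jet_space k p n"
  obtains a where "f = (\<Sum>i<r n. cscale (a i) (v i))"
proof -
  have "\<exists>a. f = (\<Sum>i<r n. cscale (a i) (v i))"
    using assms unfolding span_v[symmetric]
  proof (induction rule: cfun.span_induct_alt)
    case base
    show ?case by (rule exI[of _ "\<lambda>_. 0"]) (simp add: sum_fun_apply fun_eq_iff)
  next
    case (step c x y)
    then obtain j where j: "x = v j" "j < r n" by auto
    obtain a where a: "y = (\<Sum>i<r n. cscale (a i) (v i))" using step by blast
    have "(cscale c x + y) z = (\<Sum>i<r n. cscale ((if i = j then c else 0) + a i) (v i)) z" for z
    proof -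
      have "c * v j z = (\<Sum>i<r n. if i = j then c * v j z else 0)" using j by simp
      also have "\<dots> = (\<Sum>i<r n. (if i = j then c else 0) * v i z)" by (intro sum.cong) auto
      finally show ?thesis by (simp add: j a sum_fun_apply distrib_right sum.distrib)
    qed
    then have "cscale c x + y = (\<Sum>i<r n. cscale ((if i = j then c else 0) + a i) (v i))" by (rule ext)
    then show ?case by (rule exI[of _ "\<lambda>i. (if i = j then c else 0) + a i"])
  qed
  then show ?thesis using that by blast
qed

lemma proj_id: "f \<in> jet_space k p n \<Longrightarrow> proj n f = f"
  by (erule jet_cases) (simp add: proj_sum_v)

text \<open>Otherwise \<open>v (r n)\<close> would lie in \<open>jet_space k p n\<close>, although
  it is orthogonal to the whole basis of that space.\<close>

lemma r_mono:
  assumes "m \<le> n"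
  shows "r m \<le> r n"
proof (rule ccontr)
  assume "\<not> r m \<le> r n"
  then have "v (r n) \<in> jet_space k p n"
    using v_mem_jet[of "r n" m] jet_space_mono[OF assms] by auto
  then have "proj n (v (r n)) = v (r n)" by (rule proj_id)
  moreover have "proj n (v (r n)) = 0"
    unfolding proj_def by (rule sum.neutral) (auto simp: ip_v fun_eq_iff)
  ultimately show False using v_nonzero by simp
qed

lemma ip_diff_proj: 
  assumes "f \<in> H" "w \<in> jet_space k p n"
  shows "ip (f - proj n f) w = 0"
proof -
  obtain a where w: "w = (\<Sum>i<r n. cscale (a i) (v i))" using assms(2) by (rule jet_cases)
  have "ip (f - proj n f) (cscale (a i) (v i)) = 0" if "i < r n" for i
    using assms(1) that by (simp add: ip_scale_right diff_mem ip_diff ip_proj_v)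
  then show ?thesis
    unfolding w using assms(1) by (subst ip_sum_right) (auto simp: mem_intros)
qed

lemma nrm_diff_proj_le:
  assumes "f \<in> H"
  shows "nrm (f - proj n f) \<le> nrm f"
proof -
  have "ip (f - proj n f) (f - proj n f) = ip (f - proj n f) f"
    using assms ip_diff_proj[OF assms proj_mem_jet] by (simp add: ip_diff_right diff_mem)
  also have "\<dots> = ip f f - ip (proj n f) f"
    using assms by (simp add: ip_diff)
  also have "ip (proj n f) f = ip (proj n f) (proj n f)"
  proof -
    have "ip f (proj n f) = ip (proj n f) (proj n f)"
      using ip_diff_proj[OF assms proj_mem_jet[of n f]] assms by (simp add: ip_diff)
    then show ?thesis using ip_cnj[OF assms proj_mem[of n f]] ip_cnj[OF proj_mem[of n f] proj_mem[of n f]] by simp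
  qed
  finally have e: "ip (f - proj n f) (f - proj n f) = ip f f - ip (proj n f) (proj n f)" .
  have "Re (ip (f - proj n f) (f - proj n f)) \<le> Re (ip f f)"
    unfolding e using ip_nonneg[OF proj_mem[of n f]] by simp
  then show ?thesis by (simp add: nrm_def)
qed

text \<open>The error of the projection is orthogonal to every \<open>pw p j u\<close> with j \<le>
  n, so its expansion at p starts at degree n + 1. This is the origin of the factorial (n +
  1)!.\<close>

lemma diff_proj_le:
  assumes "f \<in> H"
  shows "cmod ((f - proj n f) (p + u)) \<le> wt p (p + u) * (nrm f *
    ((norm u / \<sigma>) ^ Suc n * exp ((norm u)\<^sup>2 / (2 * \<sigma>\<^sup>2)) / sqrt (fact (Suc n))))"
proof -
  let ?e = "f - proj n f" and ?c = "(norm u / \<sigma>) ^ Suc n * exp ((norm u)\<^sup>2 / (2 * \<sigma>\<^sup>2)) / sqrt (fact (Suc n))"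
  have e: "?e \<in> H" using assms by (intro mem_intros) auto
  have "cmod (?e (p + u)) \<le> wt p (p + u) * (nrm ?e * ?c)"
    by (rule vanishing_le[OF e]) (simp add: ip_diff_proj[OF assms pw_mem_jet_space])
  also have "\<dots> \<le> wt p (p + u) * (nrm f * ?c)"
    using nrm_diff_proj_le[OF assms, of n] \<sigma>_pos
    by (intro mult_left_mono mult_right_mono) (auto simp: less_imp_le)
  finally show ?thesis .
qed

text \<open>Orthogonality to \<open>V\<^sub>p\<^sub>,\<^sub>m\<close> is vanishing to order \<open>m\<close> at \<open>p\<close>, which the generator preserves since \<open>F p = 0\<close>.\<close>

lemma koopman_preserves_orthogonality:
  assumes h: "h \<in> koopman_dom H F" and orth: "\<And>w. w \<in> jet_space k p m \<Longrightarrow> ip h w = 0"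
    and w: "w \<in> jet_space k p m"
  shows "ip (koopman_gen F h) w = 0"
proof -
  let ?f = "koopman_gen F h"
  have hH: "h \<in> H" "?f \<in> H" using h by (auto simp: koopman_dom_def)
  have "ip ?f (pw p j u) = 0" if "j \<le> m" for j u
    by (rule koopman_vanishing[OF hH F _ that]) (use orth pw_mem_jet_space in blast)+
  then have "ip (proj m ?f) (pw p j u) = 0" if "j \<le> m" for j u
    using ip_diff_proj[OF hH(2) pw_mem_jet_space[OF that]] that hH by (simp add: ip_diff)
  \<comment> \<open>An element of \<open>jet_space k p m\<close> is determined by its coefficients
    of degree at most m.\<close>
  then have "proj m ?f (p + u) = 0" for u
    using jet_space_taylor(2)[OF proj_mem_jet proj_mem, of m ?f u] by simp
  from this[of "_ - p"] have "proj m ?f = 0" by (auto simp: fun_eq_iff)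
  then show ?thesis using ip_diff_proj[OF hH(2) w] by simp
qed

text \<open>Since the generator preserves orthogonality to \<open>jet_space k p m\<close>, the
  pairing of \<open>koopman_gen F h\<close> with \<open>v j\<close> depends only on
  \<open>proj m h\<close>. Expanding that projection in the basis yields the coordinates of the
  adjoint.\<close>

lemma adjoint_v:
  assumes j: "j < r m"
  shows "adjoint_op H ip (koopman_dom H F) (koopman_gen F) (v j) =
    (\<Sum>i<r m. cscale (ip (v j) (Av i) / of_real (vv i)) (v i))" (is "_ = ?w")
  unfolding adjoint_op_def
proof (rule the_equality)
  have w: "?w \<in> H" by (intro mem_intros) auto
  show *: "?w \<in> H \<and> (\<forall>h\<in>koopman_dom H F. ip (koopman_gen F h) (v j) = ip h ?w)"
  proof (intro conjI ballI w)
    fix h assume h: "h \<in> koopman_dom H F"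
    then have hH: "h \<in> H" "koopman_gen F h \<in> H" by (auto simp: koopman_dom_def)
    have lin: "koopman_gen F (cscale (- 1) (proj m h) + h) = cscale (- 1) (koopman_gen F (proj m h)) + koopman_gen F h"
      by (rule koopman_gen_linear) (use hH in auto)
    then have lin: "koopman_gen F (h - proj m h) = koopman_gen F h - koopman_gen F (proj m h)"
      by (simp add: fun_eq_iff cscale_def plus_fun_def fun_diff_def)
    have "koopman_gen F (h - proj m h) \<in> H"
      unfolding lin using koopman_jet_mem[OF proj_mem_jet[of m h]] hH by (intro mem_intros)
    then have "h - proj m h \<in> koopman_dom H F" using hH by (simp add: koopman_dom_def diff_mem)
    from koopman_preserves_orthogonality[OF this _ v_mem_jet[OF j]] ip_diff_proj[OF hH(1)]
    have "ip (koopman_gen F (h - proj m h)) (v j) = 0" by blast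
    then have "ip (koopman_gen F h) (v j) = ip (koopman_gen F (proj m h)) (v j)"
      unfolding lin ip_diff[OF hH(2) koopman_jet_mem[OF proj_mem_jet[of m h]] v_mem] by (simp only: right_minus_eq)
    also have "koopman_gen F (proj m h) = (\<Sum>i<r m. cscale (ip h (v i) / of_real (vv i)) (Av i))"
    proof -
      have "koopman_gen F (\<Sum>i<l. cscale (a i) (v i)) = (\<Sum>i<l. cscale (a i) (Av i))" for l a
      proof (induction l)
        case 0
        have "koopman_gen F 0 = 0"
          using koopman_gen_linear[OF zero_mem zero_mem, of F "- 1"] by simp
        then show ?case by (simp only: lessThan_0 sum.empty)
      next
        case (Suc l)
        have "(\<Sum>i<l. cscale (a i) (v i)) \<in> H" by (intro mem_intros) auto
        from koopman_gen_linear[OF v_mem this, of F "a l" l] show ?case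
          unfolding sum.lessThan_Suc Suc Av_def by (simp only: add.commute)
      qed
      then show ?thesis by (simp add: proj_def)
    qed
    also have "ip \<dots> (v j) = (\<Sum>i<r m. ip h (v i) / of_real (vv i) * ip (Av i) (v j))"
      by (subst ip_sum) (auto intro: mem_intros simp: ip_scale)
    also have "\<dots> = (\<Sum>i<r m. ip h (cscale (ip (v j) (Av i) / of_real (vv i)) (v i)))"
      by (rule sum.cong) (simp_all add: ip_scale_right hH ip_cnj[of "v j" "Av _"])
    also have "\<dots> = ip h ?w"
      by (rule ip_sum_right[symmetric]) (auto intro: mem_intros hH)
    finally show "ip (koopman_gen F h) (v j) = ip h ?w" .
  qed
  \<comment> \<open>Uniqueness, for the definite description: the domain contains all
    \<open>pw p l u\<close>, and an element of H orthogonal to all of them is 0.\<close>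
  fix w' assume w': "w' \<in> H \<and> (\<forall>h\<in>koopman_dom H F. ip (koopman_gen F h) (v j) = ip h w')"
  have "ip (w' - ?w) (pw p l u) = 0" for l u
  proof -
    have "pw p l u \<in> koopman_dom H F" using jets_in_dom pw_mem_jet_space_self by blast
    then have "ip (pw p l u) w' = ip (pw p l u) ?w"
      using bspec[OF conjunct2[OF *]] bspec[OF conjunct2[OF w']] by simp
    then have "ip (pw p l u) (w' - ?w) = 0"
      by (simp only: ip_diff_right[OF conjunct1[OF w'] w pw_mem] right_minus_eq)
    then show ?thesis
      using ip_cnj[OF pw_mem diff_mem[OF conjunct1[OF w'] w], of p l u] by (simp only: complex_cnj_zero)
  qed
  then have 0: "(w' - ?w) (p + u) = 0" for u
    by (rule eq_0_if_pw_0[OF diff_mem[OF conjunct1[OF w'] w]])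
  show "w' = ?w"
  proof
    fix y
    show "w' y = ?w y" using 0[of "y - p"] unfolding minus_apply by (simp only: right_minus_eq add.commute[of p] diff_add_cancel)
  qed
qed

lemma op_matrix_adjoint:
  assumes "i < r m" "j < r m"
  shows "op_matrix (adjoint_op H ip (koopman_dom H F) (koopman_gen F)) v (r m) $$ (i, j) =
    ip (v j) (Av i) / of_real (vv i)"
proof -
  let ?a = "\<lambda>i. ip (v j) (Av i) / of_real (vv i)"
  let ?w = "\<Sum>i<r m. cscale (?a i) (v i)"
  let ?B = "v ` {..<r m}"
  have w: "?w \<in> jet_space k p m" by (rule sum_v_mem_jet)
  have inj: "inj v" using basis by (simp add: adapted_orthogonal_basis_def)
  have "?w = (\<Sum>b\<in>?B. cscale (cfun.representation ?B ?w b) b)"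
    using w independent_v[of m] by (intro cfun.sum_representation_eq[symmetric]) (auto simp: span_v)
  also have "\<dots> = (\<Sum>i<r m. cscale (cfun.representation ?B ?w (v i)) (v i))"
    by (subst sum.reindex) (auto intro: inj_on_subset[OF inj])
  finally have "ip ?w (v i) = cfun.representation ?B ?w (v i) * of_real (vv i)"
    using ip_sum_v[of "\<lambda>i. cfun.representation ?B ?w (v i)" "r m" i] assms by simp
  then have "cfun.representation ?B ?w (v i) = ?a i"
    using ip_sum_v[of ?a "r m" i] assms vv_pos[of i] by (simp del: vv_pos)
  then show ?thesis using assms by (simp add: op_matrix_def adjoint_v)
qed

end


section \<open>Gram matrices and coefficient bounds\<close>

text \<open>Inverses of Gram matrices are written as adjugate over determinant: both are polynomials
  in the entries, so limits and bounds pass through entrywise.\<close>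

lemma adj_mat_sum:
  fixes A :: "complex mat"
  assumes A: "A \<in> carrier_mat n n" and "i < n" "j < n"
  shows "(\<Sum>l<n. adj_mat A $$ (i, l) * A $$ (l, j)) = (if i = j then det A else 0)"
proof -
  have "(adj_mat A * A) $$ (i, j) = (\<Sum>l<n. adj_mat A $$ (i, l) * A $$ (l, j))"
    using A adj_mat(1)[OF A] assms(2,3) by (auto simp: scalar_prod_def lessThan_atLeast0)
  then show ?thesis using assms(2,3) adj_mat(3)[OF A] by auto
qed

lemma det_nonzeroI:
  fixes A :: "complex mat"
  assumes A: "A \<in> carrier_mat n n"
    and inj: "\<And>x. (\<And>i. i < n \<Longrightarrow> (\<Sum>j<n. A $$ (i, j) * x j) = 0) \<Longrightarrow> (\<And>j. j < n \<Longrightarrow> x j = 0)"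
  shows "det A \<noteq> 0"
proof
  assume "det A = 0"
  then obtain x where x: "x \<in> carrier_vec n" "x \<noteq> 0\<^sub>v n" "A *\<^sub>v x = 0\<^sub>v n"
    using det_0_iff_vec_prod_zero_field[OF A] by blast
  have "(\<Sum>j<n. A $$ (i, j) * vec_index x j) = 0" if "i < n" for i
  proof -
    have "vec_index (A *\<^sub>v x) i = (\<Sum>j<n. A $$ (i, j) * vec_index x j)"
      using that x(1) A by (auto simp: scalar_prod_def lessThan_atLeast0)
    then show ?thesis using that x(3) by simp
  qed
  from inj[OF this] have "x = 0\<^sub>v n" using x(1) by (intro eq_vecI) auto
  then show False using x(2) by simp
qed

lemma rectangle_eq_cbox: "rectangle a e = cbox (a - e) (a + e)"
  by (auto simp: rectangle_def mem_box_cart)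

lemma continuous_AE_box:
  fixes f :: "real ^ 'd \<Rightarrow> complex"
  assumes cont: "continuous_on UNIV f" and "AE x in lborel. x \<in> rectangle a e \<longrightarrow> f x = 0"
    and "x \<in> box (a - e) (a + e)"
  shows "f x = 0"
proof (rule ccontr)
  assume nz: "f x \<noteq> 0"
  define S where "S = box (a - e) (a + e) \<inter> {x. f x \<noteq> 0}"
  have "open {x. f x \<noteq> 0}"
    by (rule open_Collect_neq[OF cont continuous_on_const])
  then have S: "open S" "S \<noteq> {}" using nz assms(3) by (auto simp: S_def)
  have "S \<subseteq> {x. \<not> (x \<in> rectangle a e \<longrightarrow> f x = 0)}"
    by (auto simp: S_def rectangle_def mem_box_cart less_imp_le)
  moreover obtain N where "{x \<in> space lborel. \<not> (x \<in> rectangle a e \<longrightarrow> f x = 0)} \<subseteq> N" "emeasure lborel N = 0" "N \<in> sets lborel"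
    using assms(2) by (rule AE_E)
  ultimately have "S \<subseteq> N" "N \<in> null_sets lborel" by auto
  then have "negligible S"
    using negligible_iff_null_sets negligible_subset null_sets_completionI by blast
  then show False using open_not_negligible S by blast
qed

section \<open>Measures for which elements of the space are determined by their values almost
  everywhere\<close>

context gaussian_rkhs
begin

text \<open>What invertible Gram matrices require: the compact set makes elements of H bounded
  almost everywhere, hence their products integrable, and the last clause makes the L^2 seminorm
  definite on H. It is applied to the sampling law and to Lebesgue measure on a small box.\<close>

definition determining :: "(real ^ 'd) measure \<Rightarrow> bool" where
  "determining \<nu> \<longleftrightarrow> finite_measure \<nu> \<and> sets \<nu> = sets borel \<and> (\<exists>K. compact K \<and> (AE x in \<nu>. x \<in> K)) \<and>
    (\<forall>f\<in>H. (AE x in \<nu>. f x = 0) \<longrightarrow> f = 0)"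

text \<open>A continuous function that vanishes almost everywhere on a box vanishes in its interior,
  and \<open>eq_0_if_locally_0\<close> propagates this to the whole space.\<close>

lemma determiningI:
  assumes "finite_measure \<nu>" "sets \<nu> = sets borel" "compact K" "AE x in \<nu>. x \<in> K" and e: "\<And>i. 0 < e $ i"
    and ae: "\<And>P. (AE x in \<nu>. P x) \<Longrightarrow> (AE x in lborel. x \<in> rectangle a e \<longrightarrow> P x)"
  shows "determining \<nu>"
proof -
  have "f = 0" if f: "f \<in> H" and "AE x in \<nu>. f x = 0" for f
  proof -
    have 0: "f x = 0" if "x \<in> box (a - e) (a + e)" for x
      by (rule continuous_AE_box[OF continuous_on_mem[OF f] ae[OF \<open>AE x in \<nu>. f x = 0\<close>] that])
    have "a \<in> box (a - e) (a + e)" using e by (simp add: mem_box_cart)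
    then obtain d where d: "d > 0" "ball a d \<subseteq> box (a - e) (a + e)"
      using open_contains_ball[of "box (a - e) (a + e)"] open_box by blast
    then show "f = 0" by (intro eq_0_if_locally_0[OF f d(1), of a] 0) auto
  qed
  then show ?thesis using assms unfolding determining_def by blast
qed

lemma determining_measurable:
  "determining \<nu> \<Longrightarrow> continuous_on UNIV h \<Longrightarrow> h \<in> borel_measurable \<nu>" for h :: "_ \<Rightarrow> complex"
  using borel_measurable_continuous_onI[of h] measurable_cong_sets[of \<nu> borel borel borel]
  by (auto simp: determining_def)

lemma determining_bounded:
  assumes "determining \<nu>" "h \<in> H"
  shows "\<exists>B\<ge>0. AE x in \<nu>. cmod (h x) \<le> B"
proof -
  obtain K where K: "compact K" "AE x in \<nu>. x \<in> K" using assms(1) by (auto simp: determining_def)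
  have "bounded (h ` K)"
    by (intro compact_imp_bounded compact_continuous_image continuous_on_mem assms K)
  then obtain B where "B > 0" "\<And>x. x \<in> K \<Longrightarrow> cmod (h x) \<le> B" unfolding bounded_pos by auto
  then show ?thesis using K(2) by (intro exI[of _ B]) auto
qed

lemma determining_integrable_mult:
  assumes \<nu>: "determining \<nu>" "g \<in> H" "h \<in> H"
  shows "integrable \<nu> (\<lambda>x. cnj (g x) * h x)"
proof -
  interpret finite_measure \<nu> using \<nu>(1) by (simp add: determining_def)
  obtain B B' where B: "B \<ge> 0" and bd: "AE x in \<nu>. cmod (g x) \<le> B" "AE x in \<nu>. cmod (h x) \<le> B'"
    using determining_bounded \<nu> by metis
  from bd have "AE x in \<nu>. norm (cnj (g x) * h x) \<le> B * B'"
    by eventually_elim (use B in \<open>auto simp: norm_mult intro!: mult_mono\<close>)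
  moreover have "(\<lambda>x. cnj (g x) * h x) \<in> borel_measurable \<nu>"
    by (intro determining_measurable[OF \<nu>(1)] continuous_intros continuous_on_mem \<nu>)
  ultimately show ?thesis by (rule integrable_const_bound)
qed

lemma determining_integrable:
  assumes \<nu>: "determining \<nu>" "h \<in> H"
  shows "integrable \<nu> h"
proof -
  interpret finite_measure \<nu> using \<nu>(1) by (simp add: determining_def)
  show ?thesis using determining_bounded[OF \<nu>] determining_measurable[OF \<nu>(1) continuous_on_mem[OF \<nu>(2)]]
    by (auto intro: integrable_const_bound)
qed

end

context koopman_jets
begin

text \<open>The Gram matrix in L^2(\<nu>), in contrast to \<open>gram_matrix\<close>, which is taken
  in H. The conjugate is on the first factor, so that for \<nu> = \<mu> it is the limit of V times
  its adjoint, divided by N.\<close>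

definition gram :: "(real ^ 'd) measure \<Rightarrow> nat \<Rightarrow> complex mat" where
  "gram \<nu> l = mat l l (\<lambda>(i, j). \<integral>x. cnj (v i x) * v j x \<partial>\<nu>)"

lemma gram_carrier [simp]: "gram \<nu> l \<in> carrier_mat l l"
  and gram_index [simp]: "i < l \<Longrightarrow> j < l \<Longrightarrow> gram \<nu> l $$ (i, j) = (\<integral>x. cnj (v i x) * v j x \<partial>\<nu>)"
  by (auto simp: gram_def)

lemma gram_sum:
  assumes "determining \<nu>" "i < l"
  shows "(\<Sum>j<l. gram \<nu> l $$ (i, j) * \<beta> j) = (\<integral>x. cnj (v i x) * (\<Sum>j<l. cscale (\<beta> j) (v j)) x \<partial>\<nu>)"
proof -
  have "(\<integral>x. cnj (v i x) * (\<Sum>j<l. cscale (\<beta> j) (v j)) x \<partial>\<nu>) = (\<integral>x. (\<Sum>j<l. cnj (v i x) * v j x * \<beta> j) \<partial>\<nu>)"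
    by (simp add: sum_fun_apply sum_distrib_left mult_ac)
  also have "\<dots> = (\<Sum>j<l. (\<integral>x. cnj (v i x) * v j x * \<beta> j \<partial>\<nu>))"
    by (intro Bochner_Integration.integral_sum integrable_mult_left determining_integrable_mult assms v_mem)
  also have "\<dots> = (\<Sum>j<l. gram \<nu> l $$ (i, j) * \<beta> j)"
    using assms(2) by (intro sum.cong) auto
  finally show ?thesis by simp
qed

lemma integral_cnj_sum:
  assumes \<nu>: "determining \<nu>" and h: "h \<in> H" and f: "f = (\<Sum>i<l. cscale (\<beta> i) (v i))"
  shows "(\<integral>x. cnj (f x) * h x \<partial>\<nu>) = (\<Sum>i<l. cnj (\<beta> i) * (\<integral>x. cnj (v i x) * h x \<partial>\<nu>))"
proof -
  have "cnj (f x) * h x = (\<Sum>i<l. cnj (\<beta> i) * (cnj (v i x) * h x))" for x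
    by (simp add: f sum_fun_apply sum_distrib_right mult.assoc)
  then have "(\<integral>x. cnj (f x) * h x \<partial>\<nu>) = (\<integral>x. (\<Sum>i<l. cnj (\<beta> i) * (cnj (v i x) * h x)) \<partial>\<nu>)" by simp
  also have "\<dots> = (\<Sum>i<l. cnj (\<beta> i) * (\<integral>x. cnj (v i x) * h x \<partial>\<nu>))"
    by (subst Bochner_Integration.integral_sum) (auto intro!: integrable_mult_right determining_integrable_mult \<nu> h)
  finally show ?thesis .
qed

lemma determining_square:
  assumes \<nu>: "determining \<nu>" and f: "f \<in> H"
  shows "integrable \<nu> (\<lambda>x. (cmod (f x))\<^sup>2)"
    and "(\<integral>x. cnj (f x) * f x \<partial>\<nu>) = of_real (\<integral>x. (cmod (f x))\<^sup>2 \<partial>\<nu>)"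
proof -
  have sq: "cnj (f x) * f x = of_real ((cmod (f x))\<^sup>2)" for x
    by (simp add: complex_norm_square[unfolded of_real_power] mult.commute)
  show "integrable \<nu> (\<lambda>x. (cmod (f x))\<^sup>2)"
    using integrable_Re[OF determining_integrable_mult[OF \<nu> f f]] unfolding sq Re_complex_of_real .
  show "(\<integral>x. cnj (f x) * f x \<partial>\<nu>) = of_real (\<integral>x. (cmod (f x))\<^sup>2 \<partial>\<nu>)"
    unfolding sq by (rule integral_complex_of_real)
qed

text \<open>A kernel vector \<beta> yields a combination of the \<open>v j\<close> with vanishing
  L^2(\<nu>) norm, which is then 0 in H; orthogonality of the \<open>v j\<close> in H gives \<beta>
  = 0.\<close>

lemma det_gram:
  assumes \<nu>: "determining \<nu>"
  shows "det (gram \<nu> l) \<noteq> 0"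
proof (rule det_nonzeroI[OF gram_carrier])
  fix \<beta> :: "nat \<Rightarrow> complex" and j
  assume 0: "\<And>i. i < l \<Longrightarrow> (\<Sum>j<l. gram \<nu> l $$ (i, j) * \<beta> j) = 0" and j: "j < l"
  let ?f = "\<Sum>j<l. cscale (\<beta> j) (v j)"
  have f: "?f \<in> H" by (intro mem_intros) auto
  have i0: "(\<integral>x. cnj (v i x) * ?f x \<partial>\<nu>) = 0" if "i < l" for i
    using 0[OF that] gram_sum[OF \<nu> that] by simp
  have "(\<integral>x. cnj (?f x) * ?f x \<partial>\<nu>) = 0"
    by (subst integral_cnj_sum[OF \<nu> f refl]) (simp add: i0)
  then have "(\<integral>x. (cmod (?f x))\<^sup>2 \<partial>\<nu>) = 0"
    by (simp only: determining_square(2)[OF \<nu> f] of_real_eq_0_iff)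
  moreover note determining_square(1)[OF \<nu> f]
  ultimately have "AE x in \<nu>. (cmod (?f x))\<^sup>2 = 0"
    by (subst (asm) integral_nonneg_eq_0_iff_AE) auto
  then have "AE x in \<nu>. ?f x = 0" by simp
  then have "?f = 0" using \<nu> f unfolding determining_def by blast
  then have "ip ?f (v j) = 0" by (simp only: ip_zero_left v_mem)
  then show "\<beta> j = 0" using j vv_pos[of j] by (simp add: ip_sum_v del: vv_pos)
qed

text \<open>Equivalence of norms on a finite-dimensional span, made explicit: the coefficients solve
  the Gram system, whose right-hand sides are bounded by the almost sure bound of \<open>v m\<close>
  times the L^1 norm.\<close>

lemma coefficient_bound:
  assumes \<nu>: "determining \<nu>"
  shows "\<exists>C\<ge>0. \<forall>\<beta>. \<forall>j<l. cmod (\<beta> j) \<le> C * (\<integral>x. cmod ((\<Sum>i<l. cscale (\<beta> i) (v i)) x) \<partial>\<nu>)"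
proof -
  let ?G = "gram \<nu> l"
  obtain B where B: "\<And>i. 0 \<le> B i" "\<And>i. AE x in \<nu>. cmod (v i x) \<le> B i"
    using determining_bounded[OF \<nu> v_mem] by metis
  define C where "C = (\<Sum>j<l. \<Sum>i<l. cmod (adj_mat ?G $$ (j, i)) * B i) / cmod (det ?G)"
  have "cmod (\<beta> j) \<le> C * (\<integral>x. cmod ((\<Sum>i<l. cscale (\<beta> i) (v i)) x) \<partial>\<nu>)" if j: "j < l" for \<beta> j
  proof -
    let ?f = "\<Sum>i<l. cscale (\<beta> i) (v i)"
    let ?I = "\<integral>x. cmod (?f x) \<partial>\<nu>" and ?c = "\<lambda>m. \<integral>x. cnj (v m x) * ?f x \<partial>\<nu>"
    have f: "?f \<in> H" by (intro mem_intros) auto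
    have "det ?G * \<beta> j = (\<Sum>i<l. (\<Sum>m<l. adj_mat ?G $$ (j, m) * ?G $$ (m, i)) * \<beta> i)"
    proof -
      have "det ?G * \<beta> j = (\<Sum>i<l. if j = i then det ?G * \<beta> j else 0)" using j by simp
      also have "\<dots> = (\<Sum>i<l. (\<Sum>m<l. adj_mat ?G $$ (j, m) * ?G $$ (m, i)) * \<beta> i)"
        by (rule sum.cong) (auto simp: adj_mat_sum[OF gram_carrier j] simp del: gram_index)
      finally show ?thesis .
    qed
    also have "\<dots> = (\<Sum>m<l. adj_mat ?G $$ (j, m) * (\<Sum>i<l. ?G $$ (m, i) * \<beta> i))"
      unfolding sum_distrib_left sum_distrib_right by (subst sum.swap) (simp add: mult.assoc)
    also have "\<dots> = (\<Sum>m<l. adj_mat ?G $$ (j, m) * ?c m)"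
      by (intro sum.cong arg_cong2[where f = "(*)"] gram_sum[OF \<nu>]) auto
    finally have "cmod (det ?G) * cmod (\<beta> j) = cmod (\<Sum>m<l. adj_mat ?G $$ (j, m) * ?c m)"
      by (simp only: norm_mult[symmetric])
    also have "\<dots> \<le> (\<Sum>m<l. cmod (adj_mat ?G $$ (j, m)) * (B m * ?I))"
    proof (rule sum_norm_le)
      fix m
      have "cmod (?c m) \<le> (\<integral>x. cmod (cnj (v m x) * ?f x) \<partial>\<nu>)"
        by (rule integral_norm_bound)
      also have "\<dots> \<le> (\<integral>x. B m * cmod (?f x) \<partial>\<nu>)"
      proof (rule integral_mono_AE)
        show "AE x in \<nu>. cmod (cnj (v m x) * ?f x) \<le> B m * cmod (?f x)"
          using B(2)[of m] by eventually_elim (simp add: norm_mult mult_right_mono)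
      qed (intro integrable_norm integrable_mult_right determining_integrable_mult determining_integrable \<nu> v_mem f)+
      finally have "cmod (?c m) \<le> B m * ?I" by simp
      then show "cmod (adj_mat ?G $$ (j, m) * ?c m) \<le> cmod (adj_mat ?G $$ (j, m)) * (B m * ?I)"
        unfolding norm_mult by (rule mult_left_mono) simp
    qed
    also have "\<dots> = (\<Sum>m<l. cmod (adj_mat ?G $$ (j, m)) * B m) * ?I"
      by (simp add: sum_distrib_right mult.assoc)
    also have "\<dots> \<le> (\<Sum>j<l. \<Sum>m<l. cmod (adj_mat ?G $$ (j, m)) * B m) * ?I"
      using j B(1) by (intro mult_right_mono member_le_sum[of j "{..<l}" "\<lambda>j. \<Sum>m<l. cmod (adj_mat ?G $$ (j, m)) * B m"])
        (auto intro!: sum_nonneg)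
    finally show ?thesis
      using det_gram[OF \<nu>, of l] by (simp add: C_def field_simps)
  qed
  moreover have "C \<ge> 0" unfolding C_def using B(1) by (auto intro!: divide_nonneg_nonneg sum_nonneg)
  ultimately show ?thesis by blast
qed

end


section \<open>Extrapolation in several variables\<close>

lemma nn_integral_scale_le:
  fixes g :: "'a::euclidean_space \<Rightarrow> ennreal"
  assumes [measurable]: "g \<in> borel_measurable borel" and "0 < \<delta>" "\<delta> \<le> s"
  shows "(\<integral>\<^sup>+y. g (q + s *\<^sub>R (y - q)) \<partial>lborel) \<le> ennreal (1 / \<delta> ^ DIM('a)) * (\<integral>\<^sup>+y. g y \<partial>lborel)"
proof -
  let ?D = "DIM('a)" and ?J = "\<integral>\<^sup>+y. g (q + s *\<^sub>R (y - q)) \<partial>lborel"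
  have "(\<integral>\<^sup>+y. g y \<partial>lborel) = (\<integral>\<^sup>+y. ennreal (\<bar>s\<bar> ^ ?D) * g ((q - s *\<^sub>R q) + s *\<^sub>R y) \<partial>lborel)"
    using assms by (subst lborel_affine[of s "q - s *\<^sub>R q"]) (auto simp: nn_integral_density nn_integral_distr)
  also have "\<dots> = ennreal (s ^ ?D) * ?J"
    using assms by (subst nn_integral_cmult) (auto simp: algebra_simps)
  finally have e: "(\<integral>\<^sup>+y. g y \<partial>lborel) = ennreal (s ^ ?D) * ?J" .
  have "1 \<le> 1 / \<delta> ^ ?D * s ^ ?D"
    using power_mono[of \<delta> s ?D] assms by (simp add: field_simps)
  then have "1 * ?J \<le> ennreal (1 / \<delta> ^ ?D * s ^ ?D) * ?J"
    by (intro mult_right_mono) (auto simp: ennreal_1[symmetric] simp del: ennreal_1)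
  also have "\<dots> = ennreal (1 / \<delta> ^ ?D) * (ennreal (s ^ ?D) * ?J)"
    using assms by (subst ennreal_mult) (auto simp: mult.assoc)
  finally show ?thesis unfolding e by simp
qed

context koopman_jets
begin

text \<open>\<open>proj m\<close> truncates the Taylor expansion of f at degree m. Its value at p +
  u is thus a weighted sum of the coefficients that \<open>coeff_le_integral\<close> extracts at s =
  0 from values near s = 1; l and M compare the weights at the two ends.\<close>

lemma extrapolation_pointwise:
  assumes B: "1 \<le> B" and \<eta>: "\<eta> = 1 / (B + 1 / (8 * B))" and mn: "m \<le> n" and f: "f \<in> jet_space k p n"
    and l: "0 < l" "\<And>s. s \<in> {1 - \<eta>..1 + \<eta>} \<Longrightarrow> l \<le> wt p (p + s *\<^sub>R u)" and M: "wt p (p + u) \<le> M"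
  shows "ennreal (cmod (proj m f (p + u))) \<le>
    ennreal (M / l * (real m + 1) * ((real m + 1) * (8 * B / \<eta>) ^ (m + 1) * (2 * B)) * (2 * B) ^ n) *
    (\<integral>\<^sup>+s. ennreal (cmod (f (p + s *\<^sub>R u))) * indicator {1 - \<eta>..1 + \<eta>} s \<partial>lborel)"
proof -
  note fH = jet_mem[OF f]
  let ?c = "\<lambda>j. ip f (pw p j u)" and ?I = "{1 - \<eta>..1 + \<eta>}"
  let ?N = "\<integral>\<^sup>+s. ennreal (cmod (f (p + s *\<^sub>R u))) * indicator ?I s \<partial>lborel"
  define J where "J = integral ?I (\<lambda>s. norm (\<Sum>j\<le>n. of_real s ^ j * ?c j))"
  define A where "A = (real m + 1) * (8 * B / \<eta>) ^ (m + 1) * (2 * B)"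
  have M0: "0 < M" using M wt_pos(1)[of p "p + u"] by linarith
  have "1 \<le> B + 1 / (8 * B)" using B by (simp add: add_increasing2)
  then have \<eta>1: "0 < \<eta>" "\<eta> \<le> 1" by (auto simp: \<eta>)
  have B\<eta>: "1 \<le> 8 * B / \<eta>" using \<eta>1 B by (simp add: pos_le_divide_eq)
  have A0: "0 \<le> A" using B \<eta>1 by (simp add: A_def)
  have J0: "0 \<le> J" unfolding J_def
    by (intro integral_nonneg integrable_continuous_real continuous_intros) auto
  have cj: "cmod (?c j) \<le> A * (2 * B) ^ n * J" if "j \<le> m" for j
  proof -
    have "cmod (?c j) \<le> (real j + 1) * (8 * B / \<eta>) ^ (j + 1) * (2 * B) ^ (n + 1) * J"
      unfolding J_def using that mn by (intro coeff_le_integral[OF B \<eta>]) simp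
    also have "\<dots> \<le> (real m + 1) * (8 * B / \<eta>) ^ (m + 1) * (2 * B) ^ (n + 1) * J"
    proof -
      have "0 \<le> (8 * B / \<eta>) ^ (j + 1)" using B\<eta> by (intro zero_le_power) linarith
      then show ?thesis
        using that J0 B by (intro mult_right_mono mult_mono power_increasing B\<eta>) auto
    qed
    finally show ?thesis by (simp add: A_def mult_ac)
  qed
  have "ip (proj m f) (pw p j u) = ?c j" if "j \<le> m" for j
    using ip_diff_proj[OF fH pw_mem_jet_space[OF that], of u] fH by (simp add: ip_diff)
  then have "proj m f (p + u) = of_real (wt p (p + u)) * (\<Sum>j\<le>m. ?c j)"
    using jet_space_taylor(2)[OF proj_mem_jet proj_mem, of m f u] by simp
  then have "cmod (proj m f (p + u)) = wt p (p + u) * cmod (\<Sum>j\<le>m. ?c j)"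
    by (simp only: norm_mult norm_of_real abs_of_pos[OF wt_pos(1)])
  also have "\<dots> \<le> M * (\<Sum>j\<le>m. A * (2 * B) ^ n * J)"
    using M M0 cj by (intro mult_mono sum_norm_le) auto
  also have "\<dots> = M * (real m + 1) * A * (2 * B) ^ n * J" by (simp add: mult_ac)
  finally have 1: "cmod (proj m f (p + u)) \<le> M * (real m + 1) * A * (2 * B) ^ n * J" .
  have "ennreal J = (\<integral>\<^sup>+s. ennreal (norm (\<Sum>j\<le>n. of_real s ^ j * ?c j)) * indicator ?I s \<partial>lborel)"
    unfolding J_def
    by (rule nn_integral_has_integral_lebesgue'[symmetric])
      (auto intro!: integrable_integral integrable_continuous_real continuous_intros)
  also have "\<dots> \<le> (\<integral>\<^sup>+s. ennreal (1 / l) * (ennreal (cmod (f (p + s *\<^sub>R u))) * indicator ?I s) \<partial>lborel)"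
  proof (rule nn_integral_mono)
    fix s
    show "ennreal (norm (\<Sum>j\<le>n. of_real s ^ j * ?c j)) * indicator ?I s \<le>
      ennreal (1 / l) * (ennreal (cmod (f (p + s *\<^sub>R u))) * indicator ?I s)"
    proof (cases "s \<in> ?I")
      case True
      have "f (p + s *\<^sub>R u) = of_real (wt p (p + s *\<^sub>R u)) * (\<Sum>j\<le>n. of_real s ^ j * ?c j)"
        using jet_space_taylor(2)[OF f fH, of "s *\<^sub>R u"] by (simp add: ip_pw_scale[OF fH])
      then have "cmod (f (p + s *\<^sub>R u)) = wt p (p + s *\<^sub>R u) * cmod (\<Sum>j\<le>n. of_real s ^ j * ?c j)"
        by (simp only: norm_mult norm_of_real abs_of_pos[OF wt_pos(1)])
      moreover have "l * cmod (\<Sum>j\<le>n. of_real s ^ j * ?c j) \<le> wt p (p + s *\<^sub>R u) * cmod (\<Sum>j\<le>n. of_real s ^ j * ?c j)"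
        using l(2)[OF True] by (rule mult_right_mono) simp
      ultimately have "cmod (\<Sum>j\<le>n. of_real s ^ j * ?c j) \<le> 1 / l * cmod (f (p + s *\<^sub>R u))"
        using l(1) by (simp add: field_simps)
      then show ?thesis using True l(1) by (simp add: ennreal_mult'[symmetric])
    qed simp
  qed
  also have "\<dots> = ennreal (1 / l) * ?N"
  proof (rule nn_integral_cmult)
    have "(\<lambda>s. f (p + s *\<^sub>R u)) \<in> borel_measurable borel"
      by (intro borel_measurable_continuous_onI continuous_on_compose2[OF continuous_on_mem[OF fH, of UNIV]] continuous_intros) auto
    then show "(\<lambda>s. ennreal (cmod (f (p + s *\<^sub>R u))) * indicator ?I s) \<in> borel_measurable lborel" by simp
  qed
  finally have 2: "ennreal J \<le> ennreal (1 / l) * ?N" .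
  have "ennreal (cmod (proj m f (p + u))) \<le> ennreal (M * (real m + 1) * A * (2 * B) ^ n) * ennreal J"
    using 1 M0 A0 B J0 by (simp add: ennreal_mult[symmetric] ennreal_leI)
  also have "\<dots> \<le> ennreal (M * (real m + 1) * A * (2 * B) ^ n) *
     (ennreal (1 / l) * ?N)"
    by (intro mult_left_mono 2) simp
  also have "\<dots> = ennreal (M / l * (real m + 1) * A * (2 * B) ^ n) *
      ?N"
  proof -
    have "ennreal (M * (real m + 1) * A * (2 * B) ^ n) * ennreal (1 / l) = ennreal (M / l * (real m + 1) * A * (2 * B) ^ n)"
      using M0 A0 B l(1) by (subst ennreal_mult[symmetric]) auto
    then show ?thesis by (simp only: mult.assoc[symmetric])
  qed
  finally show ?thesis unfolding A_def .
qed

text \<open>Averages the one-dimensional estimate over the lines through \<open>p\<close> that pass close to the centre \<open>a\<close>.\<close>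

lemma extrapolation:
  fixes a w :: "real ^ 'd"
  assumes B: "1 \<le> B" and w: "\<And>i. 0 < w $ i" and aB: "\<And>i. \<bar>a $ i - p $ i\<bar> \<le> (B - 1) * w $ i"
  shows "\<exists>C\<ge>0. \<exists>\<epsilon>>0. \<forall>n\<ge>m. \<forall>f\<in>jet_space k p n.
    (\<integral>\<^sup>+y. ennreal (cmod (proj m f y)) * indicator (rectangle a (\<epsilon> *\<^sub>R w)) y \<partial>lborel) \<le>
    ennreal (C * (2 * B) ^ n) * (\<integral>\<^sup>+y. ennreal (cmod (f y)) * indicator (rectangle a w) y \<partial>lborel)"
proof -
  define \<eta> where "\<eta> = 1 / (B + 1 / (8 * B))"
  have B8: "0 < 1 / (8 * B)" using B by simp
  then have "1 < B + 1 / (8 * B)" using B by linarith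
  then have \<eta>: "0 < \<eta>" "\<eta> < 1" by (auto simp: \<eta>_def)
  have "\<eta> * (B - 1) < 1"
  proof -
    have "B - 1 < B + 1 / (8 * B)" using B8 by linarith
    then show ?thesis using \<open>1 < B + 1 / (8 * B)\<close> by (simp add: \<eta>_def divide_less_eq)
  qed
  \<comment> \<open>Half of the slack in \<eta> (B - 1) < 1, because s may come close to 2 and
    doubles the deviation of y from the centre a.\<close>
  define \<epsilon> where "\<epsilon> = (1 - \<eta> * (B - 1)) / 2"
  have \<epsilon>: "0 < \<epsilon>" "\<eta> * (B - 1) + 2 * \<epsilon> = 1" using \<open>\<eta> * (B - 1) < 1\<close> by (auto simp: \<epsilon>_def field_simps)
  let ?A = "rectangle a (\<epsilon> *\<^sub>R w)" and ?R = "rectangle a w" and ?I = "{1 - \<eta>..1 + \<eta>}"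
  have sub: "p + s *\<^sub>R (y - p) \<in> ?R" if y: "y \<in> ?A" and s: "s \<in> ?I" for s y
  proof -
    have "\<bar>(p + s *\<^sub>R (y - p) - a) $ i\<bar> \<le> w $ i" for i
    proof -
      have e: "(p + s *\<^sub>R (y - p) - a) $ i = (s - 1) * (a $ i - p $ i) + s * (y $ i - a $ i)"
        by (simp add: algebra_simps)
      have "\<bar>s - 1\<bar> * \<bar>a $ i - p $ i\<bar> \<le> \<eta> * ((B - 1) * w $ i)"
        using s aB[of i] by (intro mult_mono) (auto simp: \<eta> less_imp_le abs_le_iff)
      moreover have "\<bar>s\<bar> * \<bar>y $ i - a $ i\<bar> \<le> 2 * (\<epsilon> * w $ i)"
      proof (rule mult_mono)
        show "\<bar>s\<bar> \<le> 2" using s \<eta> by auto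
        have "a $ i - \<epsilon> * w $ i \<le> y $ i" "y $ i \<le> a $ i + \<epsilon> * w $ i" using y by (auto simp: rectangle_def)
        then show "\<bar>y $ i - a $ i\<bar> \<le> \<epsilon> * w $ i" by linarith
      qed auto
      moreover have "\<bar>(p + s *\<^sub>R (y - p) - a) $ i\<bar> \<le> \<bar>s - 1\<bar> * \<bar>a $ i - p $ i\<bar> + \<bar>s\<bar> * \<bar>y $ i - a $ i\<bar>"
        unfolding e abs_mult[symmetric] by (rule abs_triangle_ineq)
      moreover have "\<eta> * ((B - 1) * w $ i) + 2 * (\<epsilon> * w $ i) = (\<eta> * (B - 1) + 2 * \<epsilon>) * w $ i"
        by (simp add: algebra_simps)
      ultimately have "\<bar>(p + s *\<^sub>R (y - p) - a) $ i\<bar> \<le> (\<eta> * (B - 1) + 2 * \<epsilon>) * w $ i"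
        by linarith
      then show ?thesis by (simp add: \<epsilon>(2))
    qed
    then show ?thesis unfolding rectangle_def by (auto simp: abs_le_iff) (smt (verit))+
  qed
  have AR: "?A \<subseteq> ?R"
  proof
    fix y assume "y \<in> ?A"
    from sub[OF this, of 1] show "y \<in> ?R" using \<eta> by simp
  qed
  obtain D where D: "\<And>y. y \<in> ?R \<Longrightarrow> dist p y \<le> D"
    using bounded_cbox[of "a - w" "a + w"] unfolding rectangle_eq_cbox[symmetric] bounded_any_center[where a = p] by auto
  have "a \<in> ?R" using w by (simp add: rectangle_def less_imp_le)
  then have "0 \<le> D" using D[of a] zero_le_dist[of p a] by linarith
  obtain l M where l: "0 < l" and lM: "\<And>q y. dist p q \<le> D \<Longrightarrow> dist p y \<le> D \<Longrightarrow> l \<le> wt q y \<and> wt q y \<le> M"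
    using wt_bounds by metis
  have lM: "l \<le> wt p y" "wt p y \<le> M" if "y \<in> ?R" for y using lM[of p y] D[OF that] \<open>0 \<le> D\<close> by auto
  define K where "K = M / l * (real m + 1) * ((real m + 1) * (8 * B / \<eta>) ^ (m + 1) * (2 * B))"
  have K: "0 \<le> K" unfolding K_def using l lM[OF \<open>a \<in> ?R\<close>] B \<eta> by simp
  \<comment> \<open>\<open>2 * \<eta>\<close> is the length of the s-interval, and (1 - \<eta>) to
    the power of the dimension bounds the Jacobian of y -> p + s (y - p) from below.\<close>
  define C where "C = K * (2 * \<eta> * (1 / (1 - \<eta>) ^ CARD('d)))"
  have "C \<ge> 0" using K \<eta> by (simp add: C_def)
  moreover have "(\<integral>\<^sup>+y. ennreal (cmod (proj m f y)) * indicator ?A y \<partial>lborel) \<le>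
      ennreal (C * (2 * B) ^ n) * (\<integral>\<^sup>+y. ennreal (cmod (f y)) * indicator ?R y \<partial>lborel)"
    if "m \<le> n" and f: "f \<in> jet_space k p n" for n f
  proof -
    let ?g = "\<lambda>y. ennreal (cmod (f y)) * indicator ?R y"
    let ?h = "\<lambda>s y. ?g (p + s *\<^sub>R (y - p)) * indicator ?I s"
    note [measurable] = mem_borel_measurable[OF jet_mem[OF f]]
    have [measurable]: "?R \<in> sets borel" "?A \<in> sets borel" unfolding rectangle_eq_cbox by auto
    have "ennreal (cmod (proj m f y)) * indicator ?A y \<le>
        ennreal (K * (2 * B) ^ n) * (\<integral>\<^sup>+s. ?h s y \<partial>lborel)" for y
    proof (cases "y \<in> ?A")
      case True
      have "ennreal (cmod (proj m f (p + (y - p)))) \<le> ennreal (K * (2 * B) ^ n) *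
        (\<integral>\<^sup>+s. ennreal (cmod (f (p + s *\<^sub>R (y - p)))) * indicator ?I s \<partial>lborel)"
        unfolding K_def
        by (rule extrapolation_pointwise[OF B \<eta>_def that l]) (use lM sub[OF True] AR True in auto)
      also have "(\<integral>\<^sup>+s. ennreal (cmod (f (p + s *\<^sub>R (y - p)))) * indicator ?I s \<partial>lborel) =
          (\<integral>\<^sup>+s. ?h s y \<partial>lborel)"
        using sub[OF True] by (intro nn_integral_cong) (auto simp: indicator_def)
      finally show ?thesis using True by simp
    qed simp
    then have "(\<integral>\<^sup>+y. ennreal (cmod (proj m f y)) * indicator ?A y \<partial>lborel) \<le>
      (\<integral>\<^sup>+y. ennreal (K * (2 * B) ^ n) * (\<integral>\<^sup>+s. ?h s y \<partial>lborel) \<partial>lborel)"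
      by (intro nn_integral_mono)
    also have "\<dots> = ennreal (K * (2 * B) ^ n) *
      (\<integral>\<^sup>+y. (\<integral>\<^sup>+s. ?h s y \<partial>lborel) \<partial>lborel)"
      by (rule nn_integral_cmult) measurable
    \<comment> \<open>With s outside, the inner integral is over a homothetic image with centre p,
      so a change of variables bounds it uniformly in s.\<close>
    also have "(\<integral>\<^sup>+y. (\<integral>\<^sup>+s. ?h s y \<partial>lborel) \<partial>lborel) =
      (\<integral>\<^sup>+s. (\<integral>\<^sup>+y. ?h s y \<partial>lborel) \<partial>lborel)"
      by (rule lborel_pair.Fubini') measurable
    also have "\<dots> \<le> (\<integral>\<^sup>+s. (ennreal (1 / (1 - \<eta>) ^ CARD('d)) * (\<integral>\<^sup>+y. ?g y \<partial>lborel)) * indicator ?I s \<partial>lborel)"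
    proof (rule nn_integral_mono)
      fix s :: real
      show "(\<integral>\<^sup>+y. ?h s y \<partial>lborel) \<le>
        (ennreal (1 / (1 - \<eta>) ^ CARD('d)) * (\<integral>\<^sup>+y. ?g y \<partial>lborel)) * indicator ?I s"
        using nn_integral_scale_le[of ?g "1 - \<eta>" s p] \<eta> by (cases "s \<in> ?I") auto
    qed
    also have "\<dots> = (ennreal (1 / (1 - \<eta>) ^ CARD('d)) * (\<integral>\<^sup>+y. ?g y \<partial>lborel)) * ennreal (2 * \<eta>)"
      using \<eta> by (subst nn_integral_cmult) auto
    finally have "(\<integral>\<^sup>+y. ennreal (cmod (proj m f y)) * indicator ?A y \<partial>lborel) \<le> ennreal (K * (2 * B) ^ n) *
      ((ennreal (1 / (1 - \<eta>) ^ CARD('d)) * (\<integral>\<^sup>+y. ?g y \<partial>lborel)) * ennreal (2 * \<eta>))"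
      by (simp add: mult_left_mono)
    also have "\<dots> = ennreal (C * (2 * B) ^ n) * (\<integral>\<^sup>+y. ?g y \<partial>lborel)"
    proof -
      have "ennreal (K * (2 * B) ^ n) * ennreal (1 / (1 - \<eta>) ^ CARD('d)) * ennreal (2 * \<eta>) = ennreal (C * (2 * B) ^ n)"
      proof -
        have nn: "0 \<le> K * (2 * B) ^ n" "0 \<le> 1 / (1 - \<eta>) ^ CARD('d)" "0 \<le> 2 * \<eta>" using K \<eta> B by auto
        show ?thesis
          by (simp only: ennreal_mult[symmetric] nn mult_nonneg_nonneg) (simp add: C_def mult_ac)
      qed
      moreover have "ennreal (K * (2 * B) ^ n) * ((ennreal (1 / (1 - \<eta>) ^ CARD('d)) * Y) * ennreal (2 * \<eta>)) =
        (ennreal (K * (2 * B) ^ n) * ennreal (1 / (1 - \<eta>) ^ CARD('d)) * ennreal (2 * \<eta>)) * Y" for Y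
        by (simp only: mult_ac)
      ultimately show ?thesis by simp
    qed
    finally show ?thesis .
  qed
  ultimately show ?thesis using \<epsilon>(1) by blast
qed

end


section \<open>The strong law of large numbers for bounded functions\<close>

text \<open>Hoeffding's inequality makes the deviation probabilities decay geometrically in N, hence
  summable; Borel-Cantelli is then applied to countably many tolerances 1 / (i + 1).\<close>

lemma (in prob_space) strong_law_real:
  fixes X :: "nat \<Rightarrow> 'a \<Rightarrow> 'b::topological_space" and \<xi> :: "'b \<Rightarrow> real"
  assumes indep: "indep_vars (\<lambda>_. borel) X UNIV" and distr: "\<And>j. distr M borel (X j) = \<mu>"
    and [measurable]: "\<xi> \<in> borel_measurable borel" and bd: "AE x in \<mu>. \<bar>\<xi> x\<bar> \<le> B"
  shows "AE \<omega> in M. (\<lambda>N. (\<Sum>l<N. \<xi> (X l \<omega>)) / real N) \<longlonglongrightarrow> (\<integral>x. \<xi> x \<partial>\<mu>)"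
proof -
  have X[measurable]: "X j \<in> borel_measurable M" for j
    using indep unfolding indep_vars_def by auto
  define Y where "Y l \<omega> = \<xi> (X l \<omega>)" for l \<omega>
  have Y[measurable]: "Y l \<in> borel_measurable M" for l unfolding Y_def[abs_def] by measurable
  have indepY: "indep_vars (\<lambda>_. borel) Y UNIV"
    unfolding Y_def[abs_def] by (rule indep_vars_compose2[OF indep]) simp
  have distrY: "distr M borel (Y l) = distr \<mu> borel \<xi>" for l
  proof -
    have "distr (distr M borel (X l)) borel \<xi> = distr M borel (\<xi> \<circ> X l)"
      by (rule distr_distr) auto
    then show ?thesis by (simp add: distr Y_def[abs_def] o_def)
  qed
  have EY: "expectation (Y 0) = (\<integral>x. \<xi> x \<partial>\<mu>)"
  proof -
    have "(\<integral>x. \<xi> x \<partial>distr M borel (X 0)) = expectation (\<lambda>\<omega>. \<xi> (X 0 \<omega>))"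
      by (rule integral_distr) auto
    then show ?thesis by (simp add: distr Y_def[abs_def])
  qed
  \<comment> \<open>The value \<open>\<bar>B\<bar> + 1\<close> makes the interval nondegenerate
    whatever B is, so that \<open>q < 1\<close> below.\<close>
  define B' where "B' = \<bar>B\<bar> + 1"
  have bdY: "AE \<omega> in M. Y 0 \<omega> \<in> {- B'..B'}"
  proof -
    have "AE x in distr M borel (X 0). \<bar>\<xi> x\<bar> \<le> B" unfolding distr using bd .
    then have "AE \<omega> in M. \<bar>\<xi> (X 0 \<omega>)\<bar> \<le> B" by (rule AE_distrD[OF X])
    then show ?thesis by eventually_elim (auto simp: Y_def B'_def)
  qed
  let ?m = "\<integral>x. \<xi> x \<partial>\<mu>"
  let ?A = "\<lambda>\<epsilon> N. {\<omega> \<in> space M. \<bar>(\<Sum>l<N. Y l \<omega>) / real N - ?m\<bar> \<ge> \<epsilon>}"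
  have ev: "AE \<omega> in M. eventually (\<lambda>N. \<omega> \<in> space M - ?A \<epsilon> N) sequentially" if \<epsilon>: "\<epsilon> > 0" for \<epsilon> :: real
  proof (rule borel_cantelli_AE1)
    show "?A \<epsilon> N \<in> sets M" for N by measurable
    show "emeasure M (?A \<epsilon> N) < \<infinity>" for N by (simp add: emeasure_eq_measure)
    define q where "q = exp (- 2 * \<epsilon>\<^sup>2 / (2 * B')\<^sup>2)"
    have "0 \<le> q" "q < 1" using \<epsilon> by (auto simp: q_def B'_def)
    have "prob (?A \<epsilon> N) \<le> 2 * q ^ N" for N
    proof (cases "N = 0")
      \<comment> \<open>Here the bound is 2, which dominates every probability.\<close>
      case True
      then show ?thesis by (auto intro: order_trans[OF prob_le_1])
    next
      case False
      interpret Hoeffding_ineq_iid M "{..<N}" Y "Y 0" "- B'" B' "expectation (Y 0)"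
        by unfold_locales (use distrY bdY indep_vars_subset[OF indepY] in auto)
      have "prob {x \<in> space M. \<epsilon> \<le> \<bar>(\<Sum>i\<in>{..<N}. Y i x) / real (card {..<N}) - expectation (Y 0)\<bar>}
        \<le> 2 * exp (- 2 * real (card {..<N}) * \<epsilon>\<^sup>2 / (B' - - B')\<^sup>2)"
        using \<epsilon> False by (intro Hoeffding_ineq_abs_ge') (auto simp: B'_def)
      also have "exp (- 2 * real (card {..<N}) * \<epsilon>\<^sup>2 / (B' - - B')\<^sup>2) = q ^ N"
        unfolding q_def exp_of_nat_mult[symmetric] by (rule arg_cong[where f = exp]) simp
      finally show ?thesis by (simp add: EY)
    qed
    moreover have "summable (\<lambda>N. 2 * q ^ N)"
      using \<open>0 \<le> q\<close> \<open>q < 1\<close> by (intro summable_mult summable_geometric) simp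
    ultimately show "summable (\<lambda>N. measure M (?A \<epsilon> N))"
      using summable_comparison_test'[of "\<lambda>N. 2 * q ^ N" 0 "\<lambda>N. measure M (?A \<epsilon> N)"] by simp
  qed
  have "AE \<omega> in M. \<forall>i::nat. eventually (\<lambda>N. \<omega> \<in> space M - ?A (1 / real (Suc i)) N) sequentially"
    unfolding AE_all_countable by (intro allI ev) simp
  then show ?thesis
  proof eventually_elim
    case (elim \<omega>)
    show ?case
    proof (rule tendstoI)
      fix e :: real assume "e > 0"
      then obtain i where i: "1 / real (Suc i) < e" using reals_Archimedean[of e] by (auto simp: inverse_eq_divide)
      show "\<forall>\<^sub>F N in sequentially. dist ((\<Sum>l<N. \<xi> (X l \<omega>)) / real N) ?m < e"
        using elim[rule_format, of i]
      proof eventually_elim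
        case (elim N)
        then have "\<bar>(\<Sum>l<N. Y l \<omega>) / real N - ?m\<bar> < 1 / real (Suc i)" by auto
        then show ?case using i by (simp add: Y_def dist_real_def)
      qed
    qed
  qed
qed

lemma (in prob_space) strong_law_complex:
  fixes X :: "nat \<Rightarrow> 'a \<Rightarrow> 'b::topological_space" and \<xi> :: "'b \<Rightarrow> complex"
  assumes indep: "indep_vars (\<lambda>_. borel) X UNIV" and distr: "\<And>j. distr M borel (X j) = \<mu>"
    and \<xi>: "\<xi> \<in> borel_measurable borel" and bd: "AE x in \<mu>. cmod (\<xi> x) \<le> B" and int: "integrable \<mu> \<xi>"
  shows "AE \<omega> in M. (\<lambda>N. (\<Sum>l<N. \<xi> (X l \<omega>)) / of_nat N) \<longlonglongrightarrow> (\<integral>x. \<xi> x \<partial>\<mu>)"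
proof -
  have "AE x in \<mu>. \<bar>Re (\<xi> x)\<bar> \<le> B" "AE x in \<mu>. \<bar>Im (\<xi> x)\<bar> \<le> B"
    using bd by (eventually_elim, meson abs_Re_le_cmod abs_Im_le_cmod order_trans)+
  then have "AE \<omega> in M. (\<lambda>N. (\<Sum>l<N. Re (\<xi> (X l \<omega>))) / real N) \<longlonglongrightarrow> (\<integral>x. Re (\<xi> x) \<partial>\<mu>)"
    "AE \<omega> in M. (\<lambda>N. (\<Sum>l<N. Im (\<xi> (X l \<omega>))) / real N) \<longlonglongrightarrow> (\<integral>x. Im (\<xi> x) \<partial>\<mu>)"
    using \<xi> by (auto intro!: strong_law_real[OF indep distr])
  then show ?thesis
  proof eventually_elim
    case (elim \<omega>)
    show ?case
      using elim int by (intro tendsto_complex_iff[THEN iffD2] conjI)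
        (simp_all add: Re_divide_of_nat Im_divide_of_nat)
  qed
qed


section \<open>Matrices\<close>

lemma tendsto_det:
  fixes A :: "nat \<Rightarrow> complex mat"
  assumes A: "\<And>N. A N \<in> carrier_mat n n" "A' \<in> carrier_mat n n"
    and lim: "\<And>i j. i < n \<Longrightarrow> j < n \<Longrightarrow> (\<lambda>N. A N $$ (i, j)) \<longlonglongrightarrow> A' $$ (i, j)"
  shows "(\<lambda>N. det (A N)) \<longlonglongrightarrow> det A'"
  unfolding det_def'[OF A(1)] det_def'[OF A(2)]
  by (intro tendsto_sum tendsto_mult tendsto_const tendsto_prod lim) (auto dest: permutes_in_image)

lemma tendsto_adj_mat:
  fixes A :: "nat \<Rightarrow> complex mat"
  assumes A: "\<And>N. A N \<in> carrier_mat n n" "A' \<in> carrier_mat n n"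
    and lim: "\<And>i j. i < n \<Longrightarrow> j < n \<Longrightarrow> (\<lambda>N. A N $$ (i, j)) \<longlonglongrightarrow> A' $$ (i, j)"
    and ij: "i < n" "j < n"
  shows "(\<lambda>N. adj_mat (A N) $$ (i, j)) \<longlonglongrightarrow> adj_mat A' $$ (i, j)"
proof -
  have dim: "dim_row (A N) = n" "dim_col (A N) = n" "dim_row A' = n" "dim_col A' = n" for N
    using A(1)[of N] A(2) by auto
  have "(\<lambda>N. det (mat_delete (A N) j i)) \<longlonglongrightarrow> det (mat_delete A' j i)"
    by (rule tendsto_det[where n = "n - 1"]) (use ij in \<open>auto simp: mat_delete_def dim intro!: lim\<close>)
  then have "(\<lambda>N. (- 1) ^ (j + i) * det (mat_delete (A N) j i)) \<longlonglongrightarrow> (- 1) ^ (j + i) * det (mat_delete A' j i)"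
    by (rule tendsto_mult_left)
  then show ?thesis using ij by (simp add: adj_mat_def dim cofactor_def)
qed

lemma mat_adjoint_simps [simp]:
  fixes A :: "complex mat"
  shows "dim_row (mat_adjoint A) = dim_col A" "dim_col (mat_adjoint A) = dim_row A"
    and "i < dim_col A \<Longrightarrow> j < dim_row A \<Longrightarrow> mat_adjoint A $$ (i, j) = cnj (A $$ (j, i))"
  by (auto simp: mat_adjoint_def mat_of_rows_def)

lemma mat_adjoint_carrier: "A \<in> carrier_mat n m \<Longrightarrow> mat_adjoint A \<in> carrier_mat m n"
  for A :: "complex mat"
  by (rule carrier_matI) simp_all

lemma mat_mult_index:
  "A \<in> carrier_mat n m \<Longrightarrow> B \<in> carrier_mat m l \<Longrightarrow> i < n \<Longrightarrow> j < l \<Longrightarrow>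
    (A * B) $$ (i, j) = (\<Sum>t<m. A $$ (i, t) * B $$ (t, j))"
  by (auto simp: scalar_prod_def lessThan_atLeast0)

lemma mat_adjoint_mult:
  fixes A B :: "complex mat"
  assumes "A \<in> carrier_mat n m" "B \<in> carrier_mat m l"
  shows "mat_adjoint (A * B) = mat_adjoint B * mat_adjoint A"
proof (rule eq_matI)
  fix i j assume "i < dim_row (mat_adjoint B * mat_adjoint A)" "j < dim_col (mat_adjoint B * mat_adjoint A)"
  then have ij: "i < l" "j < n" using assms by auto
  have "mat_adjoint (A * B) $$ (i, j) = cnj ((A * B) $$ (j, i))"
    using ij assms by (intro mat_adjoint_simps) auto
  also have "\<dots> = (\<Sum>t<m. cnj (A $$ (j, t)) * cnj (B $$ (t, i)))"
    by (subst mat_mult_index[OF assms ij(2,1)]) simp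
  also have "\<dots> = (\<Sum>t<m. mat_adjoint B $$ (i, t) * mat_adjoint A $$ (t, j))"
    using ij assms by (intro sum.cong) auto
  also have "\<dots> = (mat_adjoint B * mat_adjoint A) $$ (i, j)"
    by (rule mat_mult_index[OF mat_adjoint_carrier[OF assms(2)] mat_adjoint_carrier[OF assms(1)] ij, symmetric])
  finally show "mat_adjoint (A * B) $$ (i, j) = (mat_adjoint B * mat_adjoint A) $$ (i, j)" .
qed (use assms in auto)

lemma mat_adjoint_adjoint: "mat_adjoint (mat_adjoint A) = A" for A :: "complex mat"
  by (intro eq_matI) auto

lemma mat_adjoint_one: "mat_adjoint (1\<^sub>m n :: complex mat) = 1\<^sub>m n"
  by (intro eq_matI) auto

text \<open>T is the inverse of V times its adjoint, and the right-hand side satisfies the four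
  Penrose equations. Since \<open>pinv\<close> is a definite description, uniqueness is part of the
  proof.\<close>

lemma pinv_full_row_rank:
  fixes V T :: "complex mat"
  assumes V: "V \<in> carrier_mat n N" and T: "T \<in> carrier_mat n n"
    and inv: "V * mat_adjoint V * T = 1\<^sub>m n" "T * (V * mat_adjoint V) = 1\<^sub>m n"
  shows "pinv V = mat_adjoint V * T"
proof -
  let ?V' = "mat_adjoint V" and ?T' = "mat_adjoint T"
  let ?B = "?V' * T"
  note V' = mat_adjoint_carrier[OF V] and T' = mat_adjoint_carrier[OF T]
  note B = mult_carrier_mat[OF V' T] and S = mult_carrier_mat[OF V V']
  have "mat_adjoint (V * ?V') = V * ?V'"
    using mat_adjoint_mult[OF V V'] mat_adjoint_adjoint[of V] by simp
  then have "?T' * (V * ?V') = 1\<^sub>m n"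
    using mat_adjoint_mult[OF S T] inv(1) by (simp add: mat_adjoint_one)
  then have "?T' * (V * ?V') * T = T" using T by simp
  then have hermT: "?T' = T" using assoc_mult_mat[OF T' S T] inv(1) right_mult_one_mat[OF T'] by simp
  have VB: "V * ?B = 1\<^sub>m n" using assoc_mult_mat[OF V V' T] inv(1) by simp
  have VBV: "V * ?B * V = V" using V by (simp add: VB)
  have BVB: "?B * V * ?B = ?B"
    using assoc_mult_mat[OF B V B] VB right_mult_one_mat[OF B] by simp
  have h1: "mat_adjoint (V * ?B) = V * ?B" by (simp add: VB mat_adjoint_one)
  have h2: "mat_adjoint (?B * V) = ?B * V"
    using mat_adjoint_mult[OF B V] mat_adjoint_mult[OF V' T] hermT mat_adjoint_adjoint[of V]
      assoc_mult_mat[OF V' T V] by simp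
  show ?thesis unfolding pinv_def
  proof (rule the_equality)
    show "?B \<in> carrier_mat (dim_col V) (dim_row V) \<and> V * ?B * V = V \<and> ?B * V * ?B = ?B \<and>
      mat_adjoint (V * ?B) = V * ?B \<and> mat_adjoint (?B * V) = ?B * V"
      using B V VBV BVB h1 h2 by auto
    \<comment> \<open>With \<open>?B\<close> as right inverse, the Penrose equations force V A = 1.
      Then A = A V \<open>?B\<close>, where A V is self-adjoint and equals the adjoint of V times
      that of A; the adjoint of V A = 1 collapses the product to \<open>?B\<close>.\<close>
    fix A assume A: "A \<in> carrier_mat (dim_col V) (dim_row V) \<and> V * A * V = V \<and> A * V * A = A \<and>
      mat_adjoint (V * A) = V * A \<and> mat_adjoint (A * V) = A * V"
    then have Ac: "A \<in> carrier_mat N n" using V by auto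
    note A' = mat_adjoint_carrier[OF Ac]
    have VA: "V * A \<in> carrier_mat n n" using V Ac by simp
    have "V * A * V * ?B = V * ?B" using A by simp
    then have "V * A * (V * ?B) = V * ?B" using assoc_mult_mat[OF VA V B] by simp
    then have VA1: "V * A = 1\<^sub>m n" using right_mult_one_mat[OF VA] by (simp only: VB)
    have "A = A * (V * ?B)" using Ac by (simp add: VB)
    also have "\<dots> = A * V * ?B" using assoc_mult_mat[OF Ac V B] by simp
    also have "A * V = ?V' * mat_adjoint A" using A mat_adjoint_mult[OF Ac V] by simp
    also have "?V' * mat_adjoint A * ?B = ?V' * (mat_adjoint A * ?V') * T"
    proof -
      have "?V' * mat_adjoint A * (?V' * T) = ?V' * mat_adjoint A * ?V' * T"
        using assoc_mult_mat[OF mult_carrier_mat[OF V' A'] V' T] by simp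
      then show ?thesis using assoc_mult_mat[OF V' A' V'] by simp
    qed
    also have "mat_adjoint A * ?V' = 1\<^sub>m n"
      using mat_adjoint_mult[OF V Ac] VA1 by (simp add: mat_adjoint_one)
    finally show "A = ?B" using right_mult_one_mat[OF V'] by simp
  qed
qed

lemma diag_mult_index:
  fixes A :: "complex mat"
  assumes A: "A \<in> carrier_mat n m" and ij: "i < n" "j < m"
  shows "(mat n n (\<lambda>(i, j). if i = j then a i else 0) * A) $$ (i, j) = a i * A $$ (i, j)"
    and "(A * mat m m (\<lambda>(i, j). if i = j then a i else 0)) $$ (i, j) = A $$ (i, j) * a j"
proof -
  let ?D = "\<lambda>n. mat n n (\<lambda>(i, j). if i = j then a i else 0)"
  have "(?D n * A) $$ (i, j) =
      (\<Sum>t<n. ?D n $$ (i, t) * A $$ (t, j))"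
    using A ij by (intro mat_mult_index) auto
  also have "\<dots> = (\<Sum>t<n. if t = i then a i * A $$ (i, j) else 0)"
    using ij by (intro sum.cong) auto
  finally show "(?D n * A) $$ (i, j) = a i * A $$ (i, j)"
    using ij by simp
  have "(A * ?D m) $$ (i, j) =
      (\<Sum>t<m. A $$ (i, t) * ?D m $$ (t, j))"
    using A ij by (intro mat_mult_index) auto
  also have "\<dots> = (\<Sum>t<m. if t = j then A $$ (i, j) * a j else 0)"
    using ij by (intro sum.cong) auto
  finally show "(A * ?D m) $$ (i, j) = A $$ (i, j) * a j"
    using ij by simp
qed

text \<open>\<open>mat_inverse\<close> returns an option: the explicit inverse shows that the matrix
  is a unit, which excludes \<open>None\<close>, and uniqueness of inverses identifies the
  result.\<close>

lemma mat_inverse_diag: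
  fixes g :: "nat \<Rightarrow> complex"
  assumes g: "\<And>i. g i \<noteq> 0"
  shows "the (mat_inverse (mat n n (\<lambda>(i, j). if i = j then g i else 0))) =
    mat n n (\<lambda>(i, j). if i = j then 1 / g i else 0)"
proof -
  let ?d = "\<lambda>a. mat n n (\<lambda>(i, j). if i = j then a i else 0) :: complex mat"
  let ?G = "?d g" and ?D = "mat n n (\<lambda>(i, j). if i = j then 1 / g i else 0)"
  have mult: "?d a * ?d c = 1\<^sub>m n"
    if "\<And>i. a i * c i = 1" for a c :: "nat \<Rightarrow> complex"
  proof (rule eq_matI)
    fix i j assume ij: "i < dim_row (1\<^sub>m n :: complex mat)" "j < dim_col (1\<^sub>m n :: complex mat)"
    have "(?d a * ?d c) $$ (i, j) =
      a i * ?d c $$ (i, j)"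
      using ij by (intro diag_mult_index(1)) auto
    then show "(?d a * ?d c) $$ (i, j) =
      1\<^sub>m n $$ (i, j)" using ij by (auto simp: that simp del: index_mult_mat)
  qed auto
  have GD: "?G * ?D = 1\<^sub>m n" "?D * ?G = 1\<^sub>m n" using g by (auto intro!: mult)
  have G: "?G \<in> carrier_mat n n" and D: "?D \<in> carrier_mat n n" by auto
  have "?G \<in> Units (ring_mat TYPE(complex) n ())"
    unfolding Units_def using G D GD by (auto simp: ring_mat_simps)
  then obtain B where B: "mat_inverse ?G = Some B" using mat_inverse(1)[OF G, where b = "()"] by (cases "mat_inverse ?G") auto
  then have "B * ?G = 1\<^sub>m n" "B \<in> carrier_mat n n" using mat_inverse(2)[OF G B] by auto
  then have "B = ?D" using assoc_mult_mat[of B n n ?G n ?D n] GD D G by simp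
  then show ?thesis using B by simp
qed

text \<open>Written with the empirical Gram matrix S and with 1/N attached to the product of W and
  the adjoint of V, so that every sum over samples is an empirical mean. The factor g j / g i comes
  from the two diagonal Gram matrices in H.\<close>

lemma A_hat_index:
  fixes g :: "nat \<Rightarrow> real" and v :: "nat \<Rightarrow> real ^ 'd \<Rightarrow> complex" and x :: "nat \<Rightarrow> real ^ 'd"
    and F :: "real ^ 'd \<Rightarrow> real ^ 'd" and rm rn N :: nat
  defines "V \<equiv> V_matrix v rn N x" and "W \<equiv> W_matrix F v rm N x"
  assumes ip: "\<And>i j. ip (v i) (v j) = (if i = j then of_real (g i) else 0)" and g: "\<And>i. g i \<noteq> 0"
    and "rm \<le> rn" and N: "N > 0"
    and S: "S = mat rn rn (\<lambda>(i, j). (\<Sum>t<N. V $$ (i, t) * cnj (V $$ (j, t))) / of_nat N)" "det S \<noteq> 0"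
    and ij: "i < rm" "j < rm"
  shows "A_hat ip F v rm rn N x $$ (i, j) =
    (\<Sum>l<rn. (\<Sum>t<N. W $$ (i, t) * cnj (V $$ (l, t))) / of_nat N * (adj_mat S $$ (l, j) / det S)) * of_real (g j / g i)"
proof -
  let ?U = "\<lambda>s. \<Sum>t<N. W $$ (i, t) * cnj (V $$ (s, t))"
  let ?V' = "mat_adjoint V"
  have V: "V \<in> carrier_mat rn N" and W: "W \<in> carrier_mat rm N" by (auto simp: V_def V_matrix_def W_def W_matrix_def)
  note V' = mat_adjoint_carrier[OF V]
  have Sc: "S \<in> carrier_mat rn rn" by (simp add: S)
  define T where "T = (1 / (of_nat N * det S)) \<cdot>\<^sub>m adj_mat S"
  have T: "T \<in> carrier_mat rn rn" using adj_mat(1)[OF Sc] by (simp add: T_def)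
  have VV: "V * ?V' = of_nat N \<cdot>\<^sub>m S"
  proof (rule eq_matI)
    fix i j assume "i < dim_row (of_nat N \<cdot>\<^sub>m S)" "j < dim_col (of_nat N \<cdot>\<^sub>m S)"
    then have ij: "i < rn" "j < rn" by (auto simp: S)
    have "(V * ?V') $$ (i, j) = (\<Sum>t<N. V $$ (i, t) * cnj (V $$ (j, t)))"
      unfolding mat_mult_index[OF V V' ij] using V ij by (intro sum.cong) auto
    then show "(V * ?V') $$ (i, j) = (of_nat N \<cdot>\<^sub>m S) $$ (i, j)"
      using N ij by (simp add: S del: index_mult_mat(1))
  qed (use V V' Sc in auto)
  note adjc = adj_mat(1)[OF Sc]
  have "V * ?V' * T = of_nat N \<cdot>\<^sub>m (1 / (of_nat N * det S) \<cdot>\<^sub>m (S * adj_mat S))"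
    unfolding VV T_def
    by (simp only: mult_smult_assoc_mat[OF Sc smult_carrier_mat[OF adjc]] mult_smult_distrib[OF Sc adjc])
  also have "\<dots> = 1\<^sub>m rn" unfolding adj_mat(2)[OF Sc] using N S(2) by (intro eq_matI) auto
  finally have inv1: "V * ?V' * T = 1\<^sub>m rn" .
  have "T * (V * ?V') = 1 / (of_nat N * det S) \<cdot>\<^sub>m (of_nat N \<cdot>\<^sub>m (adj_mat S * S))"
    unfolding VV T_def
    by (simp only: mult_smult_assoc_mat[OF adjc smult_carrier_mat[OF Sc]] mult_smult_distrib[OF adjc Sc])
  also have "\<dots> = 1\<^sub>m rn" unfolding adj_mat(3)[OF Sc] using N S(2) by (intro eq_matI) auto
  finally have inv2: "T * (V * ?V') = 1\<^sub>m rn" .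
  have P: "pinv V = ?V' * T" by (rule pinv_full_row_rank[OF V T inv1 inv2])
  have gram: "gram_matrix ip v l = mat l l (\<lambda>(i, j). if i = j then of_real (g i) else 0)" for l
    unfolding gram_matrix_def by (rule cong_mat) (auto simp: ip)
  let ?D = "mat rm rm (\<lambda>(i, j). if i = j then 1 / complex_of_real (g i) else 0)"
  let ?G = "mat rn rn (\<lambda>(i, j). if i = j then complex_of_real (g i) else 0)"
  have D: "?D \<in> carrier_mat rm rm" and G: "?G \<in> carrier_mat rn rn" by auto
  have inv_gram: "the (mat_inverse (gram_matrix ip v rm)) = ?D"
    unfolding gram by (rule mat_inverse_diag) (simp add: g)
  have DW: "(?D * W) $$ (i, t) = W $$ (i, t) / of_real (g i)" if "t < N" for t
    using diag_mult_index(1)[OF W ij(1) that, of "\<lambda>i. 1 / complex_of_real (g i)"] by simp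
  have VT: "(?V' * T) $$ (t, l) = (\<Sum>s<rn. cnj (V $$ (s, t)) * T $$ (s, l))" if "t < N" "l < rn" for t l
    using that V by (subst mat_mult_index[OF V' T]) (auto intro!: sum.cong)
  note DWc = mult_carrier_mat[OF D W] and VTc = mult_carrier_mat[OF V' T]
  have X: "(?D * W * (?V' * T)) $$ (i, l) =
      (\<Sum>t<N. W $$ (i, t) / of_real (g i) * (\<Sum>s<rn. cnj (V $$ (s, t)) * T $$ (s, l)))" if "l < rn" for l
    using ij that by (subst mat_mult_index[OF DWc VTc]) (auto simp: DW VT intro!: sum.cong)
  note Xc = mult_carrier_mat[OF DWc VTc]
  have "(?D * W * (?V' * T) * ?G) $$ (i, j) = (?D * W * (?V' * T)) $$ (i, j) * of_real (g j)"
    using ij assms(5) by (intro diag_mult_index(2)[OF Xc]) auto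
  also have "(?D * W * (?V' * T)) $$ (i, j) =
      (\<Sum>t<N. W $$ (i, t) / of_real (g i) * (\<Sum>s<rn. cnj (V $$ (s, t)) * T $$ (s, j)))"
    using ij assms(5) by (intro X) simp
  also have "\<dots> = (\<Sum>s<rn. ?U s / of_real (g i) * T $$ (s, j))"
    unfolding sum_distrib_left sum_distrib_right sum_divide_distrib
    by (subst sum.swap) (simp add: mult.assoc)
  also have "\<dots> = (\<Sum>s<rn. ?U s / of_nat N * (adj_mat S $$ (s, j) / det S)) / of_real (g i)"
    unfolding sum_divide_distrib[of _ "{..<rn}"]
  proof (rule sum.cong)
    fix s assume "s \<in> {..<rn}"
    then have "T $$ (s, j) = adj_mat S $$ (s, j) / (of_nat N * det S)"
      using ij assms(5) adj_mat(1)[OF Sc] by (simp add: T_def)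
    then show "?U s / of_real (g i) * T $$ (s, j) =
      ?U s / of_nat N * (adj_mat S $$ (s, j) / det S) / of_real (g i)"
      by simp
  qed simp
  finally have "(?D * W * (?V' * T) * ?G) $$ (i, j) =
    (\<Sum>s<rn. ?U s / of_nat N * (adj_mat S $$ (s, j) / det S)) * of_real (g j / g i)"
    by simp
  moreover have "A_hat ip F v rm rn N x $$ (i, j) = (?D * W * (?V' * T) * ?G) $$ (i, j)"
    unfolding A_hat_def first_cols_def V_def[symmetric] W_def[symmetric] P inv_gram
    unfolding gram using ij Xc by auto
  ultimately show ?thesis by simp
qed

lemma frobenius_norm_limsup_le:
  fixes A :: "complex mat" and B :: "nat \<Rightarrow> complex mat"
  assumes A: "A \<in> carrier_mat n n" and B: "\<And>N. B N \<in> carrier_mat n n"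
    and lim: "\<And>i j. i < n \<Longrightarrow> j < n \<Longrightarrow> (\<lambda>N. B N $$ (i, j)) \<longlonglongrightarrow> L i j"
    and bd: "\<And>i j. i < n \<Longrightarrow> j < n \<Longrightarrow> cmod (A $$ (i, j) - L i j) \<le> \<beta>" and "0 \<le> \<beta>"
  shows "limsup (\<lambda>N. ereal (frobenius_norm (A - B N))) \<le> ereal (real n * \<beta>)"
proof -
  let ?Q = "\<Sum>i<n. \<Sum>j<n. (cmod (A $$ (i, j) - L i j))\<^sup>2"
  have "frobenius_norm (A - B N) = sqrt (\<Sum>i<n. \<Sum>j<n. (cmod (A $$ (i, j) - B N $$ (i, j)))\<^sup>2)" for N
    using A B[of N] by (simp add: frobenius_norm_def)
  moreover have "(\<lambda>N. sqrt (\<Sum>i<n. \<Sum>j<n. (cmod (A $$ (i, j) - B N $$ (i, j)))\<^sup>2)) \<longlonglongrightarrow>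
      sqrt ?Q"
    by (intro tendsto_intros lim) auto
  ultimately have "(\<lambda>N. ereal (frobenius_norm (A - B N))) \<longlonglongrightarrow> ereal (sqrt ?Q)"
    by simp
  then have "limsup (\<lambda>N. ereal (frobenius_norm (A - B N))) = ereal (sqrt ?Q)"
    by (intro lim_imp_Limsup) simp_all
  also have "\<dots> \<le> ereal (real n * \<beta>)"
  proof -
    have "?Q \<le> (\<Sum>i<n. \<Sum>j<n. \<beta>\<^sup>2)"
      using bd by (intro sum_mono power_mono) auto
    then have "sqrt ?Q \<le> sqrt ((real n * \<beta>)\<^sup>2)"
      by (intro real_sqrt_le_mono) (simp add: power2_eq_square mult_ac)
    then show ?thesis using \<open>0 \<le> \<beta>\<close> by simp
  qed
  finally show ?thesis .
qed


section \<open>The error of the limiting estimator\<close>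

context koopman_jets
begin

text \<open>By the normal equations f is the L^2(\<nu>)-projection of e, so the integral of |f|^2 is
  at most \<epsilon> times that of |f|. On a probability space the former dominates the square of
  the latter, and one factor cancels.\<close>

lemma L1_projection_le:
  assumes \<nu>: "determining \<nu>" "prob_space \<nu>" and e: "e \<in> H" and "0 \<le> \<epsilon>" "AE x in \<nu>. cmod (e x) \<le> \<epsilon>"
    and f: "f = (\<Sum>i<l. cscale (\<beta> i) (v i))"
    and normal: "\<And>i. i < l \<Longrightarrow> (\<integral>x. cnj (v i x) * f x \<partial>\<nu>) = (\<integral>x. cnj (v i x) * e x \<partial>\<nu>)"
  shows "(\<integral>x. cmod (f x) \<partial>\<nu>) \<le> \<epsilon>"
proof -
  interpret prob_space \<nu> by (rule \<nu>(2))
  have fH: "f \<in> H" unfolding f by (intro mem_intros) auto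
  let ?I = "\<integral>x. cmod (f x) \<partial>\<nu>"
  have int: "integrable \<nu> (\<lambda>x. cmod (f x))" by (intro integrable_norm determining_integrable \<nu>(1) fH)
  note int2 = determining_square(1)[OF \<nu>(1) fH]
  have eq: "complex_of_real (\<integral>x. (cmod (f x))\<^sup>2 \<partial>\<nu>) = (\<integral>x. cnj (f x) * e x \<partial>\<nu>)"
    unfolding determining_square(2)[OF \<nu>(1) fH, symmetric]
      integral_cnj_sum[OF \<nu>(1) fH f] integral_cnj_sum[OF \<nu>(1) e f]
    by (rule sum.cong) (auto simp: normal)
  have "(\<integral>x. (cmod (f x))\<^sup>2 \<partial>\<nu>) \<le> cmod (complex_of_real (\<integral>x. (cmod (f x))\<^sup>2 \<partial>\<nu>))"
    by (simp only: norm_of_real abs_ge_self)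
  also have "\<dots> \<le> (\<integral>x. cmod (cnj (f x) * e x) \<partial>\<nu>)"
    unfolding eq by (rule integral_norm_bound)
  also have "\<dots> \<le> (\<integral>x. \<epsilon> * cmod (f x) \<partial>\<nu>)"
  proof (rule integral_mono_AE)
    show "AE x in \<nu>. cmod (cnj (f x) * e x) \<le> \<epsilon> * cmod (f x)"
      using assms(5) by eventually_elim (simp add: norm_mult mult.commute mult_right_mono)
    show "integrable \<nu> (\<lambda>x. cmod (cnj (f x) * e x))"
      by (intro integrable_norm determining_integrable_mult \<nu>(1) fH e)
  qed (use int in simp)
  finally have 1: "(\<integral>x. (cmod (f x))\<^sup>2 \<partial>\<nu>) \<le> \<epsilon> * ?I" by simp
  \<comment> \<open>The variance of |f| is nonnegative.\<close>
  have "0 \<le> (\<integral>x. (cmod (f x) - ?I)\<^sup>2 \<partial>\<nu>)" by (rule integral_nonneg_AE) simp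
  also have "(\<lambda>x. (cmod (f x) - ?I)\<^sup>2) = (\<lambda>x. (cmod (f x))\<^sup>2 - 2 * ?I * cmod (f x) + ?I\<^sup>2)"
    by (simp add: power2_eq_square algebra_simps fun_eq_iff)
  also have "(\<integral>x. (cmod (f x))\<^sup>2 - 2 * ?I * cmod (f x) + ?I\<^sup>2 \<partial>\<nu>) = (\<integral>x. (cmod (f x))\<^sup>2 \<partial>\<nu>) - 2 * ?I * ?I + ?I\<^sup>2"
    using int int2 prob_space by simp
  finally have "?I * ?I \<le> \<epsilon> * ?I" using 1 by (simp add: power2_eq_square)
  moreover have "0 \<le> ?I" by simp
  ultimately show ?thesis using \<open>0 \<le> \<epsilon>\<close> by (cases "?I = 0") auto
qed

text \<open>The formula of \<open>A_hat_index\<close> with empirical means replaced by integrals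
  against \<mu>.\<close>

definition limit_mat :: "(real ^ 'd) measure \<Rightarrow> nat \<Rightarrow> nat \<Rightarrow> nat \<Rightarrow> complex" where
  "limit_mat \<mu> n i j = (\<Sum>l<r n. (\<integral>x. cnj (Av i x) * v l x \<partial>\<mu>) *
     (adj_mat (gram \<mu> (r n)) $$ (l, j) / det (gram \<mu> (r n)))) * of_real (vv j / vv i)"

text \<open>Only two ingredients depend on n: (2B)^n from \<open>extrapolation\<close>, and the size
  of the H-projection error on the support. The passage to the L^2(\<mu>)-projection is a
  contraction, and the coefficient bound takes place in the fixed space of order m, so
  \<open>C\<close> can be chosen before n.\<close>

lemma limit_error:
  fixes a w :: "real ^ 'd"
  assumes \<mu>: "determining \<mu>" "prob_space \<mu>" and "0 < c0"
    and low: "\<And>g. g \<in> borel_measurable borel \<Longrightarrow>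
      (\<integral>\<^sup>+x. g x * indicator (rectangle a w) x \<partial>lborel) \<le> ennreal (1 / c0) * (\<integral>\<^sup>+x. g x \<partial>\<mu>)"
    and supp: "AE x in \<mu>. dist p x \<le> B1" and "0 \<le> B1"
    and B: "1 \<le> B" and w: "\<And>i. 0 < w $ i" and aB: "\<And>i. \<bar>a $ i - p $ i\<bar> \<le> (B - 1) * w $ i"
    and i: "i < r m" and j: "j < r m"
  shows "\<exists>C\<ge>0. \<forall>n\<ge>m. cmod (ip (v j) (Av i) / of_real (vv i) - limit_mat \<mu> n i j) \<le>
    C * (2 * B * B1 / \<sigma>) ^ n / sqrt (fact (n + 1))"
proof -
  obtain C2 \<epsilon> where C2: "C2 \<ge> 0" "\<epsilon> > 0" and extr: "\<And>n f. n \<ge> m \<Longrightarrow> f \<in> jet_space k p n \<Longrightarrow>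
    (\<integral>\<^sup>+y. ennreal (cmod (proj m f y)) * indicator (rectangle a (\<epsilon> *\<^sub>R w)) y \<partial>lborel) \<le>
    ennreal (C2 * (2 * B) ^ n) * (\<integral>\<^sup>+y. ennreal (cmod (f y)) * indicator (rectangle a w) y \<partial>lborel)"
    using extrapolation[OF B w aB, of m] by blast
  let ?A = "rectangle a (\<epsilon> *\<^sub>R w)"
  have [measurable]: "?A \<in> sets borel" unfolding rectangle_eq_cbox by auto
  \<comment> \<open>Lebesgue measure on the small box: \<open>extrapolation\<close> controls the
    L^1(\<nu>) norm of \<open>proj m f\<close>, and \<open>coefficient_bound\<close> for \<nu> turns
    that norm into coefficients.\<close>
  define \<nu> where "\<nu> = density lborel (indicator ?A)"
  have \<nu>: "determining \<nu>"
  proof (rule determiningI[where a = a and e = "\<epsilon> *\<^sub>R w" and K = ?A])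
    show "finite_measure \<nu>"
    proof
      have "emeasure \<nu> (space \<nu>) = emeasure lborel ?A"
        by (simp add: \<nu>_def emeasure_density)
      then show "emeasure \<nu> (space \<nu>) \<noteq> \<infinity>"
        unfolding rectangle_eq_cbox using less_imp_neq[OF emeasure_lborel_cbox_finite] by metis
    qed
    show "sets \<nu> = sets borel" by (simp add: \<nu>_def)
    show "compact ?A" unfolding rectangle_eq_cbox by (rule compact_cbox)
    show "AE x in \<nu>. x \<in> ?A" unfolding \<nu>_def by (subst AE_density) (auto simp: indicator_def)
    show "0 < (\<epsilon> *\<^sub>R w) $ i" for i using C2(2) w by simp
    show "AE x in lborel. x \<in> ?A \<longrightarrow> P x" if "AE x in \<nu>. P x" for P
      using that unfolding \<nu>_def by (subst (asm) AE_density) (auto simp: indicator_def elim!: eventually_mono)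
  qed
  obtain C1 where C1: "C1 \<ge> 0" "\<And>\<beta> j. j < r m \<Longrightarrow> cmod (\<beta> j) \<le> C1 * (\<integral>x. cmod ((\<Sum>i<r m. cscale (\<beta> i) (v i)) x) \<partial>\<nu>)"
    using coefficient_bound[OF \<nu>, of "r m"] by blast
  obtain l M where l: "0 < l" "\<And>q y. dist p q \<le> B1 \<Longrightarrow> dist p y \<le> B1 \<Longrightarrow> l \<le> wt q y \<and> wt q y \<le> M"
    using wt_bounds by metis
  have M: "wt p y \<le> M" if "dist p y \<le> B1" for y using l(2)[of p y] that \<open>0 \<le> B1\<close> by simp
  have M0: "0 < M" using l(2)[of p p] l(1) \<open>0 \<le> B1\<close> by simp
  define E where "E = M * (nrm (Av i) * (B1 / \<sigma> * exp (B1\<^sup>2 / (2 * \<sigma>\<^sup>2))))"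
  have E: "0 \<le> E" using M0 \<sigma>_pos \<open>0 \<le> B1\<close> by (simp add: E_def nrm_nonneg)
  define C where "C = vv j / vv i * (C1 * (C2 / c0)) * E"
  have "0 \<le> vv j / vv i" by (simp add: less_imp_le)
  moreover have "0 \<le> C1 * (C2 / c0)" using C1(1) C2(1) \<open>0 < c0\<close> by simp
  ultimately have "0 \<le> C" unfolding C_def using E by (simp only: mult_nonneg_nonneg)
  moreover have "cmod (ip (v j) (Av i) / of_real (vv i) - limit_mat \<mu> n i j) \<le> C * (2 * B * B1 / \<sigma>) ^ n / sqrt (fact (n + 1))"
    if mn: "m \<le> n" for n
  proof -
    let ?G = "gram \<mu> (r n)"
    \<comment> \<open>The conjugates of \<gamma> are the coordinates of the L^2(\<mu>)-projection of
      \<open>Av i\<close> onto \<open>jet_space k p n\<close>, and d those of its H-projection.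
      Their difference \<beta> consists of the coordinates of the L^2(\<mu>)-projection f of the
      error e.\<close>
    define \<gamma> where "\<gamma> l = (\<Sum>s<r n. (\<integral>x. cnj (Av i x) * v s x \<partial>\<mu>) * (adj_mat ?G $$ (s, l) / det ?G))" for l
    define d where "d l = ip (Av i) (v l) / of_real (vv l)" for l
    define \<beta> where "\<beta> l = cnj (\<gamma> l) - d l" for l
    define f where "f = (\<Sum>l<r n. cscale (\<beta> l) (v l))"
    define e where "e = Av i - proj n (Av i)"
    have e: "e \<in> H" unfolding e_def by (intro mem_intros) auto
    have fjet: "f \<in> jet_space k p n" unfolding f_def by (rule sum_v_mem_jet)
    note fH = jet_mem[OF fjet]
    have rmn: "r m \<le> r n" by (rule r_mono[OF mn])
    have G: "?G \<in> carrier_mat (r n) (r n)" by simp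
    have det: "det ?G \<noteq> 0" by (rule det_gram[OF \<mu>(1)])
    have \<gamma>: "(\<Sum>l<r n. \<gamma> l * ?G $$ (l, t)) = (\<integral>x. cnj (Av i x) * v t x \<partial>\<mu>)" if "t < r n" for t
    proof -
      let ?u = "\<lambda>s. \<integral>x. cnj (Av i x) * v s x \<partial>\<mu>"
      have "(\<Sum>l<r n. \<gamma> l * ?G $$ (l, t)) = (\<Sum>l<r n. \<Sum>s<r n. ?u s * (adj_mat ?G $$ (s, l) * ?G $$ (l, t)) / det ?G)"
        unfolding \<gamma>_def sum_distrib_right by (simp add: mult.assoc del: gram_index)
      also have "\<dots> = (\<Sum>s<r n. ?u s * (\<Sum>l<r n. adj_mat ?G $$ (s, l) * ?G $$ (l, t)) / det ?G)"
        by (subst sum.swap) (simp add: sum_distrib_left sum_divide_distrib del: gram_index)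
      also have "\<dots> = (\<Sum>s<r n. if s = t then ?u t else 0)"
        by (rule sum.cong) (use that det in \<open>auto simp: adj_mat_sum[OF G] simp del: gram_index\<close>)
      finally show ?thesis using that by simp
    qed
    have cnj_int: "cnj (\<integral>x. g x \<partial>\<mu>) = (\<integral>x. cnj (g x) \<partial>\<mu>)" for g :: "_ \<Rightarrow> complex" by simp
    have normal: "(\<integral>x. cnj (v t x) * f x \<partial>\<mu>) = (\<integral>x. cnj (v t x) * e x \<partial>\<mu>)" if t: "t < r n" for t
    proof -
      have herm: "?G $$ (t, l) = cnj (?G $$ (l, t))" if "l < r n" for l
        unfolding gram_index[OF t that] gram_index[OF that t] cnj_int
        by (rule Bochner_Integration.integral_cong) (simp_all add: mult.commute)
      have "(\<Sum>l<r n. ?G $$ (t, l) * cnj (\<gamma> l)) = cnj (\<Sum>l<r n. \<gamma> l * ?G $$ (l, t))"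
        unfolding cnj_sum by (rule sum.cong) (auto simp: herm mult.commute simp del: gram_index)
      also have "\<dots> = (\<integral>x. cnj (v t x) * Av i x \<partial>\<mu>)"
        unfolding \<gamma>[OF t] cnj_int
        by (rule Bochner_Integration.integral_cong) (simp_all add: mult.commute)
      finally have 1: "(\<Sum>l<r n. ?G $$ (t, l) * cnj (\<gamma> l)) = (\<integral>x. cnj (v t x) * Av i x \<partial>\<mu>)" .
      have 2: "(\<Sum>l<r n. ?G $$ (t, l) * d l) = (\<integral>x. cnj (v t x) * proj n (Av i) x \<partial>\<mu>)"
        unfolding proj_def d_def[symmetric] by (rule gram_sum[OF \<mu>(1) t])
      have "(\<integral>x. cnj (v t x) * f x \<partial>\<mu>) = (\<Sum>l<r n. ?G $$ (t, l) * \<beta> l)"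
        unfolding f_def by (rule gram_sum[OF \<mu>(1) t, symmetric])
      also have "\<dots> = (\<integral>x. cnj (v t x) * Av i x \<partial>\<mu>) - (\<integral>x. cnj (v t x) * proj n (Av i) x \<partial>\<mu>)"
        unfolding \<beta>_def right_diff_distrib sum_subtractf 1 2 ..
      also have "\<dots> = (\<integral>x. cnj (v t x) * Av i x - cnj (v t x) * proj n (Av i) x \<partial>\<mu>)"
        by (intro Bochner_Integration.integral_diff[symmetric] determining_integrable_mult \<mu>(1)) auto
      also have "\<dots> = (\<integral>x. cnj (v t x) * e x \<partial>\<mu>)" by (simp add: e_def right_diff_distrib)
      finally show ?thesis .
    qed
    \<comment> \<open>The estimate of e carries the power n + 1 of B1 / \<sigma>; one factor is
      absorbed in \<open>E\<close>, while the factorial stays at n + 1.\<close>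
    define \<delta> where "\<delta> = E * (B1 / \<sigma>) ^ n / sqrt (fact (n + 1))"
    have \<delta>: "0 \<le> \<delta>" using E \<open>0 \<le> B1\<close> \<sigma>_pos by (simp add: \<delta>_def)
    have "cmod (e x) \<le> \<delta>" if x: "dist p x \<le> B1" for x
    proof -
      let ?u = "x - p"
      have u: "norm ?u \<le> B1" using x by (simp add: dist_norm norm_minus_commute)
      have u2: "(norm ?u)\<^sup>2 / (2 * \<sigma>\<^sup>2) \<le> B1\<^sup>2 / (2 * \<sigma>\<^sup>2)"
        using power_mono[OF u, of 2] by (intro divide_right_mono) auto
      have "cmod (e (p + ?u)) \<le> wt p (p + ?u) * (nrm (Av i) *
        ((norm ?u / \<sigma>) ^ Suc n * exp ((norm ?u)\<^sup>2 / (2 * \<sigma>\<^sup>2)) / sqrt (fact (Suc n))))"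
        unfolding e_def by (rule diff_proj_le) simp
      also have "\<dots> \<le> M * (nrm (Av i) * ((B1 / \<sigma>) ^ Suc n * exp (B1\<^sup>2 / (2 * \<sigma>\<^sup>2)) / sqrt (fact (Suc n))))"
        using M[OF x] M0 u u2 \<sigma>_pos \<open>0 \<le> B1\<close> nrm_nonneg[OF Av_mem[of i]]
        by (intro mult_mono divide_right_mono power_mono mult_nonneg_nonneg) (auto simp del: power_Suc intro: divide_right_mono)
      also have "\<dots> = \<delta>" by (simp add: \<delta>_def E_def)
      finally show ?thesis by simp
    qed
    then have ae: "AE x in \<mu>. cmod (e x) \<le> \<delta>" using supp by (auto elim: eventually_mono)
    have L1: "(\<integral>x. cmod (f x) \<partial>\<mu>) \<le> \<delta>"
      by (rule L1_projection_le[OF \<mu> e \<delta> ae f_def normal])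
    \<comment> \<open>By orthogonality in H, \<open>proj m\<close> just cuts the sum off, so the
      coefficients of index below \<open>r m\<close> are read from \<open>proj m f\<close>.\<close>
    have projf: "proj m f = (\<Sum>l<r m. cscale (\<beta> l) (v l))"
      unfolding proj_def
    proof (rule sum.cong)
      fix l assume l: "l \<in> {..<r m}"
      have "ip f (v l) = \<beta> l * of_real (vv l)" using l rmn unfolding f_def by (simp add: ip_sum_v)
      then have "ip f (v l) / of_real (vv l) = \<beta> l" using vv_pos[of l] by (simp del: vv_pos)
      then show "cscale (ip f (v l) / of_real (vv l)) (v l) = cscale (\<beta> l) (v l)" by (simp only:)
    qed simp
    have "ennreal (\<integral>x. cmod (proj m f x) \<partial>\<nu>) = (\<integral>\<^sup>+x. ennreal (cmod (proj m f x)) \<partial>\<nu>)"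
      by (intro nn_integral_eq_integral[symmetric] integrable_norm determining_integrable[OF \<nu>]) auto
    also have "\<dots> = (\<integral>\<^sup>+x. ennreal (cmod (proj m f x)) * indicator ?A x \<partial>lborel)"
    proof -
      have "proj m f \<in> borel_measurable borel"
        by (rule mem_borel_measurable[OF proj_mem])
      then show ?thesis unfolding \<nu>_def by (subst nn_integral_density) (auto simp: mult.commute)
    qed
    also have "\<dots> \<le> ennreal (C2 * (2 * B) ^ n) * (\<integral>\<^sup>+y. ennreal (cmod (f y)) * indicator (rectangle a w) y \<partial>lborel)"
      by (rule extr[OF mn fjet])
    also have "\<dots> \<le> ennreal (C2 * (2 * B) ^ n) * (ennreal (1 / c0) * (\<integral>\<^sup>+x. ennreal (cmod (f x)) \<partial>\<mu>))"
    proof (intro mult_left_mono low)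
      note [measurable] = mem_borel_measurable[OF fH]
      show "(\<lambda>y. ennreal (cmod (f y))) \<in> borel_measurable borel" by measurable
    qed simp
    also have "(\<integral>\<^sup>+x. ennreal (cmod (f x)) \<partial>\<mu>) = ennreal (\<integral>x. cmod (f x) \<partial>\<mu>)"
      by (intro nn_integral_eq_integral integrable_norm determining_integrable[OF \<mu>(1)] fH) auto
    also have "ennreal (C2 * (2 * B) ^ n) * (ennreal (1 / c0) * ennreal (\<integral>x. cmod (f x) \<partial>\<mu>)) =
        ennreal (C2 * (2 * B) ^ n * (1 / c0 * (\<integral>x. cmod (f x) \<partial>\<mu>)))"
    proof -
      have nn: "0 \<le> C2 * (2 * B) ^ n" "0 \<le> 1 / c0" "0 \<le> (\<integral>x. cmod (f x) \<partial>\<mu>)" using C2(1) B \<open>0 < c0\<close> by auto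
      show ?thesis by (simp only: ennreal_mult[symmetric] nn mult_nonneg_nonneg)
    qed
    finally have "(\<integral>x. cmod (proj m f x) \<partial>\<nu>) \<le> C2 * (2 * B) ^ n * (1 / c0 * (\<integral>x. cmod (f x) \<partial>\<mu>))"
      using C2(1) B \<open>0 < c0\<close> by (subst (asm) ennreal_le_iff) auto
    also have "\<dots> \<le> C2 * (2 * B) ^ n * (1 / c0 * \<delta>)"
      using L1 C2(1) B \<open>0 < c0\<close> by (intro mult_left_mono) auto
    finally have L1A: "(\<integral>x. cmod (proj m f x) \<partial>\<nu>) \<le> C2 * (2 * B) ^ n * (1 / c0 * \<delta>)" .
    have "cmod (\<beta> j) \<le> C1 * (\<integral>x. cmod (proj m f x) \<partial>\<nu>)"
      unfolding projf by (rule C1(2)[OF j])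
    also have "\<dots> \<le> C1 * (C2 * (2 * B) ^ n * (1 / c0 * \<delta>))"
      by (rule mult_left_mono[OF L1A C1(1)])
    finally have \<beta>j: "cmod (\<beta> j) \<le> C1 * (C2 * (2 * B) ^ n * (1 / c0 * \<delta>))" .
    have "ip (v j) (Av i) / of_real (vv i) - limit_mat \<mu> n i j = - (of_real (vv j / vv i) * cnj (\<beta> j))"
    proof -
      have "cnj (d j) * of_real (vv j) = ip (v j) (Av i)"
        using vv_pos[of j] ip_cnj[OF Av_mem[of i] v_mem[of j]] by (simp add: d_def del: vv_pos)
      then have "ip (v j) (Av i) / of_real (vv i) = of_real (vv j / vv i) * cnj (d j)" by (simp add: mult.commute)
      moreover have "limit_mat \<mu> n i j = \<gamma> j * of_real (vv j / vv i)"
        unfolding limit_mat_def \<gamma>_def ..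
      ultimately show ?thesis by (simp add: \<beta>_def algebra_simps del: of_real_divide)
    qed
    then have "cmod (ip (v j) (Av i) / of_real (vv i) - limit_mat \<mu> n i j) = vv j / vv i * cmod (\<beta> j)"
      using vv_pos[of i] vv_pos[of j] by (simp add: norm_mult norm_divide del: vv_pos)
    also have "\<dots> \<le> vv j / vv i * (C1 * (C2 * (2 * B) ^ n * (1 / c0 * \<delta>)))"
      by (rule mult_left_mono[OF \<beta>j]) (simp add: less_imp_le)
    also have "\<dots> = C * (2 * B * B1 / \<sigma>) ^ n / sqrt (fact (n + 1))"
    proof -
      have "(2 * B * B1 / \<sigma>) ^ n = (2 * B) ^ n * (B1 / \<sigma>) ^ n"
        by (simp only: power_mult_distrib[symmetric] times_divide_eq_right)
      then show ?thesis by (simp only: C_def \<delta>_def) (simp add: mult_ac)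
    qed
    finally show ?thesis .
  qed
  ultimately show ?thesis by blast
qed

text \<open>F is real, so the generator commutes with complex conjugation.\<close>

lemma W_matrix_index:
  assumes "i < l" "t < N"
  shows "W_matrix F v l N x $$ (i, t) = cnj (Av i (x t))"
  using assms by (simp add: W_matrix_def partial_deriv_cnj Av_def koopman_gen_def)

text \<open>The determinant of the empirical Gram matrix converges to that of
  \<open>gram \<mu> (r n)\<close>, which is not 0. Hence V has full row rank for all large N, and
  the closed formula applies from then on.\<close>

lemma A_hat_tendsto:
  assumes \<mu>: "determining \<mu>" and mn: "r m \<le> r n" and ij: "i < r m" "j < r m"
    and limA: "\<And>i l. (\<lambda>N. (\<Sum>t<N. cnj (Av i (x t)) * v l (x t)) / of_nat N) \<longlonglongrightarrow> (\<integral>x. cnj (Av i x) * v l x \<partial>\<mu>)"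
    and limv: "\<And>i l. (\<lambda>N. (\<Sum>t<N. cnj (v i (x t)) * v l (x t)) / of_nat N) \<longlonglongrightarrow> (\<integral>x. cnj (v i x) * v l x \<partial>\<mu>)"
  shows "(\<lambda>N. A_hat ip F v (r m) (r n) N x $$ (i, j)) \<longlonglongrightarrow> limit_mat \<mu> n i j"
proof -
  define S where "S N = mat (r n) (r n) (\<lambda>(i, j). (\<Sum>t<N. V_matrix v (r n) N x $$ (i, t) * cnj (V_matrix v (r n) N x $$ (j, t))) / of_nat N)" for N
  let ?G = "gram \<mu> (r n)"
  have S: "S N \<in> carrier_mat (r n) (r n)" for N by (simp add: S_def)
  have Slim: "(\<lambda>N. S N $$ (s, t)) \<longlonglongrightarrow> ?G $$ (s, t)" if "s < r n" "t < r n" for s t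
    using limv[of s t] that by (simp add: S_def V_matrix_def)
  note detlim = tendsto_det[OF S gram_carrier Slim] and adjlim = tendsto_adj_mat[OF S gram_carrier Slim]
  have det: "det ?G \<noteq> 0" by (rule det_gram[OF \<mu>])
  have ev: "\<forall>\<^sub>F N in sequentially. det (S N) \<noteq> 0 \<and> N > 0"
    using tendsto_imp_eventually_ne[OF detlim det] eventually_gt_at_top[of 0] by (rule eventually_conj)
  let ?T = "\<lambda>N. (\<Sum>l<r n. (\<Sum>t<N. cnj (Av i (x t)) * v l (x t)) / of_nat N * (adj_mat (S N) $$ (l, j) / det (S N))) * of_real (vv j / vv i)"
  have "?T \<longlonglongrightarrow> limit_mat \<mu> n i j"
    unfolding limit_mat_def
    using ij mn by (intro tendsto_mult tendsto_sum tendsto_const tendsto_divide limA detlim adjlim det) auto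
  moreover have "\<forall>\<^sub>F N in sequentially. ?T N = A_hat ip F v (r m) (r n) N x $$ (i, j)"
    using ev
  proof eventually_elim
    case (elim N)
    have "A_hat ip F v (r m) (r n) N x $$ (i, j) = (\<Sum>l<r n. (\<Sum>t<N. W_matrix F v (r m) N x $$ (i, t) *
        cnj (V_matrix v (r n) N x $$ (l, t))) / of_nat N * (adj_mat (S N) $$ (l, j) / det (S N))) * of_real (vv j / vv i)"
      using elim ij mn vv_pos by (intro A_hat_index) (auto simp: ip_v S_def less_imp_neq[symmetric] simp del: vv_pos)
    also have "\<dots> = ?T N"
      using ij by (intro arg_cong2[where f = "(*)"] refl sum.cong arg_cong2[where f = "(/)"]) (auto simp: W_matrix_index V_matrix_def)
    finally show ?case by simp
  qed
  ultimately show ?thesis by (rule Lim_transform_eventually)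
qed

text \<open>The number of rows is that of \<open>the (mat_inverse ...)\<close>, which is known only
  once this inverse has been computed.\<close>

lemma A_hat_carrier: "A_hat ip F v (r m) (r n) N x \<in> carrier_mat (r m) (r m)"
proof -
  have gram: "gram_matrix ip v (r m) = mat (r m) (r m) (\<lambda>(i, j). if i = j then of_real (vv i) else 0)"
    unfolding gram_matrix_def by (rule cong_mat) (auto simp: ip_v)
  have "the (mat_inverse (gram_matrix ip v (r m))) = mat (r m) (r m) (\<lambda>(i, j). if i = j then 1 / of_real (vv i) else 0)"
    unfolding gram by (rule mat_inverse_diag) (use vv_pos in \<open>simp add: less_imp_neq[symmetric] del: vv_pos\<close>)
  then show ?thesis by (simp add: A_hat_def first_cols_def)
qed

end


section \<open>Reduction of the hypotheses to the abstract setting, and conclusion\<close>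

lemma pos_essinf_lower_bound:
  fixes \<rho> :: "'a::euclidean_space \<Rightarrow> real"
  assumes "R \<in> sets borel" and pos: "essinf (restrict_space lborel R) (\<lambda>x. ereal (\<rho> x)) > 0"
  shows "\<exists>c0>0. AE x in lborel. x \<in> R \<longrightarrow> c0 \<le> \<rho> x"
proof -
  define s where "s = esssup (restrict_space lborel R) (\<lambda>x. - ereal (\<rho> x))"
  have "s < 0" using pos by (simp add: essinf_def s_def)
  \<comment> \<open>The essential supremum may be minus infinity; any negative real then serves as
    an upper bound.\<close>
  obtain d where d: "s \<le> ereal d" "d < 0"
  proof (cases s)
    case (real d)
    then show ?thesis using \<open>s < 0\<close> by (intro that[of d]) auto
  qed (use \<open>s < 0\<close> that[of "- 1"] in auto)
  have "AE x in restrict_space lborel R. - ereal (\<rho> x) \<le> s" unfolding s_def by (rule esssup_AE)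
  then have "AE x in lborel. x \<in> R \<longrightarrow> - ereal (\<rho> x) \<le> s"
    using assms(1) by (subst (asm) AE_restrict_space_iff) auto
  then have "AE x in lborel. x \<in> R \<longrightarrow> - d \<le> \<rho> x"
  proof eventually_elim
    case (elim x)
    show ?case
    proof
      assume "x \<in> R"
      then have "ereal (- \<rho> x) \<le> s" using elim by simp
      also note d(1)
      finally show "- d \<le> \<rho> x" by simp
    qed
  qed
  then show ?thesis using d(2) by (intro exI[of _ "- d"]) auto
qed

lemma exponential_or_gaussian:
  assumes "complex_rkhs H ip k" "\<sigma> > 0" "k = exponential_kernel \<sigma> b \<or> k = gaussian_kernel \<sigma>"
  shows "\<exists>c b'. gaussian_rkhs H ip k \<sigma> c b'"
  using assms(3)
proof
  assume "k = exponential_kernel \<sigma> b"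
  then have "gaussian_rkhs H ip k \<sigma> 0 b"
    unfolding gaussian_rkhs_def gaussian_rkhs_axioms_def using assms(1,2) by (auto simp: exponential_kernel_def)
  then show ?thesis by blast
next
  assume k: "k = gaussian_kernel \<sigma>"
  have "- (norm (x - y))\<^sup>2 / (2 * \<sigma>\<^sup>2) = (x \<bullet> y - ((norm x)\<^sup>2 + (norm y)\<^sup>2) / 2) / \<sigma>\<^sup>2" for x y :: "real ^ 'b"
  proof -
    have "x \<bullet> y - ((norm x)\<^sup>2 + (norm y)\<^sup>2) / 2 = - (norm (x - y))\<^sup>2 / 2"
      unfolding power2_norm_eq_inner by (simp add: inner_diff_left inner_diff_right inner_commute field_simps)
    then show ?thesis by simp
  qed
  then have "gaussian_rkhs H ip k \<sigma> 1 0"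
    unfolding gaussian_rkhs_def gaussian_rkhs_axioms_def using assms(1,2) by (auto simp: k gaussian_kernel_def)
  then show ?thesis by blast
qed

theorem theorem6p15:
  fixes \<sigma> :: real
    and b p a r :: "real ^ 'd"
    and k :: "real ^ 'd \<Rightarrow> real ^ 'd \<Rightarrow> complex"
    and H :: "(real ^ 'd \<Rightarrow> complex) set"
    and ip :: "(real ^ 'd \<Rightarrow> complex) \<Rightarrow> (real ^ 'd \<Rightarrow> complex) \<Rightarrow> complex"
    and F :: "real ^ 'd \<Rightarrow> real ^ 'd"
    and v :: "nat \<Rightarrow> real ^ 'd \<Rightarrow> complex"
    and \<rho> :: "real ^ 'd \<Rightarrow> real"
    and \<mu> :: "(real ^ 'd) measure"
    and M :: "'w measure"
    and X :: "nat \<Rightarrow> 'w \<Rightarrow> real ^ 'd"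
    and B1 B2 :: real
    and dimV :: "nat \<Rightarrow> nat"
  assumes "\<sigma> > 0"
    and "k = exponential_kernel \<sigma> b \<or> k = gaussian_kernel \<sigma>"
    and "complex_rkhs H ip k"
    and "Cinf_fun F"
    and "F p = 0"
    and "(\<Union>n. jet_space k p n) \<subseteq> koopman_dom H F"
    and "adapted_orthogonal_basis ip (jet_space k p) v"
    and "\<And>n. dimV n = cfun.dim (jet_space k p n)"
    and "\<rho> \<in> borel_measurable borel"
    and "\<And>x. \<rho> x \<ge> 0"
    and "compact (supp \<rho>)"
    and "\<mu> = density lborel (\<lambda>x. ennreal (\<rho> x))"
    and "prob_space \<mu>"
    and "\<And>i. r $ i > 0"
    and "essinf (restrict_space lborel (rectangle a r)) (\<lambda>x. ereal (\<rho> x)) > 0"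
    and "prob_space M"
    and "prob_space.indep_vars M (\<lambda>_. borel) X UNIV"
    and "\<And>j. distr M borel (X j) = \<mu>"
    and "B1 = (SUP x\<in>supp \<rho>. norm (x - p))"
    and "B2 = (SUP i. 1 + \<bar>a $ i - p $ i\<bar> / r $ i)"
  shows "\<forall>m. \<exists>C>0. \<forall>n\<ge>max m 1. AE \<omega> in M.
    limsup (\<lambda>N. ereal (frobenius_norm
      (op_matrix (adjoint_op H ip (koopman_dom H F) (koopman_gen F)) v (dimV m)
        - A_hat ip F v (dimV m) (dimV n) N (\<lambda>j. X j \<omega>))))
    \<le> ereal (C * real n ^ (m + CARD('d)) / sqrt (fact (n + 1)) * (2 * B1 * B2 / \<sigma>) ^ n)"
proof -
  note [measurable] = assms(9)
  obtain c b' where gauss: "gaussian_rkhs H ip k \<sigma> c b'"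
    using exponential_or_gaussian[OF assms(3,1,2)] by blast
  obtain L where L: "\<And>z. norm z \<le> 1 \<Longrightarrow> norm (F (p + z)) \<le> L * norm z"
    using linear_bound_if_Ck_1[of F p] assms(4,5) unfolding Cinf_fun_def by blast
  interpret K: koopman_jets H ip k \<sigma> c b' F p v L
    using gauss L assms(6,7) unfolding koopman_jets_def koopman_jets_axioms_def by auto
  have dimV: "dimV n = K.r n" for n by (simp add: assms(8) K.r_def)
  let ?R = "rectangle a r"
  have [measurable]: "?R \<in> sets borel" unfolding rectangle_eq_cbox by simp
  obtain c0 where c0: "c0 > 0" and c0_le: "AE x in lborel. x \<in> ?R \<longrightarrow> c0 \<le> \<rho> x"
    using pos_essinf_lower_bound[OF _ assms(15)] by auto
  have ae\<mu>: "(AE x in \<mu>. P x) \<longleftrightarrow> (AE x in lborel. 0 < \<rho> x \<longrightarrow> P x)" for P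
    unfolding assms(12) by (subst AE_density) auto
  have in_supp: "x \<in> supp \<rho>" if "0 < \<rho> x" for x
    using that closure_subset[of "{x. \<rho> x \<noteq> 0}"] by (auto simp: supp_def)
  have supp: "AE x in \<mu>. x \<in> supp \<rho>" unfolding ae\<mu> using in_supp by simp
  have det: "K.determining \<mu>"
  proof (rule K.determiningI[where K = "supp \<rho>" and a = a and e = r])
    show "finite_measure \<mu>" using assms(13) by (simp add: prob_space.finite_measure)
    show "sets \<mu> = sets borel" by (simp add: assms(12))
    show "AE x in lborel. x \<in> ?R \<longrightarrow> P x" if "AE x in \<mu>. P x" for P
      using that[unfolded ae\<mu>] c0_le by eventually_elim (use c0 in auto)
  qed (use supp assms(11,14) in auto)
  have low: "(\<integral>\<^sup>+x. g x * indicator ?R x \<partial>lborel) \<le> ennreal (1 / c0) * (\<integral>\<^sup>+x. g x \<partial>\<mu>)"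
    if [measurable]: "g \<in> borel_measurable borel" for g
  proof -
    have "(\<integral>\<^sup>+x. g x * indicator ?R x \<partial>lborel) \<le> (\<integral>\<^sup>+x. ennreal (1 / c0) * (ennreal (\<rho> x) * g x) \<partial>lborel)"
    proof (rule nn_integral_mono_AE)
      show "AE x in lborel. g x * indicator ?R x \<le> ennreal (1 / c0) * (ennreal (\<rho> x) * g x)"
        using c0_le
      proof eventually_elim
        case (elim x)
        show ?case
        proof (cases "x \<in> ?R")
          case True
          then have "1 \<le> 1 / c0 * \<rho> x" using elim c0 by (simp add: field_simps)
          then have "1 * g x \<le> ennreal (1 / c0 * \<rho> x) * g x"
            by (intro mult_right_mono) (auto simp: ennreal_1[symmetric] simp del: ennreal_1)
          also have "\<dots> = ennreal (1 / c0) * (ennreal (\<rho> x) * g x)"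
            using c0 assms(10) by (subst ennreal_mult) (auto simp: mult.assoc)
          finally show ?thesis using True by simp
        qed simp
      qed
    qed
    also have "\<dots> = ennreal (1 / c0) * (\<integral>\<^sup>+x. g x \<partial>\<mu>)"
      unfolding assms(12) by (subst nn_integral_density) (auto simp: nn_integral_cmult)
    finally show ?thesis .
  qed
  have bdd: "bdd_above ((\<lambda>x. norm (x - p)) ` supp \<rho>)"
    by (intro bounded_imp_bdd_above compact_imp_bounded compact_continuous_image continuous_intros assms(11))
  have B1: "dist p x \<le> B1" if "x \<in> supp \<rho>" for x
    unfolding assms(19) using cSUP_upper[OF that bdd] by (simp add: dist_norm norm_minus_commute)
  have suppB1: "AE x in \<mu>. dist p x \<le> B1" using supp by (rule eventually_mono) (rule B1)
  \<comment> \<open>A point of the support is needed for B1 \<ge> 0, since the supremum over the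
    empty set is unspecified.\<close>
  have "supp \<rho> \<noteq> {}"
  proof
    assume "supp \<rho> = {}"
    then have "AE x in \<mu>. False" using supp by simp
    then show False using prob_space.AE_const[OF assms(13)] by simp
  qed
  then have B1_0: "0 \<le> B1" using B1 zero_le_dist order_trans by blast
  have B2: "1 + \<bar>a $ i - p $ i\<bar> / r $ i \<le> B2" for i
    unfolding assms(20) by (rule cSUP_upper) auto
  have B2_1: "1 \<le> B2" using B2[of undefined] divide_nonneg_pos[OF abs_ge_zero assms(14), of "a $ undefined - p $ undefined" undefined] by linarith
  have aB: "\<bar>a $ i - p $ i\<bar> \<le> (B2 - 1) * r $ i" for i
  proof -
    have "\<bar>a $ i - p $ i\<bar> / r $ i \<le> B2 - 1" using B2[of i] by linarith
    then show ?thesis by (simp add: pos_divide_le_eq assms(14))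
  qed
  show ?thesis
  proof
    fix m
    let ?A = "op_matrix (adjoint_op H ip (koopman_dom H F) (koopman_gen F)) v (K.r m)"
    let ?E = "\<lambda>n N \<omega>. A_hat ip F v (K.r m) (K.r n) N (\<lambda>j. X j \<omega>)" and ?q = "2 * B2 * B1 / \<sigma>"
    have "\<forall>i\<in>{..<K.r m}. \<forall>j\<in>{..<K.r m}. \<exists>C\<ge>0. \<forall>n\<ge>m. cmod (?A $$ (i, j) - K.limit_mat \<mu> n i j) \<le> C * ?q ^ n / sqrt (fact (n + 1))"
    proof (intro ballI)
      fix i j assume "i \<in> {..<K.r m}" "j \<in> {..<K.r m}"
      then have ij: "i < K.r m" "j < K.r m" by auto
      show "\<exists>C\<ge>0. \<forall>n\<ge>m. cmod (?A $$ (i, j) - K.limit_mat \<mu> n i j) \<le> C * ?q ^ n / sqrt (fact (n + 1))"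
        unfolding K.op_matrix_adjoint[OF ij]
        by (rule K.limit_error[OF det assms(13) c0 low suppB1 B1_0 B2_1 assms(14) aB ij])
    qed
    \<comment> \<open>The constants depend on the entry but not on n; their sum serves for all
      entries at once.\<close>
    then obtain Cf where Cf: "\<And>i j. i < K.r m \<Longrightarrow> j < K.r m \<Longrightarrow> 0 \<le> Cf i j"
      "\<And>i j n. i < K.r m \<Longrightarrow> j < K.r m \<Longrightarrow> n \<ge> m \<Longrightarrow>
        cmod (?A $$ (i, j) - K.limit_mat \<mu> n i j) \<le> Cf i j * ?q ^ n / sqrt (fact (n + 1))"
      unfolding bchoice_iff by (metis (no_types, lifting) lessThan_iff)
    define C where "C = (\<Sum>i<K.r m. \<Sum>j<K.r m. Cf i j)"
    have C: "0 \<le> C" unfolding C_def using Cf(1) by (auto intro!: sum_nonneg)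
    have Cf_le: "Cf i j \<le> C" if "i < K.r m" "j < K.r m" for i j
    proof -
      have "Cf i j \<le> (\<Sum>j<K.r m. Cf i j)" using that Cf(1) by (intro member_le_sum) auto
      also have "\<dots> \<le> C" unfolding C_def
        using that Cf(1) by (intro member_le_sum[of i "{..<K.r m}" "\<lambda>i. \<Sum>j<K.r m. Cf i j"]) (auto intro!: sum_nonneg)
      finally show ?thesis .
    qed
    \<comment> \<open>The factor \<open>real (K.r m)\<close> passes from entries to the Frobenius
      norm; adding 1 makes the constant strictly positive even when C = 0.\<close>
    have "AE \<omega> in M. limsup (\<lambda>N. ereal (frobenius_norm (?A - ?E n N \<omega>)))
      \<le> ereal ((real (K.r m) * C + 1) * real n ^ (m + CARD('d)) / sqrt (fact (n + 1)) * (2 * B1 * B2 / \<sigma>) ^ n)"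
      if n: "max m 1 \<le> n" for n
    proof -
      have slln: "AE \<omega> in M. (\<lambda>N. (\<Sum>t<N. cnj (g (X t \<omega>)) * h (X t \<omega>)) / of_nat N) \<longlonglongrightarrow> (\<integral>x. cnj (g x) * h x \<partial>\<mu>)"
        if gh: "g \<in> H" "h \<in> H" for g h
      proof -
        obtain Bg where B: "0 \<le> Bg" and bdg: "AE x in \<mu>. cmod (g x) \<le> Bg"
          using K.determining_bounded[OF det gh(1)] by blast
        obtain Bh where bdh: "AE x in \<mu>. cmod (h x) \<le> Bh"
          using K.determining_bounded[OF det gh(2)] by blast
        show ?thesis
        proof (rule prob_space.strong_law_complex[OF assms(16,17,18), where B = "Bg * Bh" and \<xi> = "\<lambda>x. cnj (g x) * h x"])
          show "(\<lambda>x. cnj (g x) * h x) \<in> borel_measurable borel"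
            using gh by (intro borel_measurable_continuous_onI continuous_intros K.continuous_on_mem)
          show "AE x in \<mu>. cmod (cnj (g x) * h x) \<le> Bg * Bh"
            using bdg bdh by eventually_elim (use B in \<open>auto simp: norm_mult intro!: mult_mono\<close>)
          show "integrable \<mu> (\<lambda>x. cnj (g x) * h x)" by (rule K.determining_integrable_mult[OF det gh])
        qed
      qed
      \<comment> \<open>Countably many pairs of indices, so one exceptional null set suffices for
        all empirical means.\<close>
      have "AE \<omega> in M. \<forall>i l. (\<lambda>N. (\<Sum>t<N. cnj (K.Av i (X t \<omega>)) * v l (X t \<omega>)) / of_nat N) \<longlonglongrightarrow> (\<integral>x. cnj (K.Av i x) * v l x \<partial>\<mu>)"
        "AE \<omega> in M. \<forall>i l. (\<lambda>N. (\<Sum>t<N. cnj (v i (X t \<omega>)) * v l (X t \<omega>)) / of_nat N) \<longlonglongrightarrow> (\<integral>x. cnj (v i x) * v l x \<partial>\<mu>)"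
        unfolding AE_all_countable by (intro allI slln K.v_mem K.Av_mem)+
      then show ?thesis
      proof eventually_elim
        case (elim \<omega>)
        have rmn: "K.r m \<le> K.r n" using n by (intro K.r_mono) simp
        let ?\<beta> = "C * ?q ^ n / sqrt (fact (n + 1))"
        have q: "0 \<le> ?q ^ n" using B1_0 B2_1 assms(1) by simp
        have "limsup (\<lambda>N. ereal (frobenius_norm (?A - ?E n N \<omega>)))
          \<le> ereal (real (K.r m) * ?\<beta>)"
        proof (rule frobenius_norm_limsup_le[where L = "K.limit_mat \<mu> n"])
          show "?A \<in> carrier_mat (K.r m) (K.r m)" by (simp add: op_matrix_def)
          show "?E n N \<omega> \<in> carrier_mat (K.r m) (K.r m)" for N
            by (rule K.A_hat_carrier)
          fix i j assume ij: "i < K.r m" "j < K.r m"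
          show "(\<lambda>N. ?E n N \<omega> $$ (i, j)) \<longlonglongrightarrow> K.limit_mat \<mu> n i j"
            by (rule K.A_hat_tendsto[OF det rmn ij]) (use elim in blast)+
          have "cmod (?A $$ (i, j) - K.limit_mat \<mu> n i j) \<le> Cf i j * ?q ^ n / sqrt (fact (n + 1))"
            using n by (intro Cf(2) ij) simp
          also have "\<dots> \<le> ?\<beta>" using Cf_le[OF ij] q by (intro divide_right_mono mult_right_mono) auto
          finally show "cmod (?A $$ (i, j) - K.limit_mat \<mu> n i j) \<le> ?\<beta>" .
        qed (use C q in auto)
        also have "real (K.r m) * ?\<beta> \<le> (real (K.r m) * C + 1) * real n ^ (m + CARD('d)) / sqrt (fact (n + 1)) * (2 * B1 * B2 / \<sigma>) ^ n"
        proof -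
          \<comment> \<open>Here n \<ge> 1 enters: the bound proved so far has no power of n, and
            one may be inserted because it is at least 1.\<close>
          have "1 \<le> real n ^ (m + CARD('d))" using n by (intro one_le_power) simp
          then have "real (K.r m) * C * 1 \<le> (real (K.r m) * C + 1) * real n ^ (m + CARD('d))"
            using C by (intro mult_mono) auto
          then have "real (K.r m) * C * (?q ^ n / sqrt (fact (n + 1))) \<le>
              (real (K.r m) * C + 1) * real n ^ (m + CARD('d)) * (?q ^ n / sqrt (fact (n + 1)))"
            using q by (intro mult_right_mono) auto
          then show ?thesis by (simp add: mult_ac)
        qed
        finally show ?case by simp
      qed
    qed
    then show "\<exists>C>0. \<forall>n\<ge>max m 1. AE \<omega> in M.
      limsup (\<lambda>N. ereal (frobenius_norm
        (op_matrix (adjoint_op H ip (koopman_dom H F) (koopman_gen F)) v (dimV m)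
          - A_hat ip F v (dimV m) (dimV n) N (\<lambda>j. X j \<omega>))))
      \<le> ereal (C * real n ^ (m + CARD('d)) / sqrt (fact (n + 1)) * (2 * B1 * B2 / \<sigma>) ^ n)"
      unfolding dimV using C by (intro exI[of _ "real (K.r m) * C + 1"]) (auto simp: add_nonneg_pos)
  qed
qed

end
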